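(* Assume $p\ge n^\kappa$ for some universal constant $\kappa>0$. Let $\mathcal A$ be a subclass of $\mathcal A^{\rm si}(a,d)$ such that the following hold for every $A\in\mathcal A$: there exist a sequence of constants $B_n\ge1$ and a universal constant $\gamma_1\ge1$ with $\|v^\top X_t\|_{\psi_{\gamma_1}}\le B_n$ for all $t\in[n]$ and $v\in\mathcal V\{A^K(A)\}$; and there exists a universal constant $K_4>0$ with $\mathrm{Var}(n^{-1/2}\sum_{t=1}^nv^\top X_t)\ge K_4$ for any $v\in\mathcal V\{A^K(A)\}$ (the constants $B_n,\gamma_1,K_4$ being common to all $A\in\mathcal A$). Then $$\rho_n(\mathcal A)\lesssim\frac{a(d\log p)^{1/2}}{n}+\frac{B_n(D_nD_n^* )^{1/3}(d\log p)^{7/6}}{n^{1/6}},$$ where $D_n$ and $D_n^*$ are the maximum degrees of the first-degree and second-degree connections in the dependency graph generated by the sequence $\{X_t\}_{t=1}^n$, respectively.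
   Context: Asymptotic setting: for each $n$, $\mathcal X_n=\{X_1,\dots,X_n\}$ is a sequence of (possibly dependent and non-stationary) random vectors in $\mathbb R^p$ with $\mathbb E(X_t)=0$; $p$ and the distribution of the sequence may depend on $n$. A "universal constant" is a constant not depending on $n$ or on any quantity allowed to vary with $n$. For positive sequences, $a_n\lesssim b_n$ means $\limsup_{n\to\infty}a_n/b_n\le c$ for some universal constant $c>0$. $[m]=\{1,\dots,m\}$. $S_{n,x}=n^{-1/2}\sum_{t=1}^nX_t$, $\Xi=\mathrm{Cov}(S_{n,x})$, $G\sim N(0,\Xi)$, and for a class $\mathcal A$ of Borel subsets of $\mathbb R^p$, $\rho_n(\mathcal A)=\sup_{A\in\mathcal A}|\mathbb P(S_{n,x}\in A)-\mathbb P(G\in A)|$. For $\gamma>0$ and a real random variable $\xi$, $\|\xi\|_{\psi_\gamma}=\inf\{\lambda>0:\mathbb E[\exp\{(|\xi|/\lambda)^{\gamma}\}-1]\le 1\}$. Dependency graph: an undirected graph $G_n=(V_n,E_n)$ with node set $V_n=[n]$, node $t$ denoting $X_t$, and a set $E_n$ of undirected edges such that $X_t$ and $X_s$ are independent whenever $(t,s)\notin E_n$, with the convention $(t,t)\in E_n$ for all $t\in V_n$. Let $\mathcal N_t=\{s\in V_n:(t,s)\in E_n\}$, $D_n=\max_{t\in[n]}\sum_{s=1}^nI\{(t,s)\in E_n\}$, $D_n^*=\max_{t\in[n]}\sum_{s=1}^nI\{s\in\cup_{\ell\in\mathcal N_t}\mathcal N_\ell\}$, where $I(\cdot)$ is the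 indicator function. Simple convex sets: for a closed convex $A\subset\mathbb R^p$, the support function is $\mathcal S_A(v)=\sup\{w^\top v:w\in A\}$, $v\in\mathbb S^{p-1}$ (unit sphere). A set $A^K$ is $K$-generated if it is the intersection of $K$ half-spaces; $\mathcal V(A^K)$ is the set of the $K$ unit normal vectors outward to its facets, so $A^K=\bigcap_{v\in\mathcal V(A^K)}\{w:w^\top v\le\mathcal S_{A^K}(v)\}$. For $\epsilon>0$ (and likewise $\epsilon=0$), $A^{K,\epsilon}=\bigcap_{v\in\mathcal V(A^K)}\{w:w^\top v\le\mathcal S_{A^K}(v)+\epsilon\}$. For constants $a\ge0$, $d>0$, $\mathcal A^{\rm si}(a,d)$ is the class of all sets $A\subset\mathbb R^p$ for which there is a $K$-generated $A^K$ with $K\le(pn)^d$ and $A^K\subset A\subset A^{K,\epsilon}$, $\epsilon=a/n$. For each $A\in\mathcal A^{\rm si}(a,d)$, $A^K(A)$ denotes a fixed such approximating set $A^K$.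
   Formalization: In the dependency graph, families of the X_t indexed by node sets with no edge between them are required to be independent, not merely X_t and X_s for each non-edge; with pairwise independence alone the claim is false (products of independent signs). *)

theory Defs
  imports "HOL-Probability.Probability"
begin

text \<open>
  The dimension is a number that varies with the sample size, so a vector of dimension \<open>p\<close>
  is an extensional function on \<open>{..<p}\<close>. Coordinates are numbered from 0, time points from 1.
\<close>

definition vecs :: "nat \<Rightarrow> (nat \<Rightarrow> real) set" where
  "vecs p = ({..<p} \<rightarrow>\<^sub>E UNIV)"

definition borel_vec :: "nat \<Rightarrow> (nat \<Rightarrow> real) measure" where
  "borel_vec p = (\<Pi>\<^sub>M j\<in>{..<p}. borel)"

definition dot :: "nat \<Rightarrow> (nat \<Rightarrow> real) \<Rightarrow> (nat \<Rightarrow> real) \<Rightarrow> real" where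
  "dot p v w = (\<Sum>j<p. v j * w j)"

definition unit_vecs :: "nat \<Rightarrow> (nat \<Rightarrow> real) set" where
  "unit_vecs p = {v \<in> vecs p. dot p v v = 1}"


text \<open>
  The support function takes values in the extended reals: it is \<open>\<infinity>\<close> in directions in which
  the set is unbounded, and \<open>-\<infinity>\<close> for the empty set.
\<close>

definition support_fun :: "nat \<Rightarrow> (nat \<Rightarrow> real) set \<Rightarrow> (nat \<Rightarrow> real) \<Rightarrow> ereal" where
  "support_fun p A v = (SUP w\<in>A. ereal (dot p v w))"

definition enlarge :: "nat \<Rightarrow> (nat \<Rightarrow> real) set \<Rightarrow> (nat \<Rightarrow> real) set \<Rightarrow> real \<Rightarrow> (nat \<Rightarrow> real) set" where
  "enlarge p A V \<epsilon> = {w \<in> vecs p. \<forall>v\<in>V. ereal (dot p v w) \<le> support_fun p A v + ereal \<epsilon>}"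

text \<open>
  \<open>A\<close> is the intersection of \<open>K\<close> half-spaces with the unit outward normals \<open>V\<close>. The last
  condition says that no half-space can be dropped; if \<open>A\<close> has nonempty interior, this holds
  exactly when every \<open>v \<in> V\<close> is the outward normal of a facet of \<open>A\<close>, so that \<open>V\<close> is
  determined by \<open>A\<close>. Sets without interior points may have several such \<open>V\<close>, which is why
  \<open>V\<close> is carried along with \<open>A\<close>.
\<close>

definition K_generated :: "nat \<Rightarrow> nat \<Rightarrow> (nat \<Rightarrow> real) set \<Rightarrow> (nat \<Rightarrow> real) set \<Rightarrow> bool" where
  "K_generated p K A V \<longleftrightarrow>
     V \<subseteq> unit_vecs p \<and> finite V \<and> card V = K \<and>
     A = enlarge p A V 0 \<and>
     (\<forall>v\<in>V. enlarge p A (V - {v}) 0 \<noteq> A)"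

definition approximates ::
  "nat \<Rightarrow> nat \<Rightarrow> real \<Rightarrow> real \<Rightarrow> (nat \<Rightarrow> real) set \<Rightarrow> (nat \<Rightarrow> real) set \<Rightarrow> (nat \<Rightarrow> real) set \<Rightarrow> bool"
where
  "approximates p n a d A\<^sub>K V A \<longleftrightarrow>
     (\<exists>K. K_generated p K A\<^sub>K V \<and> real K \<le> (real p * real n) powr d) \<and>
     A\<^sub>K \<subseteq> A \<and> A \<subseteq> enlarge p A\<^sub>K V (a / real n)"

definition simple_convex :: "nat \<Rightarrow> nat \<Rightarrow> real \<Rightarrow> real \<Rightarrow> (nat \<Rightarrow> real) set set" where
  "simple_convex p n a d = {A. A \<subseteq> vecs p \<and> (\<exists>A\<^sub>K V. approximates p n a d A\<^sub>K V A)}"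


text \<open>
  The expectation is a nonnegative integral and the infimum is taken in the extended reals, so
  that the norm of a variable without the required exponential moments is \<open>\<infinity>\<close>.
\<close>

definition psi_norm :: "'a measure \<Rightarrow> real \<Rightarrow> ('a \<Rightarrow> real) \<Rightarrow> ereal" where
  "psi_norm M \<gamma> \<xi> =
     Inf {ereal u | u. u > 0 \<and> (\<integral>\<^sup>+ \<omega>. ennreal (exp ((\<bar>\<xi> \<omega>\<bar> / u) powr \<gamma>) - 1) \<partial>M) \<le> 1}"

definition norm_sum :: "nat \<Rightarrow> nat \<Rightarrow> (nat \<Rightarrow> 'a \<Rightarrow> nat \<Rightarrow> real) \<Rightarrow> 'a \<Rightarrow> nat \<Rightarrow> real" where
  "norm_sum p n X \<omega> = (\<lambda>j\<in>{..<p}. (\<Sum>t=1..n. X t \<omega> j) / sqrt (real n))"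

definition cov :: "'a measure \<Rightarrow> ('a \<Rightarrow> nat \<Rightarrow> real) \<Rightarrow> nat \<Rightarrow> nat \<Rightarrow> real" where
  "cov M Y i j =
     (LINT \<omega>|M. (Y \<omega> i - (LINT \<omega>'|M. Y \<omega>' i)) * (Y \<omega> j - (LINT \<omega>'|M. Y \<omega>' j)))"

text \<open>
  \<open>N\<close> is the law of \<open>L Z\<close>, where \<open>L L\<^sup>T = \<Xi>\<close> and \<open>Z\<close> is a vector of independent standard normal
  variables. This covers singular \<open>\<Xi>\<close>, for which there is no density.
\<close>

definition centered_normal :: "nat \<Rightarrow> (nat \<Rightarrow> nat \<Rightarrow> real) \<Rightarrow> (nat \<Rightarrow> real) measure \<Rightarrow> bool" where
  "centered_normal p \<Xi> N \<longleftrightarrow>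
     (\<exists>k (L :: nat \<Rightarrow> nat \<Rightarrow> real).
        (\<forall>i<p. \<forall>j<p. \<Xi> i j = (\<Sum>l<k. L i l * L j l)) \<and>
        N = distr (\<Pi>\<^sub>M l\<in>{..<k}. std_normal_distribution) (borel_vec p)
              (\<lambda>z. \<lambda>i\<in>{..<p}. \<Sum>l<k. L i l * z l))"

text \<open>
  The supremum is taken in the extended reals; all its members lie in \<open>[0, 1]\<close>.
\<close>

definition rho ::
  "nat \<Rightarrow> nat \<Rightarrow> 'a measure \<Rightarrow> (nat \<Rightarrow> 'a \<Rightarrow> nat \<Rightarrow> real) \<Rightarrow> (nat \<Rightarrow> real) measure
     \<Rightarrow> (nat \<Rightarrow> real) set set \<Rightarrow> ereal"
where
  "rho p n M X N \<A> =
     (SUP A\<in>\<A>. ereal \<bar>measure M {\<omega> \<in> space M. norm_sum p n X \<omega> \<in> A} - measure N A\<bar>)"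


text \<open>
  Independence of non-adjacent nodes is required, as usual for dependency graphs, for groups of
  nodes: two families of variables are independent if no edge joins their index sets. For
  singletons \<open>I = {t}\<close>, \<open>J = {s}\<close> this is independence of \<open>X t\<close> and \<open>X s\<close>. Pairwise independence
  alone does not suffice for a central limit theorem: the \<open>n = 2 ^ k - 1\<close> products of \<open>k\<close>
  independent signs over nonempty index sets are pairwise independent, but their sum is \<open>-1\<close>
  except with probability \<open>2\<close> to the power \<open>-k\<close>.
  Taking \<open>I\<close> and \<open>J\<close> disjoint is implied by the loops \<open>(t, t) \<in> E\<close>.
\<close>

definition dependency_graph ::
  "nat \<Rightarrow> nat \<Rightarrow> 'a measure \<Rightarrow> (nat \<Rightarrow> 'a \<Rightarrow> nat \<Rightarrow> real) \<Rightarrow> (nat \<times> nat) set \<Rightarrow> bool"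
where
  "dependency_graph p n M X E \<longleftrightarrow>
     E \<subseteq> {1..n} \<times> {1..n} \<and> sym E \<and> (\<forall>t\<in>{1..n}. (t, t) \<in> E) \<and>
     (\<forall>I J. I \<subseteq> {1..n} \<and> J \<subseteq> {1..n} \<and> (I \<times> J) \<inter> E = {} \<longrightarrow>
        prob_space.indep_var M
          (\<Pi>\<^sub>M t\<in>I. borel_vec p) (\<lambda>\<omega>. \<lambda>t\<in>I. X t \<omega>)
          (\<Pi>\<^sub>M s\<in>J. borel_vec p) (\<lambda>\<omega>. \<lambda>s\<in>J. X s \<omega>))"

definition nbhd :: "nat \<Rightarrow> (nat \<times> nat) set \<Rightarrow> nat \<Rightarrow> nat set" where
  "nbhd n E t = {s \<in> {1..n}. (t, s) \<in> E}"

definition degree1 :: "nat \<Rightarrow> (nat \<times> nat) set \<Rightarrow> nat" where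
  "degree1 n E = Max ((\<lambda>t. card (nbhd n E t)) ` {1..n})"

definition degree2 :: "nat \<Rightarrow> (nat \<times> nat) set \<Rightarrow> nat" where
  "degree2 n E = Max ((\<lambda>t. card (\<Union>l\<in>nbhd n E t. nbhd n E l)) ` {1..n})"

end

theory Submission
  imports Defs
begin

text \<open>
  After replacing a set by the intersection of the half-spaces that generate it, one compares the
  maxima of the coordinates \<open>v \<bullet> S\<close> and \<open>v \<bullet> G\<close> over the finite set of normals. The indicator of an orthant
  is replaced by a function of the log-sum-exp at scale \<open>\<beta>\<close>, and \<open>S\<close> is joined to \<open>G\<close> by the path
  \<open>sin \<theta> S + cos \<theta> G\<close>. Along it, Stein's method with the dependency graph on one side and Gaussian
  integration by parts on the other leave only third derivatives. These vanish unless the maximum lies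
  in a window of width of order \<open>L / \<beta>\<close>, where \<open>L\<close> bounds the logarithm of the number of normals, and
  the probability of the window is again bounded by the distance \<open>\<rho>\<close> to be estimated plus Gaussian
  anti-concentration. For a suitable \<open>\<beta>\<close> this reads \<open>\<rho> \<le> C L\<^sup>3\<^sup>/\<^sup>2 / \<beta> + \<rho> / 2\<close>, and solving for \<open>\<rho>\<close>
  gives the rate.
\<close>

section \<open>A smooth cutoff\<close>

text \<open>The number of normals may be of order \<open>exp L\<close>, so a sum over them is
  affordable only against an exponentially small factor. This shapes the error terms: the third
  derivatives are dominated by softmax weights, which sum to one, so that moments of single
  coordinates suffice. But the weights depend on all variables. They are decoupled from a given
  variable by removing its neighbours, which changes them by a bounded factor as long as the removed
  variables stay below a threshold; the exceptional event is small enough to pay for the square of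
  the number of normals. The path is trigonometric because its squared coefficients add up to one:
  the second-order terms of Stein's method and of the Gaussian integration by parts are then the
  same and cancel. The third-order terms run over a variable, a neighbour of it, and a member of
  either neighbourhood, which gives the product of the two degrees. The coefficient of
  \<open>\<rho>\<close> has order \<open>d1 d2 (\<beta> B)^3 / (L sqrt n)\<close>. Keeping it at a
  small constant fixes \<open>\<beta>\<close> at the order
  \<open>n^(1/6) L^(1/3) / (B (d1 d2)^(1/3))\<close>, and \<open>L^(3/2) / \<beta>\<close> becomes
  the stated rate.\<close>

lemma DERIV_max_0_power:
  "((\<lambda>u::real. max 0 u ^ (k+2)) has_real_derivative (real k + 2) * max 0 u ^ (k+1)) (at u)"
proof -
  consider "u < 0" | "u > 0" | "u = 0" by linarith
  then show ?thesis
  proof cases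
    case 1
    have "((\<lambda>u::real. 0) has_real_derivative 0) (at u)" by simp
    then have "((\<lambda>u::real. max 0 u ^ (k+2)) has_real_derivative 0) (at u)"
      by (rule has_field_derivative_transform_within_open[where S="{..<0}"]) (use 1 in auto)
    then show ?thesis using 1 by simp
  next
    case 2
    have "((\<lambda>u::real. u ^ (k+2)) has_real_derivative (real k + 2) * u ^ (k+1)) (at u)"
      by (rule derivative_eq_intros refl | simp)+
    then have "((\<lambda>u::real. max 0 u ^ (k+2)) has_real_derivative (real k + 2) * u ^ (k+1)) (at u)"
      by (rule has_field_derivative_transform_within_open[where S="{0<..}"]) (use 2 in auto)
    then show ?thesis using 2 by simp
  next
    case 3
    \<comment> \<open>At the kink the difference quotient is at most
      \<open>\<bar>h\<bar> ^ (k+1)\<close>; an exponent of at least 2 makes it vanish.\<close>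
    have "((\<lambda>h::real. max 0 h ^ (k+2) / h) \<longlongrightarrow> 0) (at 0)"
    proof (rule Lim_null_comparison)
      show "((\<lambda>h::real. \<bar>h\<bar> ^ (k+1)) \<longlongrightarrow> 0) (at 0)"
        by (rule tendsto_eq_intros refl | simp)+
      show "\<forall>\<^sub>F h in at 0. norm (max 0 h ^ (k+2) / h) \<le> \<bar>h\<bar> ^ (k+1)"
      proof (rule always_eventually, rule allI)
        fix h :: real
        show "norm (max 0 h ^ (k+2) / h) \<le> \<bar>h\<bar> ^ (k+1)"
        proof (cases "h > 0")
          case False
          then have z: "max 0 h ^ (k+2) = 0" by simp
          show ?thesis by (subst z) simp
        qed simp
      qed
    qed
    then show ?thesis using 3 by (simp add: DERIV_def)
  qed
qed

text \<open>The positive part lets the formulas for all three derivatives of the cutoff hold on the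
  whole line without case distinctions.\<close>

definition bump :: "real \<Rightarrow> real" where "bump x = max 0 (x * (1 - x))"

text \<open>The middle branch is one minus the primitive of \<open>140 x^3 (1-x)^3\<close>, the
  smoothstep of degree seven. This is the lowest degree at which the first three derivatives can
  vanish at both ends, so that the branches fit together three times differentiably.\<close>

definition step0 :: "real \<Rightarrow> real" where
  "step0 x = (if x \<le> 0 then 1 else if x \<ge> 1 then 0 else 1 - x^4 * (35 - 84*x + 70*x^2 - 20*x^3))"
definition step1 :: "real \<Rightarrow> real" where "step1 x = - 140 * bump x ^ 3"
definition step2 :: "real \<Rightarrow> real" where "step2 x = - 420 * bump x ^ 2 * (1 - 2*x)"
definition step3 :: "real \<Rightarrow> real" where
  "step3 x = - 840 * (bump x * (1 - 2*x)^2 - bump x ^ 2)"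

lemma DERIV_bump_power:
  "((\<lambda>x. bump x ^ (k+2)) has_real_derivative (real k + 2) * bump x ^ (k+1) * (1 - 2*x)) (at x)"
proof -
  have "((\<lambda>x::real. x*(1-x)) has_real_derivative (1-2*x)) (at x)"
    by (auto intro!: derivative_eq_intros)
  from DERIV_chain2[OF DERIV_max_0_power this, of k] show ?thesis
    by (simp add: bump_def)
qed

lemma DERIV_step0: "(step0 has_real_derivative step1 x) (at x)"
proof (cases "x < 1")
  case True
  have "((\<lambda>x::real. 1 - max 0 x ^ (2+2) * (35 - 84*x + 70*x^2 - 20*x^3))
     has_real_derivative - ((real 2 + 2) * max 0 x ^ (2+1) * (35 - 84*x + 70*x^2 - 20*x^3)
        + max 0 x ^ (2+2) * (- 84 + 140*x - 60*x^2))) (at x)"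
    by (intro DERIV_cong[OF DERIV_diff[OF DERIV_const DERIV_mult[OF DERIV_max_0_power]]])
       (auto intro!: derivative_eq_intros simp: algebra_simps power2_eq_square)
  then have "(step0 has_real_derivative - ((real 2 + 2) * max 0 x ^ (2+1) * (35 - 84*x + 70*x^2 - 20*x^3)
        + max 0 x ^ (2+2) * (- 84 + 140*x - 60*x^2))) (at x)"
    by (rule has_field_derivative_transform_within_open[where S="{..<1}"]) (use True in \<open>auto simp: step0_def max_def\<close>)
  moreover have "- ((real 2 + 2) * max 0 x ^ (2+1) * (35 - 84*x + 70*x^2 - 20*x^3)
        + max 0 x ^ (2+2) * (- 84 + 140*x - 60*x^2)) = step1 x"
  proof (cases "x \<le> 0")
    case True
    then have "x*(1-x) \<le> 0" by (simp add: mult_nonpos_nonneg)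
    with True show ?thesis by (simp add: step1_def bump_def)
  next
    case False
    then show ?thesis using \<open>x < 1\<close>
      by (simp add: step1_def bump_def algebra_simps power2_eq_square power3_eq_cube power4_eq_xxxx)
  qed
  ultimately show ?thesis by simp
next
  case False
  \<comment> \<open>Seen from the right end, the same polynomial factors as
    \<open>(1-x)^4 (1 + 4x + 10x^2 + 20x^3)\<close>.\<close>
  have "((\<lambda>x::real. max 0 (1-x) ^ (2+2) * (1 + 4*x + 10*x^2 + 20*x^3))
     has_real_derivative ((real 2 + 2) * max 0 (1-x) ^ (2+1) * (-1) * (1 + 4*x + 10*x^2 + 20*x^3)
        + max 0 (1-x) ^ (2+2) * (4 + 20*x + 60*x^2))) (at x)"
  proof (rule DERIV_cong[OF DERIV_mult])
    show "((\<lambda>x. max 0 (1-x) ^ (2+2)) has_real_derivative (real 2 + 2) * max 0 (1-x) ^ (2+1) * (-1)) (at x)"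
      by (rule DERIV_chain2[OF DERIV_max_0_power]) (auto intro!: derivative_eq_intros)
    show "((\<lambda>x. 1 + 4*x + 10*x^2 + 20*x^3) has_real_derivative 4 + 20*x + 60*x^2) (at x)"
      by (auto intro!: derivative_eq_intros)
  qed simp
  then have "(step0 has_real_derivative ((real 2 + 2) * max 0 (1-x) ^ (2+1) * (-1) * (1 + 4*x + 10*x^2 + 20*x^3)
        + max 0 (1-x) ^ (2+2) * (4 + 20*x + 60*x^2))) (at x)"
    by (rule has_field_derivative_transform_within_open[where S="{0<..}"])
      (use False in \<open>auto simp: step0_def max_def algebra_simps power2_eq_square power3_eq_cube power4_eq_xxxx\<close>)
  moreover have "bump x = 0" using False by (auto simp: bump_def max_def zero_le_mult_iff)
  ultimately show ?thesis using False by (simp add: step1_def)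
qed

lemma DERIV_step1: "(step1 has_real_derivative step2 x) (at x)"
proof -
  have "((\<lambda>x. - 140 * bump x ^ (1+2)) has_real_derivative - 140 * ((real 1 + 2) * bump x ^ (1+1) * (1 - 2*x))) (at x)"
    by (rule DERIV_cmult[OF DERIV_bump_power])
  then show ?thesis unfolding step1_def[abs_def] step2_def
    by (simp add: power3_eq_cube power2_eq_square mult.assoc)
qed

lemma DERIV_step2: "(step2 has_real_derivative step3 x) (at x)"
proof -
  have "((\<lambda>x. - 420 * (bump x ^ (0+2) * (1-2*x))) has_real_derivative
      - 420 * ((real 0 + 2) * bump x ^ (0+1) * (1 - 2*x) * (1-2*x) + (-2) * bump x ^ (0+2))) (at x)"
    by (intro DERIV_cmult DERIV_mult DERIV_bump_power) (auto intro!: derivative_eq_intros)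
  then show ?thesis unfolding step2_def[abs_def] step3_def
    by (simp add: power2_eq_square algebra_simps)
qed

lemma bump_bounds: "0 \<le> bump x" "bump x \<le> 1/4" "x \<notin> {0<..<1} \<Longrightarrow> bump x = 0"
proof -
  have "x*(1-x) \<le> 1/4" using zero_le_power2[of "x-1/2"] by (simp add: power2_eq_square algebra_simps)
  then show "bump x \<le> 1/4" by (simp add: bump_def)
  show "x \<notin> {0<..<1} \<Longrightarrow> bump x = 0"
    by (auto simp: bump_def max_def zero_le_mult_iff)
qed (simp add: bump_def)

text \<open>The estimates yield 140/64, 420/16 and 840/4. One common bound is enough, as only the
  order in \<open>L\<close> and \<open>\<beta>\<close> matters later.\<close>

lemma step_bounds: "\<bar>step1 x\<bar> \<le> 300" "\<bar>step2 x\<bar> \<le> 300" "\<bar>step3 x\<bar> \<le> 300"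
proof -
  note b = bump_bounds(1,2)[of x]
  have b2: "bump x ^ 2 \<le> (1/4)^2" by (rule power_mono) (use b in auto)
  have "bump x ^ 3 \<le> (1/4)^3" by (rule power_mono) (use b in auto)
  then have b3: "bump x ^ 3 \<le> 1/64" by (simp add: power3_eq_cube)
  show "\<bar>step1 x\<bar> \<le> 300" using b3 b by (simp add: step1_def abs_mult)
  show "\<bar>step2 x\<bar> \<le> 300"
  proof (cases "x \<in> {0<..<1}")
    case True
    then have "bump x ^ 2 * \<bar>1-2*x\<bar> \<le> (1/4)^2 * 1" using b2 by (intro mult_mono) auto
    then show ?thesis by (simp add: step2_def abs_mult power2_eq_square)
  qed (simp add: step2_def bump_bounds)
  show "\<bar>step3 x\<bar> \<le> 300"
  proof (cases "x \<in> {0<..<1}")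
    case True
    have "(1-2*x)^2 \<le> 1" using True by (simp add: abs_square_le_1 abs_le_iff)
    then have "bump x * (1-2*x)^2 \<le> (1/4) * 1" using b by (intro mult_mono) auto
    moreover have "0 \<le> bump x * (1-2*x)^2" using b by simp
    moreover have "0 \<le> bump x ^2" by simp
    moreover have "bump x ^2 \<le> 1/16" using b2 by (simp add: power2_eq_square)
    moreover define e where "e = bump x * (1-2*x)^2 - bump x^2"
    ultimately have "\<bar>e\<bar> \<le> 1/4" by linarith
    moreover have "step3 x = - 840 * e" by (simp add: step3_def e_def)
    ultimately show ?thesis by linarith
  qed (simp add: step3_def bump_bounds)
qed

lemma step_eq_0: "x \<notin> {0<..<1} \<Longrightarrow> step1 x = 0" "x \<notin> {0<..<1} \<Longrightarrow> step2 x = 0"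
  "x \<notin> {0<..<1} \<Longrightarrow> step3 x = 0"
  by (auto simp: step1_def step2_def step3_def bump_bounds)

lemma step0_antimono: "x \<le> y \<Longrightarrow> step0 y \<le> step0 x"
  by (rule DERIV_nonpos_imp_nonincreasing[where f=step0])
    (use DERIV_step0 in \<open>auto simp: step1_def bump_bounds intro!: exI\<close>)

lemma step0_range: "0 \<le> step0 x" "step0 x \<le> 1"
proof -
  have "step0 (max x 1) \<le> step0 x" "step0 x \<le> step0 (min x 0)" by (auto intro: step0_antimono)
  moreover have "step0 (max x 1) = 0" "step0 (min x 0) = 1" by (auto simp: step0_def)
  ultimately show "0 \<le> step0 x" "step0 x \<le> 1" by auto
qed

section \<open>A smooth approximation of the indicator of an orthant\<close>

definition delta :: "'v \<Rightarrow> 'v \<Rightarrow> real" where "delta j k = (if j = k then 1 else 0)"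

lemma sum_delta_mult: "finite V \<Longrightarrow> j \<in> V \<Longrightarrow> (\<Sum>k\<in>V. delta j k * f k) = f j"
  by (simp add: delta_def if_distrib[of "\<lambda>x. x * _"] cong: if_cong)

locale smooth_max =
  fixes V :: "'v set" and \<beta> L :: real
  assumes finite_V: "finite V" and V_ne: "V \<noteq> {}" and \<beta>_pos: "\<beta> > 0" and L_ge: "L \<ge> 1"
    and card_V: "ln (card V) \<le> L"
begin

text \<open>
  The cutoff is spread over \<open>L \<le> lse x \<le> 2 L\<close>, so every derivative of \<open>F\<close> gains a factor \<open>1 / L\<close>, at
  the price of a transition zone of width \<open>2 L / \<beta>\<close>. This balance produces the exponent \<open>7/6\<close>.
\<close>

definition lse :: "('v \<Rightarrow> real) \<Rightarrow> real" where "lse x = ln (\<Sum>j\<in>V. exp (\<beta> * x j))"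
text \<open>The softmax, which is the gradient of \<open>lse\<close> divided by
  \<open>\<beta>\<close>. Since \<open>lse\<close> itself is not divided by \<open>\<beta>\<close>,
  it approximates \<open>\<beta>\<close> times the maximum with an error of at most
  \<open>ln (card V)\<close>.\<close>

definition wt :: "('v \<Rightarrow> real) \<Rightarrow> 'v \<Rightarrow> real" where "wt x j = exp (\<beta> * x j) / (\<Sum>j\<in>V. exp (\<beta> * x j))"
definition F :: "('v \<Rightarrow> real) \<Rightarrow> real" where "F x = step0 (lse x / L - 1)"
text \<open>\<open>p1\<close>, \<open>p2\<close>, \<open>p3\<close> are the derivatives of the
  cutoff as a function of the value of \<open>lse\<close>; \<open>D1\<close>, \<open>D2\<close>,
  \<open>D3\<close> are the partial derivatives of \<open>F\<close> that result from them by the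
  chain rule.\<close>

definition p1 :: "('v \<Rightarrow> real) \<Rightarrow> real" where "p1 x = step1 (lse x / L - 1) / L"
definition p2 :: "('v \<Rightarrow> real) \<Rightarrow> real" where "p2 x = step2 (lse x / L - 1) / L ^ 2"
definition p3 :: "('v \<Rightarrow> real) \<Rightarrow> real" where "p3 x = step3 (lse x / L - 1) / L ^ 3"
definition D1 :: "('v \<Rightarrow> real) \<Rightarrow> 'v \<Rightarrow> real" where "D1 x j = \<beta> * (p1 x * wt x j)"
definition D2 :: "('v \<Rightarrow> real) \<Rightarrow> 'v \<Rightarrow> 'v \<Rightarrow> real" where
  "D2 x j k = \<beta>^2 * (p2 x * (wt x j * wt x k) + p1 x * (wt x j * (delta j k - wt x k)))"
definition D3 :: "('v \<Rightarrow> real) \<Rightarrow> 'v \<Rightarrow> 'v \<Rightarrow> 'v \<Rightarrow> real" where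
  "D3 x j k m = \<beta>^3 * (p3 x * wt x m * (wt x j * wt x k)
      + p2 x * (wt x j * (delta j m - wt x m) * wt x k + wt x j * (wt x k * (delta k m - wt x m)))
      + p2 x * wt x m * (wt x j * (delta j k - wt x k))
      + p1 x * (wt x j * (delta j m - wt x m) * (delta j k - wt x k) - wt x j * (wt x k * (delta k m - wt x m))))"

text \<open>The derivatives live on slack 0. Larger slacks arise because every exchange of one sum
  for a slightly perturbed one moves \<open>lse\<close> by up to 1.\<close>

definition wnd :: "real \<Rightarrow> ('v \<Rightarrow> real) \<Rightarrow> bool" where
  "wnd c x \<longleftrightarrow> L - c \<le> lse x \<and> lse x \<le> 2 * L + c"

lemma sum_exp_pos: "(\<Sum>j\<in>V. exp (\<beta> * x j)) > 0"
  using finite_V V_ne by (intro sum_pos) auto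

lemma wt_nonneg [simp]: "wt x j \<ge> 0"
  using sum_exp_pos[of x] by (simp add: wt_def)

lemma sum_wt: "(\<Sum>j\<in>V. wt x j) = 1"
  using sum_exp_pos[of x] by (simp add: wt_def flip: sum_divide_distrib)

lemma wt_le_1: "j \<in> V \<Longrightarrow> wt x j \<le> 1"
  using member_le_sum[of j V "wt x"] finite_V sum_wt[of x] by auto

text \<open>As \<open>L \<ge> 1\<close>, higher powers of \<open>1 / L\<close> are reduced to the
  first. The rate does not suffer, because the part of \<open>D3\<close> that carries
  \<open>p1\<close> has a single factor \<open>1 / L\<close> anyway.\<close>

lemma p_bounds: "\<bar>p1 x\<bar> \<le> 300 / L" "\<bar>p2 x\<bar> \<le> 300 / L" "\<bar>p3 x\<bar> \<le> 300 / L"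
proof -
  have L: "L \<le> L^2" "L \<le> L^3" "L > 0" using L_ge self_le_power[of L 2] self_le_power[of L 3] by auto
  show "\<bar>p1 x\<bar> \<le> 300 / L" using L step_bounds(1) by (simp add: p1_def abs_mult divide_right_mono)
  have "\<bar>p2 x\<bar> \<le> 300 / L^2" using L step_bounds(2) by (simp add: p2_def abs_mult divide_right_mono)
  also have "\<dots> \<le> 300 / L" using L by (intro divide_left_mono) auto
  finally show "\<bar>p2 x\<bar> \<le> 300 / L" .
  have "\<bar>p3 x\<bar> \<le> 300 / L^3" using L step_bounds(3) by (simp add: p3_def abs_mult divide_right_mono)
  also have "\<dots> \<le> 300 / L" using L by (intro divide_left_mono) auto
  finally show "\<bar>p3 x\<bar> \<le> 300 / L" .
qed

lemma p_eq_0: assumes "\<not> wnd 0 x" shows "p1 x = 0" "p2 x = 0" "p3 x = 0"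
proof -
  have "lse x / L - 1 \<notin> {0<..<1}" using assms L_ge by (auto simp: wnd_def field_simps)
  then show "p1 x = 0" "p2 x = 0" "p3 x = 0" by (simp_all add: p1_def p2_def p3_def step_eq_0)
qed

section \<open>Derivatives along differentiable curves\<close>

context
  fixes x :: "real \<Rightarrow> 'v \<Rightarrow> real" and x' :: "'v \<Rightarrow> real" and r :: real
  assumes dx: "\<And>j. j \<in> V \<Longrightarrow> ((\<lambda>r. x r j) has_real_derivative x' j) (at r)"
begin

lemma DERIV_sum_exp:
  "((\<lambda>r. \<Sum>j\<in>V. exp (\<beta> * x r j)) has_real_derivative
     (\<Sum>j\<in>V. exp (\<beta> * x r j)) * (\<beta> * (\<Sum>m\<in>V. wt (x r) m * x' m))) (at r)"
proof -
  have "((\<lambda>r. \<Sum>j\<in>V. exp (\<beta> * x r j)) has_real_derivative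
     (\<Sum>j\<in>V. exp (\<beta> * x r j) * (\<beta> * x' j))) (at r)"
    by (intro DERIV_sum DERIV_fun_exp DERIV_cmult dx)
  also have "(\<Sum>j\<in>V. exp (\<beta> * x r j) * (\<beta> * x' j)) =
      (\<Sum>j\<in>V. exp (\<beta> * x r j)) * (\<beta> * (\<Sum>m\<in>V. wt (x r) m * x' m))"
    unfolding sum_distrib_left using sum_exp_pos[of "x r"]
    by (intro sum.cong refl) (simp add: wt_def)
  finally show ?thesis .
qed

lemma DERIV_lse: "((\<lambda>r. lse (x r)) has_real_derivative \<beta> * (\<Sum>m\<in>V. wt (x r) m * x' m)) (at r)"
proof -
  note s = less_imp_neq[OF sum_exp_pos[of "x r"], symmetric]
  from DERIV_chain2[OF DERIV_ln[OF sum_exp_pos] DERIV_sum_exp]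
  show ?thesis unfolding lse_def[abs_def] by (rule DERIV_cong) (use s in \<open>simp add: field_simps\<close>)
qed

lemma DERIV_wt: 
  assumes j: "j \<in> V"
  shows "((\<lambda>r. wt (x r) j) has_real_derivative
     \<beta> * (\<Sum>m\<in>V. wt (x r) j * (delta j m - wt (x r) m) * x' m)) (at r)"
proof -
  note s = less_imp_neq[OF sum_exp_pos[of "x r"], symmetric]
  have 1: "(\<Sum>m\<in>V. wt (x r) j * (delta j m - wt (x r) m) * x' m) =
     wt (x r) j * (x' j - (\<Sum>m\<in>V. wt (x r) m * x' m))"
  proof -
    have "(\<Sum>m\<in>V. wt (x r) j * (delta j m - wt (x r) m) * x' m) =
      wt (x r) j * (\<Sum>m\<in>V. delta j m * x' m - wt (x r) m * x' m)"
      unfolding sum_distrib_left by (intro sum.cong refl) (simp add: algebra_simps)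
    then show ?thesis by (simp add: sum_subtractf sum_delta_mult[OF finite_V j])
  qed
  define A where "A = (\<Sum>m\<in>V. wt (x r) m * x' m)"
  have "((\<lambda>r. exp (\<beta> * x r j)) has_real_derivative exp (\<beta> * x r j) * (\<beta> * x' j)) (at r)"
    by (intro DERIV_fun_exp DERIV_cmult dx j)
  from DERIV_divide[OF this DERIV_sum_exp[folded A_def] s]
  show ?thesis unfolding 1 A_def[symmetric] unfolding wt_def
    by (rule DERIV_cong) (use s in \<open>simp add: field_simps\<close>)
qed

lemma DERIV_p:
  "((\<lambda>r. F (x r)) has_real_derivative p1 (x r) * (\<beta> * (\<Sum>m\<in>V. wt (x r) m * x' m))) (at r)"
  "((\<lambda>r. p1 (x r)) has_real_derivative p2 (x r) * (\<beta> * (\<Sum>m\<in>V. wt (x r) m * x' m))) (at r)"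
  "((\<lambda>r. p2 (x r)) has_real_derivative p3 (x r) * (\<beta> * (\<Sum>m\<in>V. wt (x r) m * x' m))) (at r)"
proof -
  have l: "((\<lambda>r. lse (x r) / L - 1) has_real_derivative \<beta> * (\<Sum>m\<in>V. wt (x r) m * x' m) / L) (at r)"
    by (rule DERIV_cong[OF DERIV_diff[OF DERIV_cdivide[OF DERIV_lse] DERIV_const]]) simp
  have L: "L > 0" using L_ge by simp
  show "((\<lambda>r. F (x r)) has_real_derivative p1 (x r) * (\<beta> * (\<Sum>m\<in>V. wt (x r) m * x' m))) (at r)"
    unfolding F_def[abs_def] p1_def
    by (rule DERIV_cong[OF DERIV_chain2[OF DERIV_step0 l]]) simp
  show "((\<lambda>r. p1 (x r)) has_real_derivative p2 (x r) * (\<beta> * (\<Sum>m\<in>V. wt (x r) m * x' m))) (at r)"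
    unfolding p1_def[abs_def] p2_def
    by (rule DERIV_cong[OF DERIV_cdivide[OF DERIV_chain2[OF DERIV_step1 l]]]) (simp add: power2_eq_square)
  show "((\<lambda>r. p2 (x r)) has_real_derivative p3 (x r) * (\<beta> * (\<Sum>m\<in>V. wt (x r) m * x' m))) (at r)"
    unfolding p2_def[abs_def] p3_def
    by (rule DERIV_cong[OF DERIV_cdivide[OF DERIV_chain2[OF DERIV_step2 l]]])
      (simp add: power2_eq_square power3_eq_cube)
qed

text \<open>Curves are used in place of a multivariate derivative: the interpolation path for
  \<open>F\<close>, segments between two weighted sums for \<open>D1\<close> and \<open>D2\<close>,
  and lines parallel to a coordinate axis of the Gaussian space.\<close>

lemma DERIV_F: "((\<lambda>r. F (x r)) has_real_derivative (\<Sum>m\<in>V. D1 (x r) m * x' m)) (at r)"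
  by (rule DERIV_cong[OF DERIV_p(1)]) (simp add: D1_def sum_distrib_left mult_ac)

lemma DERIV_D1:
  assumes j: "j \<in> V"
  shows "((\<lambda>r. D1 (x r) j) has_real_derivative (\<Sum>m\<in>V. D2 (x r) j m * x' m)) (at r)"
proof -
  let ?S = "\<lambda>f. \<Sum>m\<in>V. f m * x' m"
  have "((\<lambda>r. D1 (x r) j) has_real_derivative
     \<beta> * ((p2 (x r) * (\<beta> * ?S (wt (x r)))) * wt (x r) j
       + (\<beta> * ?S (\<lambda>m. wt (x r) j * (delta j m - wt (x r) m))) * p1 (x r))) (at r)"
    unfolding D1_def[abs_def] by (intro DERIV_cmult DERIV_mult DERIV_p DERIV_wt j)
  also have "\<beta> * ((p2 (x r) * (\<beta> * ?S (wt (x r)))) * wt (x r) j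
       + (\<beta> * ?S (\<lambda>m. wt (x r) j * (delta j m - wt (x r) m))) * p1 (x r))
     = (\<Sum>m\<in>V. D2 (x r) j m * x' m)"
    unfolding sum_distrib_left sum_distrib_right sum.distrib[symmetric]
    by (intro sum.cong refl) (simp add: D2_def algebra_simps power2_eq_square)
  finally show ?thesis .
qed

lemma DERIV_D2:
  assumes j: "j \<in> V" and k: "k \<in> V"
  shows "((\<lambda>r. D2 (x r) j k) has_real_derivative (\<Sum>m\<in>V. D3 (x r) j k m * x' m)) (at r)"
proof -
  let ?S = "\<lambda>f. \<Sum>m\<in>V. f m * x' m"
  let ?a = "\<beta> * ?S (wt (x r))"
  let ?w = "\<lambda>j. \<beta> * ?S (\<lambda>m. wt (x r) j * (delta j m - wt (x r) m))"
  have "((\<lambda>r. D2 (x r) j k) has_real_derivative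
     \<beta>^2 * ((p3 (x r) * ?a) * (wt (x r) j * wt (x r) k) + (?w j * wt (x r) k + ?w k * wt (x r) j) * p2 (x r)
       + ((p2 (x r) * ?a) * (wt (x r) j * (delta j k - wt (x r) k)) 
         + (?w j * (delta j k - wt (x r) k) + (0 - ?w k) * wt (x r) j) * p1 (x r)))) (at r)"
    unfolding D2_def[abs_def]
    by (intro DERIV_cmult DERIV_add DERIV_mult DERIV_diff DERIV_const DERIV_p DERIV_wt j k)
  also have "\<beta>^2 * ((p3 (x r) * ?a) * (wt (x r) j * wt (x r) k) + (?w j * wt (x r) k + ?w k * wt (x r) j) * p2 (x r)
       + ((p2 (x r) * ?a) * (wt (x r) j * (delta j k - wt (x r) k)) 
         + (?w j * (delta j k - wt (x r) k) + (0 - ?w k) * wt (x r) j) * p1 (x r)))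
     = (\<Sum>m\<in>V. D3 (x r) j k m * x' m)"
    unfolding diff_0 sum_distrib_left sum_distrib_right sum.distrib[symmetric] sum_negf[symmetric]
    by (intro sum.cong refl) (simp add: D3_def algebra_simps power2_eq_square power3_eq_cube)
  finally show ?thesis .
qed

end

section \<open>Bounds for the derivatives that do not depend on the number of coordinates\<close>

lemma le300: "300 / L \<le> 300"
  using L_ge by (simp add: divide_le_eq)

lemma D1_bound: "j \<in> V \<Longrightarrow> \<bar>D1 x j\<bar> \<le> 300 * \<beta>"
proof -
  assume j: "j \<in> V"
  have "\<bar>p1 x\<bar> \<le> 300" using p_bounds(1)[of x] le300 by linarith
  then have "\<bar>p1 x\<bar> * wt x j \<le> 300 * 1" using wt_le_1[OF j] by (intro mult_mono) auto
  then show ?thesis using \<beta>_pos by (simp add: D1_def abs_mult)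
qed

lemma D2_bound: "j \<in> V \<Longrightarrow> k \<in> V \<Longrightarrow> \<bar>D2 x j k\<bar> \<le> 600 * \<beta>^2"
proof -
  assume j: "j \<in> V" and k: "k \<in> V"
  have p: "\<bar>p1 x\<bar> \<le> 300" "\<bar>p2 x\<bar> \<le> 300" using p_bounds[of x] le300 by linarith+
  have 1: "\<bar>wt x j * wt x k\<bar> \<le> 1" using wt_le_1[OF j, of x] wt_le_1[OF k, of x]
    by (simp add: mult_le_one)
  have "\<bar>delta j k - wt x k\<bar> \<le> 1" using wt_le_1[OF k, of x] wt_nonneg[of x k] by (simp add: delta_def)
  then have 2: "\<bar>wt x j * (delta j k - wt x k)\<bar> \<le> 1" using wt_le_1[OF j, of x]
    by (simp add: abs_mult mult_le_one)
  have "\<bar>p2 x * (wt x j * wt x k)\<bar> \<le> 300 * 1" "\<bar>p1 x * (wt x j * (delta j k - wt x k))\<bar> \<le> 300 * 1"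
    unfolding abs_mult[of "p2 x"] abs_mult[of "p1 x"] by (intro mult_mono p 1 2; simp)+
  then have "\<bar>p2 x * (wt x j * wt x k) + p1 x * (wt x j * (delta j k - wt x k))\<bar> \<le> 600" by linarith
  then show ?thesis using \<beta>_pos by (simp add: D2_def abs_mult)
qed

text \<open>What is left of \<open>D3\<close> when signs are dropped and each
  \<open>delta - wt\<close> becomes \<open>delta + wt\<close>: six products under a common bound for
  \<open>p1\<close>, \<open>p2\<close>, \<open>p3\<close> collect into the coefficients 6, 2, 2, 2,
  1. The result is symmetric in the three indices.\<close>

definition T3 :: "('v \<Rightarrow> real) \<Rightarrow> 'v \<Rightarrow> 'v \<Rightarrow> 'v \<Rightarrow> real" where
  "T3 x j k m = 6 * (wt x j * wt x k * wt x m) + 2 * (delta j m * (wt x j * wt x k))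
     + 2 * (delta k m * (wt x j * wt x k)) + 2 * (delta j k * (wt x j * wt x m))
     + delta j k * (delta j m * wt x j)"

lemma D3_T3: "\<bar>D3 x j k m\<bar> \<le> (if wnd 0 x then 300 * \<beta>^3 / L * T3 x j k m else 0)"
proof (cases "wnd 0 x")
  case True
  define P where "P = 300 / L"
  have p: "\<bar>p1 x\<bar> \<le> P" "\<bar>p2 x\<bar> \<le> P" "\<bar>p3 x\<bar> \<le> P" using p_bounds[of x] by (simp_all add: P_def)
  have d: "\<bar>delta a c - wt x c\<bar> \<le> delta a c + wt x c" for a c
    using wt_nonneg[of x c] by (cases "a = c") (auto simp: delta_def abs_le_iff)
  let ?w = "wt x" and ?d = delta
  have m: "\<bar>q * e\<bar> \<le> P * e'" if "\<bar>q\<bar> \<le> P" "\<bar>e\<bar> \<le> e'" for q e e'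
    unfolding abs_mult by (intro mult_mono that) (use that in auto)
  have w: "\<bar>?w a * e\<bar> \<le> ?w a * e'" if "\<bar>e\<bar> \<le> e'" for a e e'
    unfolding abs_mult using that by (simp add: mult_left_mono)
  have h1: "\<bar>p3 x * (?w m * (?w j * ?w k))\<bar> \<le> P * (?w m * (?w j * ?w k))"
    by (intro m p) simp
  have h2: "\<bar>p2 x * (?w j * (?w k * (?d j m - ?w m)))\<bar> \<le> P * (?w j * (?w k * (?d j m + ?w m)))"
    by (intro m p w d)
  have h3: "\<bar>p2 x * (?w j * (?w k * (?d k m - ?w m)))\<bar> \<le> P * (?w j * (?w k * (?d k m + ?w m)))"
    by (intro m p w d)
  have h4: "\<bar>p2 x * (?w m * (?w j * (?d j k - ?w k)))\<bar> \<le> P * (?w m * (?w j * (?d j k + ?w k)))"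
    by (intro m p w d)
  have h5: "\<bar>p1 x * (?w j * ((?d j m - ?w m) * (?d j k - ?w k)))\<bar>
      \<le> P * (?w j * ((?d j m + ?w m) * (?d j k + ?w k)))"
    by (intro m p w, unfold abs_mult, intro mult_mono d) (auto simp: delta_def)
  have h6: "\<bar>p1 x * (?w j * (?w k * (?d k m - ?w m)))\<bar> \<le> P * (?w j * (?w k * (?d k m + ?w m)))"
    by (intro m p w d)
  have comb: "\<bar>a1 + a2 + a3 + a4 + a5 - a6\<bar> \<le> b1 + b2 + b3 + b4 + b5 + b6"
    if "\<bar>a1\<bar> \<le> b1" "\<bar>a2\<bar> \<le> b2" "\<bar>a3\<bar> \<le> b3" "\<bar>a4\<bar> \<le> b4" "\<bar>a5\<bar> \<le> b5" "\<bar>a6\<bar> \<le> b6"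
    for a1 a2 a3 a4 a5 a6 b1 b2 b3 b4 b5 b6 :: real
    using that by linarith
  have "\<bar>p3 x * (?w m * (?w j * ?w k)) + p2 x * (?w j * (?w k * (?d j m - ?w m)))
    + p2 x * (?w j * (?w k * (?d k m - ?w m))) + p2 x * (?w m * (?w j * (?d j k - ?w k)))
    + p1 x * (?w j * ((?d j m - ?w m) * (?d j k - ?w k))) - p1 x * (?w j * (?w k * (?d k m - ?w m)))\<bar>
    \<le> P * (?w m * (?w j * ?w k)) + P * (?w j * (?w k * (?d j m + ?w m)))
    + P * (?w j * (?w k * (?d k m + ?w m))) + P * (?w m * (?w j * (?d j k + ?w k)))
    + P * (?w j * ((?d j m + ?w m) * (?d j k + ?w k))) + P * (?w j * (?w k * (?d k m + ?w m)))"
    by (rule comb[OF h1 h2 h3 h4 h5 h6])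
  also have "\<dots> = P * T3 x j k m"
    by (simp add: T3_def algebra_simps)
  also have "p3 x * (?w m * (?w j * ?w k)) + p2 x * (?w j * (?w k * (?d j m - ?w m)))
    + p2 x * (?w j * (?w k * (?d k m - ?w m))) + p2 x * (?w m * (?w j * (?d j k - ?w k)))
    + p1 x * (?w j * ((?d j m - ?w m) * (?d j k - ?w k))) - p1 x * (?w j * (?w k * (?d k m - ?w m)))
    = D3 x j k m / \<beta>^3"
  proof -
    have "D3 x j k m = \<beta>^3 * (p3 x * (?w m * (?w j * ?w k)) + p2 x * (?w j * (?w k * (?d j m - ?w m)))
    + p2 x * (?w j * (?w k * (?d k m - ?w m))) + p2 x * (?w m * (?w j * (?d j k - ?w k)))
    + p1 x * (?w j * ((?d j m - ?w m) * (?d j k - ?w k))) - p1 x * (?w j * (?w k * (?d k m - ?w m))))"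
      unfolding D3_def by (rule arg_cong[where f="(*) _"]) (simp add: algebra_simps)
    then show ?thesis using \<beta>_pos by simp
  qed
  finally show ?thesis using True \<beta>_pos by (simp add: P_def field_simps abs_mult)
qed (simp add: D3_def p_eq_0)

text \<open>By symmetry the three marginals of \<open>T3\<close> agree. Each equals
  \<open>13 * wt x\<close>, because the weights sum to one and 6 + 2 + 2 + 2 + 1 = 13; three of them
  give 39.\<close>

lemma sum_T3:
  "(\<Sum>j\<in>V. \<Sum>k\<in>V. \<Sum>m\<in>V. T3 x j k m * (a j + a k + a m)) = 39 * (\<Sum>j\<in>V. wt x j * a j)"
proof -
  let ?w = "wt x" and ?A = "\<Sum>j\<in>V. wt x j * a j"
  note fV = finite_V
  have s1: "(\<Sum>k\<in>V. c * ?w k) = c" for c using sum_wt[of x] by (simp flip: sum_distrib_left)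
  have s2: "(\<Sum>k\<in>V. c * (?w k * a k)) = c * ?A" for c by (simp add: sum_distrib_left)
  have inner: "(\<Sum>m\<in>V. T3 x j k m * (a j + a k + a m)) =
      6 * (?w j * ?w k * (a j + a k + ?A)) + 2 * (?w j * ?w k * (2 * a j + a k))
      + 2 * (?w j * ?w k * (a j + 2 * a k)) + 2 * (delta j k * (?w j * (2 * a j + ?A)))
      + delta j k * (3 * (?w j * a j))" if j: "j \<in> V" and k: "k \<in> V" for j k
  proof -
    have "(\<Sum>m\<in>V. T3 x j k m * (a j + a k + a m)) =
      (\<Sum>m\<in>V. (6 * ?w j * ?w k * (a j + a k)) * ?w m) + (\<Sum>m\<in>V. (6 * ?w j * ?w k) * (?w m * a m))
      + (\<Sum>m\<in>V. delta j m * (2 * ?w j * ?w k * (a j + a k + a m)))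
      + (\<Sum>m\<in>V. delta k m * (2 * ?w j * ?w k * (a j + a k + a m)))
      + (\<Sum>m\<in>V. (2 * delta j k * ?w j * (a j + a k)) * ?w m)
      + (\<Sum>m\<in>V. (2 * delta j k * ?w j) * (?w m * a m))
      + (\<Sum>m\<in>V. delta j m * (delta j k * ?w j * (a j + a k + a m)))"
      unfolding sum.distrib[symmetric] by (intro sum.cong refl) (simp add: T3_def algebra_simps)
    also have "\<dots> = (6 * ?w j * ?w k * (a j + a k)) + (6 * ?w j * ?w k) * ?A
       + 2 * ?w j * ?w k * (a j + a k + a j) + 2 * ?w j * ?w k * (a j + a k + a k)
       + (2 * delta j k * ?w j * (a j + a k)) + (2 * delta j k * ?w j) * ?A + delta j k * ?w j * (a j + a k + a j)"
      unfolding s1 s2 sum_delta_mult[OF fV j] sum_delta_mult[OF fV k] ..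
    finally show ?thesis by (simp add: algebra_simps delta_def)
  qed
  have inner2: "(\<Sum>k\<in>V. \<Sum>m\<in>V. T3 x j k m * (a j + a k + a m)) =
     6 * (?w j * (a j + 2 * ?A)) + 2 * (?w j * (2 * a j + ?A)) + 2 * (?w j * (a j + 2 * ?A)) + 2 * (?w j * (2 * a j + ?A))
     + 3 * (?w j * a j)" if j: "j \<in> V" for j
  proof -
    have "(\<Sum>k\<in>V. \<Sum>m\<in>V. T3 x j k m * (a j + a k + a m)) =
      (\<Sum>k\<in>V. (6 * ?w j * (a j + ?A) + 4 * ?w j * a j + 2 * ?w j * a j) * ?w k)
      + (\<Sum>k\<in>V. (6 * ?w j + 2 * ?w j + 4 * ?w j) * (?w k * a k))
      + (\<Sum>k\<in>V. delta j k * (2 * (?w j * (2 * a j + ?A)) + 3 * (?w j * a j)))"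
      unfolding sum.distrib[symmetric] by (intro sum.cong refl) (subst inner[OF j], assumption, simp add: algebra_simps)
    also have "\<dots> = (6 * ?w j * (a j + ?A) + 4 * ?w j * a j + 2 * ?w j * a j) + (6 * ?w j + 2 * ?w j + 4 * ?w j) * ?A
      + (2 * (?w j * (2 * a j + ?A)) + 3 * (?w j * a j))"
      unfolding s1 s2 sum_delta_mult[OF fV j] ..
    finally show ?thesis by (simp add: algebra_simps)
  qed
  have "(\<Sum>j\<in>V. \<Sum>k\<in>V. \<Sum>m\<in>V. T3 x j k m * (a j + a k + a m)) =
      (\<Sum>j\<in>V. 19 * (?w j * a j)) + (\<Sum>j\<in>V. (20 * ?A) * ?w j)"
    unfolding sum.distrib[symmetric] by (intro sum.cong refl) (subst inner2, assumption, simp add: algebra_simps)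
  also have "\<dots> = 39 * ?A" unfolding s1 sum_distrib_left[symmetric] by (simp add: sum_wt)
  finally show ?thesis .
qed

text \<open>The triple sum costs no factor \<open>card V\<close>: a majorant that splits into
  one-index terms is merely averaged with the weights. The constant is 300 * 39.\<close>

lemma D3_contract:
  assumes a: "\<And>j k m. j \<in> V \<Longrightarrow> k \<in> V \<Longrightarrow> m \<in> V \<Longrightarrow> \<bar>C j k * w m\<bar> \<le> a j + a k + a m"
  shows "\<bar>\<Sum>j\<in>V. \<Sum>k\<in>V. C j k * (\<Sum>m\<in>V. D3 x j k m * w m)\<bar>
     \<le> (if wnd 0 x then 11700 * \<beta>^3 / L * (\<Sum>j\<in>V. wt x j * a j) else 0)"
proof -
  have "\<bar>\<Sum>j\<in>V. \<Sum>k\<in>V. C j k * (\<Sum>m\<in>V. D3 x j k m * w m)\<bar>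
      \<le> (\<Sum>j\<in>V. \<Sum>k\<in>V. \<Sum>m\<in>V. \<bar>C j k * w m\<bar> * \<bar>D3 x j k m\<bar>)"
    unfolding sum_distrib_left
    by (intro order.trans[OF sum_abs] sum_mono) (simp add: abs_mult mult_ac)
  also have "\<dots> \<le> (\<Sum>j\<in>V. \<Sum>k\<in>V. \<Sum>m\<in>V. (a j + a k + a m) * (if wnd 0 x then 300 * \<beta>^3 / L * T3 x j k m else 0))"
    by (intro sum_mono mult_mono a D3_T3) (auto intro: order.trans[OF abs_ge_zero a])
  also have "\<dots> = (if wnd 0 x then 300 * \<beta>^3 / L * (\<Sum>j\<in>V. \<Sum>k\<in>V. \<Sum>m\<in>V. T3 x j k m * (a j + a k + a m)) else 0)"
    by (simp add: sum_distrib_left mult_ac)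
  also have "\<dots> = (if wnd 0 x then 11700 * \<beta>^3 / L * (\<Sum>j\<in>V. wt x j * a j) else 0)"
    unfolding sum_T3 by simp
  finally show ?thesis .
qed

text \<open>Each exponential changes by a factor between \<open>exp (-1)\<close> and
  \<open>exp 1\<close>, and hence so does their sum. The quotient changes by at most
  \<open>exp 2\<close>, however many coordinates there are.\<close>

lemma wt_stable:
  assumes "\<And>j. j \<in> V \<Longrightarrow> \<beta> * \<bar>x j - y j\<bar> \<le> 1"
  shows "\<bar>lse x - lse y\<bar> \<le> 1" and "j \<in> V \<Longrightarrow> wt x j \<le> exp 2 * wt y j"
proof -
  have e: "exp (\<beta> * x j) \<le> exp 1 * exp (\<beta> * y j)" "exp (\<beta> * y j) \<le> exp 1 * exp (\<beta> * x j)" if "j \<in> V" for j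
  proof -
    have "\<bar>\<beta> * x j - \<beta> * y j\<bar> \<le> 1"
      using assms[OF that] \<beta>_pos by (simp add: abs_mult flip: right_diff_distrib)
    then show "exp (\<beta> * x j) \<le> exp 1 * exp (\<beta> * y j)" "exp (\<beta> * y j) \<le> exp 1 * exp (\<beta> * x j)"
      unfolding exp_add[symmetric] exp_le_cancel_iff by linarith+
  qed
  let ?h = "\<lambda>x. \<Sum>j\<in>V. exp (\<beta> * x j)"
  have h: "?h x \<le> exp 1 * ?h y" "?h y \<le> exp 1 * ?h x"
    unfolding sum_distrib_left by (intro sum_mono e; assumption)+
  have "lse x \<le> ln (exp 1 * ?h y)" "lse y \<le> ln (exp 1 * ?h x)"
    unfolding lse_def using h sum_exp_pos[of x] sum_exp_pos[of y] by (subst ln_le_cancel_iff; simp)+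
  then show "\<bar>lse x - lse y\<bar> \<le> 1"
    using sum_exp_pos[of x] sum_exp_pos[of y] by (simp add: ln_mult lse_def)
  assume j: "j \<in> V"
  have "wt x j \<le> (exp 1 * exp (\<beta> * y j)) / (?h y / exp 1)"
    unfolding wt_def using sum_exp_pos[of x] sum_exp_pos[of y] e[OF j] h
    by (intro frac_le) (auto simp: field_simps)
  also have "\<dots> = exp 2 * wt y j"
    using exp_add[of 1 "1::real"] by (simp add: wt_def)
  finally show "wt x j \<le> exp 2 * wt y j" .
qed

lemma wnd_stable:
  assumes "\<And>j. j \<in> V \<Longrightarrow> \<beta> * \<bar>x j - y j\<bar> \<le> 1" "wnd c x"
  shows "wnd (c + 1) y"
  using wt_stable(1)[of x y, OF assms(1)] assms(2) by (auto simp: wnd_def)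

lemma F_range: "0 \<le> F x" "F x \<le> 1"
  by (simp_all add: F_def step0_range)

text \<open>Replacing every term by the largest one costs \<open>ln (card V)\<close>, which
  \<open>L\<close> absorbs. This is why the cutoff starts at \<open>L\<close> and not at 0.\<close>

lemma lse_le:
  assumes "\<And>j. j \<in> V \<Longrightarrow> x j \<le> c"
  shows "lse x \<le> L + \<beta> * c"
proof -
  have "(\<Sum>j\<in>V. exp (\<beta> * x j)) \<le> (\<Sum>j\<in>V. exp (\<beta> * c))"
    using \<beta>_pos assms by (intro sum_mono) auto
  then have "lse x \<le> ln (card V * exp (\<beta> * c))"
    unfolding lse_def using sum_exp_pos[of x] by (subst ln_le_cancel_iff) auto
  also have "\<dots> = ln (card V) + \<beta> * c"
    using finite_V V_ne by (simp add: ln_mult card_gt_0_iff)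
  finally show ?thesis using card_V by simp
qed

lemma lse_ge: "j \<in> V \<Longrightarrow> \<beta> * x j \<le> lse x"
proof -
  assume j: "j \<in> V"
  have "exp (\<beta> * x j) \<le> (\<Sum>j\<in>V. exp (\<beta> * x j))"
    using member_le_sum[OF j, of "\<lambda>j. exp (\<beta> * x j)"] finite_V by auto
  then have "ln (exp (\<beta> * x j)) \<le> lse x" unfolding lse_def
    using sum_exp_pos[of x] by (subst ln_le_cancel_iff) auto
  then show ?thesis by simp
qed

lemma F_eq_1: "(\<And>j. j \<in> V \<Longrightarrow> x j \<le> 0) \<Longrightarrow> F x = 1"
  using lse_le[of x 0] L_ge by (simp add: F_def step0_def field_simps)

lemma F_eq_0: "j \<in> V \<Longrightarrow> x j > 2 * L / \<beta> \<Longrightarrow> F x = 0"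
  using lse_ge[of j x] L_ge \<beta>_pos by (simp add: F_def step0_def field_simps)

lemma wnd_le:
  assumes "wnd c x" "j \<in> V" shows "x j \<le> (2 * L + c) / \<beta>"
  using lse_ge[of j x] assms \<beta>_pos by (simp add: wnd_def field_simps)

text \<open>Together with \<open>wnd_le\<close> this confines the maximal coordinate to an interval
  whose length has order \<open>L / \<beta>\<close>.\<close>

lemma wnd_gt:
  assumes "wnd c x" "c < d" shows "\<exists>j\<in>V. x j > - d / \<beta>"
proof (rule ccontr)
  assume "\<not> ?thesis"
  then have "lse x \<le> L + \<beta> * (- d / \<beta>)" by (intro lse_le) auto
  with assms \<beta>_pos show False by (simp add: wnd_def)
qed

end

section \<open>Gaussian product measures\<close>

abbreviation "gauss \<equiv> std_normal_distribution"

lemma prob_space_gauss: "prob_space gauss"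
  by (rule prob_space_normal_density) simp

lemma sets_gauss [measurable_cong, simp]: "sets gauss = sets borel" by simp
lemma space_gauss [simp]: "space gauss = UNIV" by simp

section \<open>Translations of Gaussian measures\<close>

lemma nn_integral_gauss_shift:
  assumes [measurable]: "f \<in> borel_measurable borel"
  shows "(\<integral>\<^sup>+x. f x \<partial>gauss) = (\<integral>\<^sup>+x. f (x + a) * ennreal (exp (- a * x - a\<^sup>2 / 2)) \<partial>gauss)"
proof -
  have "(\<integral>\<^sup>+x. f x \<partial>gauss) = (\<integral>\<^sup>+x. ennreal (std_normal_density x) * f x \<partial>lborel)"
    by (simp add: nn_integral_density)
  also have "\<dots> = (\<integral>\<^sup>+x. ennreal (std_normal_density (a + 1 * x)) * f (a + 1 * x) \<partial>lborel)"
    by (subst nn_integral_real_affine[where t=a and c=1]) simp_all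
  also have "\<dots> = (\<integral>\<^sup>+x. ennreal (std_normal_density x) * (f (x + a) * ennreal (exp (- a * x - a\<^sup>2 / 2))) \<partial>lborel)"
  proof (rule nn_integral_cong)
    fix x
    have "std_normal_density (a + x) = std_normal_density x * exp (- a * x - a\<^sup>2 / 2)"
      by (simp add: std_normal_density_def power2_eq_square field_simps flip: exp_add)
    then show "ennreal (std_normal_density (a + 1 * x)) * f (a + 1 * x) =
        ennreal (std_normal_density x) * (f (x + a) * ennreal (exp (- a * x - a\<^sup>2 / 2)))"
      by (simp add: ennreal_mult mult_ac add.commute)
  qed
  also have "\<dots> = (\<integral>\<^sup>+x. f (x + a) * ennreal (exp (- a * x - a\<^sup>2 / 2)) \<partial>gauss)"
    by (simp add: nn_integral_density)
  finally show ?thesis .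
qed

abbreviation gaussP :: "'i set \<Rightarrow> ('i \<Rightarrow> real) measure" where
  "gaussP I \<equiv> (\<Pi>\<^sub>M i\<in>I. gauss)"

lemma product_sigma_finite_gauss: "product_sigma_finite (\<lambda>i. gauss)"
  by (simp add: product_sigma_finite_def prob_space_gauss prob_space_imp_sigma_finite)

lemma prob_space_gaussP: "prob_space (gaussP I)"
  by (intro prob_space_PiM prob_space_gauss)

text \<open>The Cameron-Martin formula. The density of the translate is a product, so the
  coordinates are shifted one at a time with Tonelli's theorem; nonnegative integrals avoid any side
  condition of integrability.\<close>

lemma nn_integral_gaussP_shift:
  assumes "finite I" "f \<in> borel_measurable (gaussP I)"
  shows "(\<integral>\<^sup>+z. f z \<partial>gaussP I) =
    (\<integral>\<^sup>+z. f (\<lambda>i\<in>I. z i + a i) * ennreal (exp (- (\<Sum>i\<in>I. a i * z i) - (\<Sum>i\<in>I. (a i)\<^sup>2) / 2)) \<partial>gaussP I)"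
  using assms
proof (induction I arbitrary: f rule: finite_induct)
  case empty
  show ?case
    by (rule nn_integral_cong) (auto simp: space_PiM restrict_def intro!: arg_cong[where f=f])
next
  case (insert i I)
  interpret product_sigma_finite "\<lambda>i. gauss" by (rule product_sigma_finite_gauss)
  note fi = insert.hyps
  note [measurable] = insert.prems
  let ?e = "\<lambda>x. ennreal (exp (- a i * x - (a i)\<^sup>2 / 2))"
  let ?E = "\<lambda>I z. ennreal (exp (- (\<Sum>i\<in>I. a i * z i) - (\<Sum>i\<in>I. (a i)\<^sup>2) / 2))"
  have upd [measurable]: "(\<lambda>(z, x). z(i := h x)) \<in> gaussP I \<Otimes>\<^sub>M borel \<rightarrow>\<^sub>M gaussP (insert i I)"
    if [measurable]: "h \<in> borel_measurable borel" for h
  proof (rule measurable_PiM_single')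
    fix j assume j: "j \<in> insert i I"
    show "(\<lambda>w. (case w of (z, x) \<Rightarrow> z(i := h x)) j) \<in> gaussP I \<Otimes>\<^sub>M borel \<rightarrow>\<^sub>M gauss"
      using j by (cases "j = i") (auto simp: split_beta' intro!: measurable_compose[OF measurable_fst])
  qed (auto simp: space_pair_measure space_PiM PiE_def Pi_def extensional_def)
  have m: "(\<lambda>(z, x). f (z(i := x + c))) \<in> borel_measurable (gaussP I \<Otimes>\<^sub>M borel)" for c
    using measurable_compose[OF upd[of "\<lambda>x. x + c"] insert.prems] by (simp add: split_beta')
  have m1: "(\<lambda>x. f (z(i := x + c))) \<in> borel_measurable borel" if "z \<in> space (gaussP I)" for z c
    using measurable_Pair2[OF m that] by simp
  have m2 [measurable]: "(\<lambda>z. \<integral>\<^sup>+x. f (z(i := x + a i)) * ?e x \<partial>gauss) \<in> borel_measurable (gaussP I)"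
    using m[of "a i"]
    by (intro sigma_finite_measure.borel_measurable_nn_integral prob_space_imp_sigma_finite prob_space_gauss)
      (simp add: split_beta')
  have "(\<integral>\<^sup>+z. f z \<partial>gaussP (insert i I)) = (\<integral>\<^sup>+z. \<integral>\<^sup>+x. f (z(i := x)) \<partial>gauss \<partial>gaussP I)"
    by (rule product_nn_integral_insert) (use fi in auto)
  also have "\<dots> = (\<integral>\<^sup>+z. \<integral>\<^sup>+x. f (z(i := x + a i)) * ?e x \<partial>gauss \<partial>gaussP I)"
    using m1[of _ 0] by (intro nn_integral_cong nn_integral_gauss_shift) simp
  also have "\<dots> = (\<integral>\<^sup>+z. (\<integral>\<^sup>+x. f ((\<lambda>i\<in>I. z i + a i)(i := x + a i)) * ?e x \<partial>gauss) * ?E I z \<partial>gaussP I)"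
    by (rule insert.IH[OF m2])
  also have "\<dots> = (\<integral>\<^sup>+z. \<integral>\<^sup>+x. f (\<lambda>j\<in>insert i I. (z(i := x)) j + a j) * ?E (insert i I) (z(i := x)) \<partial>gauss \<partial>gaussP I)"
  proof (rule nn_integral_cong)
    fix z assume z: "z \<in> space (gaussP I)"
    have za: "(\<lambda>i\<in>I. z i + a i) \<in> space (gaussP I)" by (simp add: space_PiM)
    have [measurable]: "(\<lambda>x. f ((\<lambda>i\<in>I. z i + a i)(i := x + a i))) \<in> borel_measurable borel"
      using m1[OF za] .
    have "(\<integral>\<^sup>+x. f ((\<lambda>i\<in>I. z i + a i)(i := x + a i)) * ?e x \<partial>gauss) * ?E I z =
       (\<integral>\<^sup>+x. f ((\<lambda>i\<in>I. z i + a i)(i := x + a i)) * ?e x * ?E I z \<partial>gauss)"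
      by (subst nn_integral_multc) auto
    also have "\<dots> = (\<integral>\<^sup>+x. f (\<lambda>j\<in>insert i I. (z(i := x)) j + a j) * ?E (insert i I) (z(i := x)) \<partial>gauss)"
    proof (rule nn_integral_cong)
      fix x
      have "(\<Sum>j\<in>I. a j * (z(i := x)) j) = (\<Sum>j\<in>I. a j * z j)"
        using fi by (intro sum.cong) auto
      then have "?e x * ?E I z = ?E (insert i I) (z(i := x))"
        using fi by (simp add: ennreal_mult[symmetric] exp_add[symmetric] field_simps)
      moreover have "(\<lambda>i\<in>I. z i + a i)(i := x + a i) = (\<lambda>j\<in>insert i I. (z(i := x)) j + a j)"
        using fi by (auto simp: fun_eq_iff)
      ultimately show "f ((\<lambda>i\<in>I. z i + a i)(i := x + a i)) * ?e x * ?E I z =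
         f (\<lambda>j\<in>insert i I. (z(i := x)) j + a j) * ?E (insert i I) (z(i := x))"
        by (simp add: mult.assoc)
    qed
    finally show "(\<integral>\<^sup>+x. f ((\<lambda>i\<in>I. z i + a i)(i := x + a i)) * ?e x \<partial>gauss) * ?E I z = \<dots>" .
  qed
  also have "\<dots> = (\<integral>\<^sup>+z. f (\<lambda>j\<in>insert i I. z j + a j) * ?E (insert i I) z \<partial>gaussP (insert i I))"
    using fi by (intro product_nn_integral_insert[symmetric]) measurable
  finally show ?case .
qed

text \<open>On \<open>A\<close> the translated indicator of \<open>A'\<close> equals 1 and the
  Cameron-Martin density is at least \<open>exp w\<close>.\<close>

lemma gauss_shift_le:
  assumes I: "finite I" and A [measurable]: "A \<in> sets (gaussP I)" and A' [measurable]: "A' \<in> sets (gaussP I)"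
    and sub: "\<And>z. z \<in> A \<Longrightarrow> (\<lambda>i\<in>I. z i + a i) \<in> A'"
    and w: "\<And>z. z \<in> A \<Longrightarrow> w \<le> - (\<Sum>i\<in>I. a i * z i) - (\<Sum>i\<in>I. (a i)\<^sup>2) / 2"
  shows "exp w * measure (gaussP I) A \<le> measure (gaussP I) A'"
proof -
  interpret P: prob_space "gaussP I" by (rule prob_space_gaussP)
  have "ennreal (exp w * measure (gaussP I) A) = (\<integral>\<^sup>+z. ennreal (exp w) * indicator A z \<partial>gaussP I)"
    by (simp add: nn_integral_cmult_indicator P.emeasure_eq_measure ennreal_mult)
  also have "\<dots> \<le> (\<integral>\<^sup>+z. indicator A' (\<lambda>i\<in>I. z i + a i) *
      ennreal (exp (- (\<Sum>i\<in>I. a i * z i) - (\<Sum>i\<in>I. (a i)\<^sup>2) / 2)) \<partial>gaussP I)"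
    by (intro nn_integral_mono) (auto simp: indicator_def sub w ennreal_leI)
  also have "\<dots> = (\<integral>\<^sup>+z. indicator A' z \<partial>gaussP I)"
    by (rule nn_integral_gaussP_shift[symmetric]) (use I in auto)
  also have "\<dots> = ennreal (measure (gaussP I) A')" by (simp add: P.emeasure_eq_measure)
  finally show ?thesis by (simp add: ennreal_le_iff)
qed

section \<open>Anti-concentration of Gaussian maxima\<close>

lemma sum_mult_le_1:
  fixes u v :: "'i \<Rightarrow> real"
  assumes "(\<Sum>i\<in>I. (u i)\<^sup>2) = 1" "(\<Sum>i\<in>I. (v i)\<^sup>2) = 1"
  shows "(\<Sum>i\<in>I. u i * v i) \<le> 1"
proof -
  have "(\<Sum>i\<in>I. u i * v i) \<le> (\<Sum>i\<in>I. ((u i)\<^sup>2 + (v i)\<^sup>2) / 2)"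
    using sum_squares_bound[of "u _" "v _"] by (intro sum_mono) (simp add: field_simps power2_eq_square mult_ac)
  also have "\<dots> = 1" using assms by (simp add: sum.distrib flip: sum_divide_distrib)
  finally show ?thesis .
qed

text \<open>
  Moving \<open>z\<close> by \<open>m \<eta>\<close> in the direction \<open>u j\<close> maps the part of the slab on which \<open>j\<close> is the first
  maximiser into the corresponding part of the slab at level \<open>b + m \<eta>\<close>. The slabs at levels
  \<open>b, b + \<eta>, b + 2 \<eta>, \<dots>\<close> are disjoint, and because of \<open>b \<le> c\<close> about \<open>1 / (c \<eta>)\<close> of them have at
  least \<open>exp (-2)\<close> times the probability of the first one.
\<close>

lemma gauss_slab:
  fixes u :: "'v \<Rightarrow> 'i \<Rightarrow> real" and b :: "'v \<Rightarrow> real"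
  assumes I: "finite I" and V: "finite V" and u: "\<And>j. j \<in> V \<Longrightarrow> (\<Sum>i\<in>I. (u j i)\<^sup>2) = 1"
    and b: "\<And>j. j \<in> V \<Longrightarrow> b j \<le> c" and c: "c \<ge> 1" and \<eta>: "\<eta> > 0"
  shows "measure (gaussP I) {z \<in> space (gaussP I). (\<exists>j\<in>V. b j < (\<Sum>i\<in>I. u j i * z i)) \<and>
     (\<forall>j\<in>V. (\<Sum>i\<in>I. u j i * z i) \<le> b j + \<eta>)} \<le> 18 * c * \<eta>"
proof -
  interpret P: prob_space "gaussP I" by (rule prob_space_gaussP)
  define \<xi> where "\<xi> j z = (\<Sum>i\<in>I. u j i * z i)" for j z
  have [measurable]: "\<xi> j \<in> borel_measurable (Pi\<^sub>M I (\<lambda>_. borel))" "\<xi> j \<in> borel_measurable (gaussP I)" for j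
    unfolding \<xi>_def by measurable
  define S where "S m = {z \<in> space (gaussP I). (\<exists>j\<in>V. b j + real m * \<eta> < \<xi> j z) \<and>
     (\<forall>j\<in>V. \<xi> j z \<le> b j + real m * \<eta> + \<eta>)}" for m :: nat
  obtain r :: "'v \<Rightarrow> nat" where r: "inj_on r V" using V finite_imp_inj_to_nat_seg by blast
  \<comment> \<open>Ties between maximisers are broken by an injection \<open>r\<close> into the
    natural numbers. The pieces \<open>Sj m j\<close> thereby become disjoint, and their
    probabilities add up to that of the slab.\<close>
  define first where "first j z \<longleftrightarrow> (\<forall>k\<in>V. \<xi> k z - b k \<le> \<xi> j z - b j \<and> (r k < r j \<longrightarrow> \<xi> k z - b k < \<xi> j z - b j))"
    for j z
  define Sj where "Sj m j = {z \<in> space (gaussP I). b j + real m * \<eta> < \<xi> j z \<and>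
     \<xi> j z \<le> b j + real m * \<eta> + \<eta> \<and> first j z}" for m j
  have S [measurable]: "S m \<in> sets (gaussP I)" for m unfolding S_def using V by measurable
  have [measurable]: "Measurable.pred (gaussP I) (first j)" for j
  proof -
    have "first j = (\<lambda>z. (\<forall>k\<in>V. \<not> \<xi> j z - b j < \<xi> k z - b k) \<and>
        (\<forall>k\<in>{k\<in>V. r k < r j}. \<xi> k z - b k < \<xi> j z - b j))"
      by (auto simp: first_def fun_eq_iff not_less)
    then show ?thesis using V by (simp only:) measurable
  qed
  have Sjm [measurable]: "Sj m j \<in> sets (gaussP I)" for m j unfolding Sj_def by measurable
  have ex_first: "\<exists>j\<in>V. first j z" if "V \<noteq> {}" for z
  proof -
    define D where "D k = \<xi> k z - b k" for k
    define W where "W = {k\<in>V. \<forall>l\<in>V. D l \<le> D k}"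
    have "Max (D ` V) \<in> D ` V" using V that by (intro Max_in) auto
    then obtain k where "k \<in> V" "D k = Max (D ` V)" by auto
    then have "k \<in> W" using V by (auto simp: W_def)
    define j where "j = arg_min r (\<lambda>k. k \<in> W)"
    have j: "j \<in> W" "\<And>k. k \<in> W \<Longrightarrow> r j \<le> r k"
      using arg_min_nat_lemma[of "\<lambda>k. k \<in> W", OF \<open>k \<in> W\<close>, of r] by (auto simp: j_def)
    have "D l < D j" if "l \<in> V" "r l < r j" for l
    proof (rule ccontr)
      assume "\<not> D l < D j"
      then have "l \<in> W" using j(1) that by (force simp: W_def)
      with j(2) that show False by force
    qed
    then show ?thesis using j(1) by (auto simp: W_def D_def first_def intro!: bexI[of _ j])
  qed
  have S_eq: "S m = (\<Union>j\<in>V. Sj m j)" for m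
  proof (intro equalityI subsetI)
    fix z assume z: "z \<in> S m"
    then have "V \<noteq> {}" by (auto simp: S_def)
    from ex_first[OF this, of z] obtain j where j: "j \<in> V" "first j z" by auto
    from z obtain k where "k \<in> V" "b k + real m * \<eta> < \<xi> k z" by (auto simp: S_def)
    then have "b j + real m * \<eta> < \<xi> j z" using j by (force simp: first_def)
    then show "z \<in> (\<Union>j\<in>V. Sj m j)" using z j by (auto simp: Sj_def S_def)
  next
    fix z assume "z \<in> (\<Union>j\<in>V. Sj m j)"
    then show "z \<in> S m" by (force simp: S_def Sj_def first_def)
  qed
  have disj: "disjoint_family_on (Sj m) V" for m
  proof (unfold disjoint_family_on_def, intro ballI impI)
    fix j k assume jk: "j \<in> V" "k \<in> V" "j \<noteq> k"
    then have "r j \<noteq> r k" using r by (auto simp: inj_on_def)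
    then have "r j < r k \<or> r k < r j" by linarith
    then have "\<not> (first j z \<and> first k z)" for z
      using jk by (force simp: first_def)
    then show "Sj m j \<inter> Sj m k = {}" by (auto simp: Sj_def)
  qed
  have PS: "P.prob (S m) = (\<Sum>j\<in>V. P.prob (Sj m j))" for m
    unfolding S_eq by (rule P.finite_measure_finite_Union) (use V disj Sjm in auto)
  have "disjoint_family S"
  proof (unfold disjoint_family_on_def, intro ballI impI)
    fix m m' :: nat assume "m \<noteq> m'"
    have *: "S a \<inter> S b' = {}" if "a < b'" for a b'
    proof -
      have "real a + 1 \<le> real b'" using that by linarith
      then have "real a * \<eta> + \<eta> \<le> real b' * \<eta>"
        using mult_right_mono[of "real a + 1" "real b'" \<eta>] \<eta> by (simp add: algebra_simps)
      then show ?thesis by (force simp: S_def)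
    qed
    from \<open>m \<noteq> m'\<close> have "m < m' \<or> m' < m" by linarith
    with *[of m m'] *[of m' m] show "S m \<inter> S m' = {}" by blast
  qed
  then have sum1: "(\<Sum>m<k. P.prob (S m)) \<le> 1" for k
  proof -
    have "P.prob (\<Union>m<k. S m) = (\<Sum>m<k. P.prob (S m))"
      using \<open>disjoint_family S\<close> S by (intro P.finite_measure_finite_Union) (auto simp: disjoint_family_on_def)
    then show ?thesis using P.prob_le_1[of "\<Union>m<k. S m"] by linarith
  qed
  have shift: "exp (-2) * P.prob (S 0) \<le> P.prob (S m)" if m: "real m * \<eta> \<le> 1 / c" "\<eta> \<le> 1/18" for m
  proof -
    define s where "s = real m * \<eta>"
    have s: "s \<ge> 0" "s * c \<le> 1" using \<eta> m c by (auto simp: s_def field_simps)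
    then have s1: "s \<le> 1" using c mult_left_mono[of 1 c s] by simp
    have "exp (-2) * P.prob (Sj 0 j) \<le> P.prob (Sj m j)" if j: "j \<in> V" for j
    proof (rule gauss_shift_le[where a = "\<lambda>i. s * u j i", OF I Sjm Sjm])
      fix z assume z: "z \<in> Sj 0 j"
      have x: "\<xi> k (\<lambda>i\<in>I. z i + s * u j i) = \<xi> k z + s * (\<Sum>i\<in>I. u k i * u j i)" for k
        by (simp add: \<xi>_def algebra_simps sum.distrib sum_distrib_left cong: sum.cong)
      have xj: "\<xi> j (\<lambda>i\<in>I. z i + s * u j i) = \<xi> j z + s"
        using x[of j] u[OF j] by (simp add: power2_eq_square)
      \<comment> \<open>Unit vectors have inner product at most 1, so no coordinate gains more than
        coordinate \<open>j\<close>, and \<open>j\<close> stays the first maximiser after the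
        shift.\<close>
      have xk: "\<xi> k (\<lambda>i\<in>I. z i + s * u j i) \<le> \<xi> k z + s" if "k \<in> V" for k
        using x[of k] mult_left_mono[OF sum_mult_le_1[OF u[OF that] u[OF j]] s(1)] by simp
      have "first j (\<lambda>i\<in>I. z i + s * u j i)"
        using z xk unfolding first_def xj Sj_def by force
      then show "(\<lambda>i\<in>I. z i + s * u j i) \<in> Sj m j"
        using z by (simp add: Sj_def xj s_def[symmetric] space_PiM)
      have "\<xi> j z \<le> c + 1/18" using z b[OF j] that m by (auto simp: Sj_def)
      then have "s * \<xi> j z \<le> s * (c + 1/18)" using s by (intro mult_left_mono)
      also have "\<dots> \<le> 1 + 1/18" using s s1 by (simp add: algebra_simps)
      finally have 1: "s * \<xi> j z \<le> 1 + 1/18" .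
      have 2: "s\<^sup>2 \<le> 1" using s s1 by (simp add: power_le_one)
      have "(\<Sum>i\<in>I. s * u j i * z i) = s * \<xi> j z" by (simp add: \<xi>_def sum_distrib_left mult.assoc)
      moreover have "(\<Sum>i\<in>I. (s * u j i)\<^sup>2) = s\<^sup>2"
        using u[OF j] by (simp add: power_mult_distrib flip: sum_distrib_left)
      \<comment> \<open>The linear term costs at most \<open>1 + 1/18\<close> and the quadratic one
        at most 1/2, together less than 2.\<close>
      ultimately show "- 2 \<le> - (\<Sum>i\<in>I. s * u j i * z i) - (\<Sum>i\<in>I. (s * u j i)\<^sup>2) / 2"
        using 1 2 by simp
    qed
    then show ?thesis unfolding PS sum_distrib_left by (rule sum_mono)
  qed
  have "P.prob (S 0) \<le> 18 * c * \<eta>"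
  \<comment> \<open>The constant is 9 * 2: \<open>exp 2 \<le> 9\<close>, and rounding
    \<open>1 / (c * \<eta>)\<close> down to the number of usable slabs loses at most a factor 2 once
    \<open>c * \<eta>\<close> is below 1/18. Above that value the bound is trivial.\<close>
  proof (cases "18 * c * \<eta> \<ge> 1")
    case True
    then show ?thesis using P.prob_le_1[of "S 0"] by linarith
  next
    case False
    have ce: "c * \<eta> > 0" using c \<eta> by simp
    have "\<eta> \<le> c * \<eta>" using c \<eta> by simp
    with False have \<eta>18: "\<eta> \<le> 1/18" by simp
    define k where "k = nat \<lfloor>1 / (c * \<eta>)\<rfloor>"
    have k: "real k \<le> 1 / (c * \<eta>)" "real k \<ge> 1 / (c * \<eta>) - 1"
      using ce by (simp_all add: k_def of_nat_nat)
    have "exp (-2) * P.prob (S 0) \<le> P.prob (S m)" if "m < k" for m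
    proof (rule shift[OF _ \<eta>18])
      have "real m * \<eta> \<le> real k * \<eta>" using that \<eta> by simp
      also have "\<dots> \<le> 1 / (c * \<eta>) * \<eta>" using k \<eta> by (intro mult_right_mono) auto
      finally show "real m * \<eta> \<le> 1 / c" using \<eta> by simp
    qed
    then have "(\<Sum>m<k. exp (-2) * P.prob (S 0)) \<le> (\<Sum>m<k. P.prob (S m))" by (intro sum_mono) auto
    also have "\<dots> \<le> 1" by (rule sum1)
    finally have 1: "real k * (exp (-2) * P.prob (S 0)) \<le> 1" by simp
    have "exp (2::real) = exp 1 * exp 1" by (simp flip: exp_add)
    also have "\<dots> \<le> 3 * 3" using exp_le by (intro mult_mono) auto
    finally have "exp (-2::real) \<ge> 1 / 9" by (simp add: exp_minus field_simps)
    then have "1 / 9 * P.prob (S 0) \<le> exp (-2) * P.prob (S 0)" by (intro mult_right_mono) auto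
    then have "real k * (1 / 9 * P.prob (S 0)) \<le> real k * (exp (-2) * P.prob (S 0))"
      by (intro mult_left_mono) auto
    with 1 have 2: "real k * P.prob (S 0) \<le> 9" by linarith
    have "1 / (2 * (c * \<eta>)) \<le> 1 / (c * \<eta>) - 1" using ce False by (simp add: field_simps)
    with k have "1 / (2 * (c * \<eta>)) * P.prob (S 0) \<le> real k * P.prob (S 0)"
      by (intro mult_right_mono) auto
    with 2 have "1 / (2 * (c * \<eta>)) * P.prob (S 0) \<le> 9" by linarith
    then show ?thesis using ce by (simp add: field_simps)
  qed
  then show ?thesis by (simp add: S_def \<xi>_def)
qed

text \<open>
  A face at distance \<open>b j > sqrt (2 L)\<close> is handled on its own: moving it to the origin multiplies
  its probability by at least \<open>exp (b j\<^sup>2 / 2) \<ge> exp L\<close>, which pays for the number of faces.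
\<close>

lemma gauss_anti:
  fixes u :: "'v \<Rightarrow> 'i \<Rightarrow> real" and b :: "'v \<Rightarrow> real"
  assumes I: "finite I" and V: "finite V" and u: "\<And>j. j \<in> V \<Longrightarrow> (\<Sum>i\<in>I. (u j i)\<^sup>2) = 1"
    and L: "L \<ge> 1" "ln (card V) \<le> L" and \<eta>: "\<eta> > 0"
  shows "measure (gaussP I) {z \<in> space (gaussP I). (\<exists>j\<in>V. b j < (\<Sum>i\<in>I. u j i * z i)) \<and>
     (\<forall>j\<in>V. (\<Sum>i\<in>I. u j i * z i) \<le> b j + \<eta>)} \<le> 45 * sqrt L * \<eta>" (is "measure _ ?S \<le> _")
proof -
  interpret P: prob_space "gaussP I" by (rule prob_space_gaussP)
  define \<xi> where "\<xi> j z = (\<Sum>i\<in>I. u j i * z i)" for j z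
  have [measurable]: "\<xi> j \<in> borel_measurable (gaussP I)" for j
    unfolding \<xi>_def by measurable
  define c where "c = sqrt (2 * L)"
  have c: "c \<ge> 1" "c \<le> 1.5 * sqrt L"
  proof -
    show "c \<ge> 1" using L by (simp add: c_def)
    have "sqrt 2 \<le> sqrt (1.5^2)" by (intro real_sqrt_le_mono) (simp add: power2_eq_square)
    then have "sqrt 2 \<le> 1.5" by simp
    then show "c \<le> 1.5 * sqrt L" using L unfolding c_def real_sqrt_mult by (intro mult_right_mono) auto
  qed
  define V1 where "V1 = {j\<in>V. b j \<le> c}"
  define V2 where "V2 = {j\<in>V. b j > c}"
  define S1 where "S1 = {z \<in> space (gaussP I). (\<exists>j\<in>V1. b j < \<xi> j z) \<and> (\<forall>j\<in>V1. \<xi> j z \<le> b j + \<eta>)}"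
  define S2 where "S2 j = {z \<in> space (gaussP I). b j < \<xi> j z \<and> \<xi> j z \<le> b j + \<eta>}" for j
  define S3 where "S3 j = {z \<in> space (gaussP I). 0 < \<xi> j z \<and> \<xi> j z \<le> \<eta>}" for j
  have fin: "finite V1" "finite V2" using V by (auto simp: V1_def V2_def)
  have [measurable]: "S1 \<in> sets (gaussP I)" unfolding S1_def using fin by measurable
  have m2 [measurable]: "S2 j \<in> sets (gaussP I)" "S3 j \<in> sets (gaussP I)" for j
    unfolding S2_def S3_def by measurable
  have s1: "P.prob S1 \<le> 18 * c * \<eta>"
    unfolding S1_def \<xi>_def by (rule gauss_slab[OF I fin(1)]) (use u c \<eta> in \<open>auto simp: V1_def\<close>)
  have s2: "P.prob (S2 j) \<le> exp (- L) * (18 * \<eta>)" if j: "j \<in> V2" for j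
  proof -
    have jV: "j \<in> V" and bc: "b j > c" using j by (auto simp: V2_def)
    have b0: "b j \<ge> 0" using bc c by linarith
    have "c\<^sup>2 \<le> (b j)\<^sup>2" using bc c by (intro power_mono) auto
    then have bL: "L \<le> (b j)\<^sup>2 / 2" using L by (simp add: c_def)
    have "exp L * P.prob (S2 j) \<le> P.prob (S3 j)"
    proof (rule gauss_shift_le[where a = "\<lambda>i. - b j * u j i", OF I m2])
      fix z assume z: "z \<in> S2 j"
      have "\<xi> j (\<lambda>i\<in>I. z i + - b j * u j i) = \<xi> j z - b j * (\<Sum>i\<in>I. (u j i)\<^sup>2)"
        unfolding \<xi>_def sum_distrib_left sum_subtractf[symmetric]
        by (intro sum.cong) (auto simp: algebra_simps power2_eq_square)
      then show "(\<lambda>i\<in>I. z i + - b j * u j i) \<in> S3 j"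
        using z u[OF jV] by (simp add: S2_def S3_def space_PiM)
      have "(\<Sum>i\<in>I. - b j * u j i * z i) = - b j * \<xi> j z"
        by (simp add: \<xi>_def sum_distrib_left sum_negf mult.assoc)
      moreover have "(\<Sum>i\<in>I. (- b j * u j i)\<^sup>2) = (b j)\<^sup>2"
        using u[OF jV] by (simp add: power_mult_distrib flip: sum_distrib_left)
      moreover have "b j * \<xi> j z \<ge> b j * b j" using z b0 by (intro mult_left_mono) (auto simp: S2_def)
      ultimately show "L \<le> - (\<Sum>i\<in>I. - b j * u j i * z i) - (\<Sum>i\<in>I. (- b j * u j i)\<^sup>2) / 2"
        using bL by (simp add: power2_eq_square)
    qed
    also have "P.prob (S3 j) \<le> 18 * 1 * \<eta>"
      using gauss_slab[OF I, of "{j}" u "\<lambda>_. 0" 1 \<eta>] u[OF jV] \<eta> by (simp add: S3_def \<xi>_def)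
    finally show ?thesis by (simp add: exp_minus field_simps)
  qed
  \<comment> \<open>The face that is exceeded is either near, and then the point lies in the slab of
    the near faces, or far, and then it lies in the strip of that face alone.\<close>
  have "?S \<subseteq> S1 \<union> (\<Union>j\<in>V2. S2 j)"
    by (force simp: S1_def S2_def V1_def V2_def \<xi>_def)
  then have "P.prob ?S \<le> P.prob (S1 \<union> (\<Union>j\<in>V2. S2 j))"
    by (rule P.finite_measure_mono) (use fin m2 in \<open>auto intro!: sets.Un sets.finite_UN\<close>)
  also have "\<dots> \<le> P.prob S1 + P.prob (\<Union>j\<in>V2. S2 j)"
    by (rule measure_Un_le) (use fin m2 in \<open>auto intro!: sets.finite_UN\<close>)
  also have "P.prob (\<Union>j\<in>V2. S2 j) \<le> (\<Sum>j\<in>V2. P.prob (S2 j))"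
    using fin by (intro P.finite_measure_subadditive_finite) auto
  also have "\<dots> \<le> (\<Sum>j\<in>V2. exp (- L) * (18 * \<eta>))" by (intro sum_mono s2)
  also have "\<dots> = real (card V2) * exp (- L) * (18 * \<eta>)" by simp
  also have "\<dots> \<le> 1 * (18 * \<eta>)"
  proof (intro mult_right_mono)
    show "real (card V2) * exp (- L) \<le> 1"
    proof (cases "V2 = {}")
      case False
      then have "card V2 > 0" using fin by (simp add: card_gt_0_iff)
      moreover have "card V2 \<le> card V" using V by (intro card_mono) (auto simp: V2_def)
      ultimately have "ln (card V2) \<le> L" using L(2) by (auto intro: order.trans[OF _ L(2)])
      then have "exp (ln (real (card V2))) \<le> exp L" by simp
      then have "real (card V2) \<le> exp L" using \<open>card V2 > 0\<close> by simp
      then show ?thesis by (simp add: exp_minus field_simps)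
    qed simp
  qed (use \<eta> in auto)
  finally have "P.prob ?S \<le> 18 * c * \<eta> + 18 * \<eta>" using s1 by simp
  \<comment> \<open>The near faces give 27 and the far ones 18, hence 45.\<close>
  also have "\<dots> \<le> 18 * (1.5 * sqrt L) * \<eta> + 18 * sqrt L * \<eta>"
    using c L \<eta> by (intro add_mono mult_right_mono mult_left_mono) auto
  finally show ?thesis by (simp add: field_simps)
qed

text \<open>Dividing every coordinate by its standard deviation reduces the claim to unit vectors.
  The thresholds are arbitrary and may be divided as well, and the widths become at most
  \<open>\<eta> / \<sigma>\<close>. For \<open>\<eta> = 0\<close> the slab is empty.\<close>

lemma gauss_anti_var:
  fixes u :: "'v \<Rightarrow> 'i \<Rightarrow> real" and b :: "'v \<Rightarrow> real"
  assumes I: "finite I" and V: "finite V" and u: "\<And>j. j \<in> V \<Longrightarrow> (\<Sum>i\<in>I. (u j i)\<^sup>2) \<ge> \<sigma>\<^sup>2" and \<sigma>: "\<sigma> > 0"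
    and L: "L \<ge> 1" "ln (card V) \<le> L" and \<eta>: "\<eta> \<ge> 0"
  shows "measure (gaussP I) {z \<in> space (gaussP I). (\<exists>j\<in>V. b j < (\<Sum>i\<in>I. u j i * z i)) \<and>
     (\<forall>j\<in>V. (\<Sum>i\<in>I. u j i * z i) \<le> b j + \<eta>)} \<le> 45 * sqrt L * \<eta> / \<sigma>" (is "measure _ ?S \<le> _")
proof (cases "\<eta> = 0")
  case True
  then have e: "?S = {}" by force
  show ?thesis unfolding e using True by simp
next
  case False
  interpret P: prob_space "gaussP I" by (rule prob_space_gaussP)
  define n where "n j = sqrt (\<Sum>i\<in>I. (u j i)\<^sup>2)" for j
  have n: "n j \<ge> \<sigma>" "n j > 0" if "j \<in> V" for j
  proof -
    show "n j \<ge> \<sigma>" using u[OF that] \<sigma> by (simp add: n_def real_le_rsqrt)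
    then show "n j > 0" using \<sigma> by simp
  qed
  have un: "(\<Sum>i\<in>I. (u j i / n j)\<^sup>2) = 1" if "j \<in> V" for j
  proof -
    have "(\<Sum>i\<in>I. (u j i / n j)\<^sup>2) = (\<Sum>i\<in>I. (u j i)\<^sup>2) / (n j)\<^sup>2"
      by (simp add: power_divide sum_divide_distrib)
    also have "(\<Sum>i\<in>I. (u j i)\<^sup>2) = (n j)\<^sup>2" by (simp add: n_def sum_nonneg)
    finally show ?thesis using n(2)[OF that] by simp
  qed
  let ?S' = "{z \<in> space (gaussP I). (\<exists>j\<in>V. b j / n j < (\<Sum>i\<in>I. u j i / n j * z i)) \<and>
     (\<forall>j\<in>V. (\<Sum>i\<in>I. u j i / n j * z i) \<le> b j / n j + \<eta> / \<sigma>)}"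
  have eq: "(\<Sum>i\<in>I. u j i / n j * z i) = (\<Sum>i\<in>I. u j i * z i) / n j" for j z
    by (simp add: sum_divide_distrib)
  have "?S \<subseteq> ?S'"
  proof (safe)
    fix z j assume "j \<in> V" "b j < (\<Sum>i\<in>I. u j i * z i)"
    then show "\<exists>j\<in>V. b j / n j < (\<Sum>i\<in>I. u j i / n j * z i)"
      unfolding eq using n by (auto intro!: bexI[of _ j] divide_strict_right_mono)
  next
    fix z j assume j: "j \<in> V" and *: "\<forall>j\<in>V. (\<Sum>i\<in>I. u j i * z i) \<le> b j + \<eta>"
    have "(\<Sum>i\<in>I. u j i * z i) / n j \<le> (b j + \<eta>) / n j"
      using * j n(2)[OF j] by (auto intro!: divide_right_mono)
    also have "\<dots> \<le> b j / n j + \<eta> / \<sigma>"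
      using n[OF j] \<sigma> \<eta> by (simp add: add_divide_distrib frac_le)
    finally show "(\<Sum>i\<in>I. u j i / n j * z i) \<le> b j / n j + \<eta> / \<sigma>" unfolding eq .
  qed
  then have "P.prob ?S \<le> P.prob ?S'"
    using V by (intro P.finite_measure_mono) measurable
  also have "\<dots> \<le> 45 * sqrt L * (\<eta> / \<sigma>)"
    by (rule gauss_anti[OF I V un L]) (use False \<eta> \<sigma> in auto)
  finally show ?thesis by simp
qed

section \<open>Gaussian integration by parts\<close>

lemma std_normal_density_tendsto_0:
  "(std_normal_density \<longlongrightarrow> 0) at_top" "(std_normal_density \<longlongrightarrow> 0) at_bot"
proof -
  have *: "(std_normal_density \<longlongrightarrow> 0) F" if "filterlim (\<lambda>x::real. x ^ 2) at_top F" for F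
  proof -
    have "filterlim (\<lambda>x::real. - ((1/2) * x ^ 2)) at_bot F"
      by (intro filterlim_uminus_at_bot_at_top[THEN filterlim_compose] filterlim_tendsto_pos_mult_at_top[OF tendsto_const] that) simp
    from filterlim_compose[OF exp_at_bot this]
    have "((\<lambda>x::real. (1 / sqrt (2 * pi)) * exp (- ((1/2) * x ^ 2))) \<longlongrightarrow> (1 / sqrt (2 * pi)) * 0) F"
      by (intro tendsto_mult tendsto_const)
    then show ?thesis unfolding std_normal_density_def[abs_def] by simp
  qed
  show "(std_normal_density \<longlongrightarrow> 0) at_top"
    by (rule *, rule filterlim_pow_at_top) (auto intro: filterlim_ident)
  show "(std_normal_density \<longlongrightarrow> 0) at_bot"
    by (rule *, rule filterlim_pow_at_bot_even) (auto intro: filterlim_ident)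
qed

text \<open>The fundamental theorem of calculus on the whole line, applied to \<open>g\<close> times
  the normal density. Its derivative is \<open>g' x - x * g x\<close> times the density, and its
  limits at both ends vanish because \<open>g\<close> is bounded.\<close>

lemma gauss_stein_1:
  fixes g g' :: "real \<Rightarrow> real"
  assumes d: "\<And>x. (g has_real_derivative g' x) (at x)" and c: "\<And>x. isCont g' x"
    and b: "\<And>x. \<bar>g x\<bar> \<le> C" "\<And>x. \<bar>g' x\<bar> \<le> C"
  shows "(\<integral>x. x * g x \<partial>gauss) = (\<integral>x. g' x \<partial>gauss)"
proof -
  let ?\<phi> = std_normal_density
  have cg: "isCont g x" for x using d by (rule DERIV_isCont)
  have [measurable]: "g \<in> borel_measurable borel" "g' \<in> borel_measurable borel"
    using cg c by (auto intro!: borel_measurable_continuous_onI continuous_at_imp_continuous_on)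
  have d\<phi>: "(?\<phi> has_real_derivative - x * ?\<phi> x) (at x)" for x
  proof -
    have "((\<lambda>x. exp (- x\<^sup>2 / 2)) has_real_derivative exp (- x\<^sup>2 / 2) * (- x)) (at x)"
      by (auto intro!: derivative_eq_intros)
    from DERIV_cmult[OF this, of "1 / sqrt (2 * pi)"] show ?thesis
      by (simp add: std_normal_density_def[abs_def] mult_ac)
  qed
  have D: "((\<lambda>x. g x * ?\<phi> x) has_real_derivative (g' x * ?\<phi> x - ?\<phi> x * x * g x)) (at x)" for x
    by (rule DERIV_cong[OF DERIV_mult[OF d d\<phi>]]) (simp add: algebra_simps)
  have i1: "integrable lborel (\<lambda>x. ?\<phi> x * x * g x)"
    by (rule Bochner_Integration.integrable_bound[OF integrable_mult_right[OF integrable_std_normal_moment_abs[of 1], of C]])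
      (auto simp: abs_mult mult_ac intro!: AE_I2 mult_left_mono mult_right_mono order.trans[OF b(1) abs_ge_self])
  have i2: "integrable lborel (\<lambda>x. g' x * ?\<phi> x)"
    by (rule Bochner_Integration.integrable_bound[OF integrable_mult_right[OF integrable_normal_density[where \<mu>=0 and \<sigma>=1], of C]])
      (auto simp: abs_mult intro!: AE_I2 mult_right_mono order.trans[OF b(2) abs_ge_self])
  have lim: "((\<lambda>x. g x * ?\<phi> x) \<longlongrightarrow> 0) F" if "(?\<phi> \<longlongrightarrow> 0) F" for F
  proof (rule Lim_null_comparison)
    show "((\<lambda>x. C * ?\<phi> x) \<longlongrightarrow> 0) F" using tendsto_mult[OF tendsto_const that, of C] by simp
    show "\<forall>\<^sub>F x in F. norm (g x * ?\<phi> x) \<le> C * ?\<phi> x"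
      by (auto simp: abs_mult intro!: always_eventually mult_right_mono b)
  qed
  have "(LBINT x=-\<infinity>..\<infinity>. g' x * ?\<phi> x - ?\<phi> x * x * g x) = 0 - 0"
  proof (rule interval_integral_FTC_integrable[where F = "\<lambda>x. g x * ?\<phi> x"])
    show "((\<lambda>x. g x * ?\<phi> x) has_vector_derivative g' x * ?\<phi> x - ?\<phi> x * x * g x) (at x)" for x
      using D[of x] by (simp add: has_real_derivative_iff_has_vector_derivative)
    show "isCont (\<lambda>x. g' x * ?\<phi> x - ?\<phi> x * x * g x) x" for x
      by (intro continuous_intros c cg DERIV_isCont[OF d\<phi>])
    show "set_integrable lborel (einterval (-\<infinity>) \<infinity>) (\<lambda>x. g' x * ?\<phi> x - ?\<phi> x * x * g x)"
      using i1 i2 by (simp add: set_integrable_def)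
    show "(((\<lambda>x. g x * ?\<phi> x) \<circ> real_of_ereal) \<longlongrightarrow> 0) (at_right (-\<infinity>))"
      unfolding ereal_tendsto_simps by (intro lim std_normal_density_tendsto_0)
    show "(((\<lambda>x. g x * ?\<phi> x) \<circ> real_of_ereal) \<longlongrightarrow> 0) (at_left \<infinity>)"
      unfolding ereal_tendsto_simps by (intro lim std_normal_density_tendsto_0)
  qed simp
  then have "(\<integral>x. g' x * ?\<phi> x - ?\<phi> x * x * g x \<partial>lborel) = 0"
    by (simp add: interval_lebesgue_integral_def set_lebesgue_integral_def)
  then have "(\<integral>x. g' x * ?\<phi> x \<partial>lborel) = (\<integral>x. ?\<phi> x * x * g x \<partial>lborel)"
    using i1 i2 by simp
  then show ?thesis by (simp add: integral_density mult_ac)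
qed

lemma integrable_gaussP_component:
  assumes "finite I" "i \<in> I" shows "integrable (gaussP I) (\<lambda>z. z i)"
proof -
  interpret product_prob_space "\<lambda>_::'a. gauss" by (simp add: product_prob_space_def product_prob_space_axioms_def
    product_sigma_finite_gauss prob_space_gauss)
  have "integrable gauss (\<lambda>x. x ^ 1)" by (rule integrable_std_normal_distribution_moment)
  then have "integrable (distr (gaussP I) gauss (\<lambda>z. z i)) (\<lambda>x. x)"
    using assms by (subst PiM_component) auto
  then show ?thesis using assms by (subst (asm) integrable_distr_eq) auto
qed

text \<open>Fubini's theorem isolates coordinate \<open>i\<close>, and the one-dimensional identity
  applies with the others held fixed.\<close>

lemma gauss_stein:
  fixes g g' :: "('i \<Rightarrow> real) \<Rightarrow> real"
  assumes I: "finite I" "i \<in> I"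
    and [measurable]: "g \<in> borel_measurable (gaussP I)" "g' \<in> borel_measurable (gaussP I)"
    and d: "\<And>z x. ((\<lambda>x. g (z(i := x))) has_real_derivative g' (z(i := x))) (at x)"
    and c: "\<And>z x. isCont (\<lambda>x. g' (z(i := x))) x"
    and b: "\<And>z. \<bar>g z\<bar> \<le> C" "\<And>z. \<bar>g' z\<bar> \<le> C"
  shows "(\<integral>z. z i * g z \<partial>gaussP I) = (\<integral>z. g' z \<partial>gaussP I)"
proof -
  interpret product_sigma_finite "\<lambda>i. gauss" by (rule product_sigma_finite_gauss)
  interpret P: prob_space "gaussP I" by (rule prob_space_gaussP)
  obtain J where J: "I = insert i J" "i \<notin> J" "finite J"
    using I by (metis finite_insert mk_disjoint_insert)
  have i1: "integrable (gaussP I) (\<lambda>z. z i * g z)"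
    by (rule Bochner_Integration.integrable_bound[OF integrable_mult_left[OF integrable_gaussP_component[OF I], of C]])
      (use I in \<open>auto simp: abs_mult intro!: AE_I2 mult_left_mono mult_right_mono order.trans[OF b(1) abs_ge_self]\<close>)
  have i2: "integrable (gaussP I) g'"
    by (rule P.integrable_const_bound[of _ C]) (use b in auto)
  have "(\<integral>z. z i * g z \<partial>gaussP I) = (\<integral>z. (\<integral>x. x * g (z(i := x)) \<partial>gauss) \<partial>gaussP J)"
    using product_integral_insert[OF J(3,2) i1[unfolded J(1)]] by (simp add: J(1))
  also have "\<dots> = (\<integral>z. (\<integral>x. g' (z(i := x)) \<partial>gauss) \<partial>gaussP J)"
    by (intro Bochner_Integration.integral_cong refl gauss_stein_1[where C=C] d c b)
  also have "\<dots> = (\<integral>z. g' z \<partial>gaussP I)"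
    using product_integral_insert[OF J(3,2) i2[unfolded J(1)]] by (simp add: J(1))
  finally show ?thesis .
qed

section \<open>Stein's method for dependency graphs\<close>

lemma continuous_step: "isCont step0 x" "isCont step1 x" "isCont step2 x"
  by (rule DERIV_isCont, rule DERIV_step0 DERIV_step1 DERIV_step2)+

lemma borel_measurable_step [measurable]:
  "step0 \<in> borel_measurable borel" "step1 \<in> borel_measurable borel" "step2 \<in> borel_measurable borel"
  by (auto intro!: borel_measurable_continuous_onI continuous_at_imp_continuous_on continuous_step)

context smooth_max
begin

lemma measurable_smooth:
  assumes [measurable]: "\<And>j. j \<in> V \<Longrightarrow> (\<lambda>\<omega>. x \<omega> j) \<in> borel_measurable N"
  shows "(\<lambda>\<omega>. lse (x \<omega>)) \<in> borel_measurable N"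
    and "j \<in> V \<Longrightarrow> (\<lambda>\<omega>. wt (x \<omega>) j) \<in> borel_measurable N"
    and "(\<lambda>\<omega>. F (x \<omega>)) \<in> borel_measurable N"
    and "j \<in> V \<Longrightarrow> (\<lambda>\<omega>. D1 (x \<omega>) j) \<in> borel_measurable N"
    and "j \<in> V \<Longrightarrow> k \<in> V \<Longrightarrow> (\<lambda>\<omega>. D2 (x \<omega>) j k) \<in> borel_measurable N"
    and "Measurable.pred N (\<lambda>\<omega>. wnd c (x \<omega>))"
proof -
  have s [measurable]: "(\<lambda>\<omega>. \<Sum>j\<in>V. exp (\<beta> * x \<omega> j)) \<in> borel_measurable N"
    by (intro borel_measurable_sum) measurable
  show l [measurable]: "(\<lambda>\<omega>. lse (x \<omega>)) \<in> borel_measurable N"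
    unfolding lse_def by measurable
  show w: "(\<lambda>\<omega>. wt (x \<omega>) j) \<in> borel_measurable N" if [measurable]: "j \<in> V" for j
    unfolding wt_def by measurable
  show "(\<lambda>\<omega>. F (x \<omega>)) \<in> borel_measurable N" unfolding F_def by measurable
  have [measurable]: "(\<lambda>\<omega>. p1 (x \<omega>)) \<in> borel_measurable N" unfolding p1_def by measurable
  have [measurable]: "(\<lambda>\<omega>. p2 (x \<omega>)) \<in> borel_measurable N" unfolding p2_def by measurable
  show "(\<lambda>\<omega>. D1 (x \<omega>) j) \<in> borel_measurable N" if j: "j \<in> V"
  proof -
    note [measurable] = w[OF j]
    show ?thesis unfolding D1_def by measurable
  qed
  show "(\<lambda>\<omega>. D2 (x \<omega>) j k) \<in> borel_measurable N" if j: "j \<in> V" and k: "k \<in> V"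
  proof -
    note [measurable] = w[OF j] w[OF k]
    show ?thesis unfolding D2_def by measurable
  qed
  show "Measurable.pred N (\<lambda>\<omega>. wnd c (x \<omega>))" unfolding wnd_def by measurable
qed

end

section \<open>Moments and factorisation in a dependent field\<close>

lemma exp_ge_power: "x \<ge> 0 \<Longrightarrow> x ^ k \<le> fact k * exp (x::real)"
  using exp_ge_one_plus_x_over_n_power_n sum_le_suminf[OF summable_exp[of x], of "{k}"]
  by (auto simp: exp_def field_simps scaleR_conv_of_real)

text \<open>\<open>Y t\<close> gathers the projections of one vector on all normals, so that the
  dimension disappears and \<open>V\<close> takes its place. The bound 6 is what an Orlicz norm
  yields after its scale is doubled. For the second degree, only the union of two adjacent
  neighbourhoods matters.\<close>

locale dep_field = prob_space M + smooth_max V \<beta> L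
  for M :: "'a measure" and V :: "'v set" and \<beta> L :: real +
  fixes Y :: "nat \<Rightarrow> 'a \<Rightarrow> 'v \<Rightarrow> real" and n :: nat and nb :: "nat \<Rightarrow> nat set" and B d1 d2 :: real
  assumes n_ge: "n \<ge> 1" and B_pos: "B > 0"
    and Y_meas: "t \<in> {1..n} \<Longrightarrow> Y t \<in> M \<rightarrow>\<^sub>M (\<Pi>\<^sub>M j\<in>V. borel)"
    and nb_sub: "t \<in> {1..n} \<Longrightarrow> nb t \<subseteq> {1..n}" and nb_self: "t \<in> {1..n} \<Longrightarrow> t \<in> nb t"
    and indep: "T \<subseteq> {1..n} \<Longrightarrow> J \<subseteq> {1..n} \<Longrightarrow> (\<And>t. t \<in> T \<Longrightarrow> nb t \<inter> J = {}) \<Longrightarrow>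
        indep_var (\<Pi>\<^sub>M t\<in>T. \<Pi>\<^sub>M j\<in>V. borel) (\<lambda>\<omega>. \<lambda>t\<in>T. Y t \<omega>) (\<Pi>\<^sub>M t\<in>J. \<Pi>\<^sub>M j\<in>V. borel) (\<lambda>\<omega>. \<lambda>t\<in>J. Y t \<omega>)"
    and mean0: "t \<in> {1..n} \<Longrightarrow> j \<in> V \<Longrightarrow> expectation (\<lambda>\<omega>. Y t \<omega> j) = 0"
    and exp_int: "t \<in> {1..n} \<Longrightarrow> j \<in> V \<Longrightarrow> integrable M (\<lambda>\<omega>. exp (\<bar>Y t \<omega> j\<bar> / B))"
    and exp_le6: "t \<in> {1..n} \<Longrightarrow> j \<in> V \<Longrightarrow> expectation (\<lambda>\<omega>. exp (\<bar>Y t \<omega> j\<bar> / B)) \<le> 6"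
    and card_nb: "t \<in> {1..n} \<Longrightarrow> card (nb t) \<le> d1"
    and card_nb2: "t \<in> {1..n} \<Longrightarrow> s \<in> nb t \<Longrightarrow> card (nb t \<union> nb s) \<le> d2"
begin

lemma meas_Y [measurable]: "t \<in> {1..n} \<Longrightarrow> j \<in> V \<Longrightarrow> (\<lambda>\<omega>. Y t \<omega> j) \<in> borel_measurable M"
  using measurable_compose[OF Y_meas measurable_component_singleton] by simp

lemma nb_fin: "t \<in> {1..n} \<Longrightarrow> finite (nb t)"
  using nb_sub finite_subset by blast

lemma d1_ge: "d1 \<ge> 1"
proof -
  have 1: "1 \<in> {1..n}" using n_ge by simp
  have "card {1::nat} \<le> card (nb 1)" using nb_fin[OF 1] nb_self[OF 1] by (intro card_mono) auto
  then show ?thesis using card_nb[OF 1] by simp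
qed

lemma abs_power_le: "\<bar>y\<bar> ^ k \<le> fact k * B ^ k * exp (\<bar>y\<bar> / B)"
proof -
  have "(\<bar>y\<bar> / B) ^ k \<le> fact k * exp (\<bar>y\<bar> / B)" using B_pos by (intro exp_ge_power) auto
  then have "B ^ k * (\<bar>y\<bar> / B) ^ k \<le> B ^ k * (fact k * exp (\<bar>y\<bar> / B))"
    using B_pos by (intro mult_left_mono) auto
  then show ?thesis using B_pos by (simp add: power_divide mult_ac)
qed

lemma integrable_abs_power:
  assumes "t \<in> {1..n}" "j \<in> V" shows "integrable M (\<lambda>\<omega>. \<bar>Y t \<omega> j\<bar> ^ k)"
proof (rule Bochner_Integration.integrable_bound[OF integrable_mult_right[OF exp_int[OF assms], of "fact k * B ^ k"]])
  show "AE \<omega> in M. norm (\<bar>Y t \<omega> j\<bar> ^ k) \<le> norm (fact k * B ^ k * exp (\<bar>Y t \<omega> j\<bar> / B))"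
    using B_pos abs_power_le by (auto simp: abs_mult intro!: AE_I2)
qed (use assms in measurable)

lemma expectation_abs_power:
  assumes "t \<in> {1..n}" "j \<in> V" shows "expectation (\<lambda>\<omega>. \<bar>Y t \<omega> j\<bar> ^ k) \<le> 6 * fact k * B ^ k"
proof -
  have "expectation (\<lambda>\<omega>. \<bar>Y t \<omega> j\<bar> ^ k) \<le> expectation (\<lambda>\<omega>. fact k * B ^ k * exp (\<bar>Y t \<omega> j\<bar> / B))"
    by (intro integral_mono integrable_abs_power integrable_mult_right exp_int assms abs_power_le)
  also have "\<dots> = fact k * B ^ k * expectation (\<lambda>\<omega>. exp (\<bar>Y t \<omega> j\<bar> / B))" by simp
  also have "\<dots> \<le> fact k * B ^ k * 6" using B_pos by (intro mult_left_mono exp_le6 assms) auto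
  finally show ?thesis by (simp add: mult_ac)
qed

lemma integrable_Y: "t \<in> {1..n} \<Longrightarrow> j \<in> V \<Longrightarrow> integrable M (\<lambda>\<omega>. Y t \<omega> j)"
  using integrable_abs_cancel[OF integrable_abs_power[of t j 1, unfolded power_one_right] meas_Y] by blast

lemma abs_mult_le: "\<bar>a * b\<bar> \<le> \<bar>a\<bar> ^ 2 + \<bar>b\<bar> ^ 2" for a b :: real
proof -
  have "2 * (\<bar>a\<bar> * \<bar>b\<bar>) \<le> \<bar>a\<bar> ^ 2 + \<bar>b\<bar> ^ 2"
    using sum_squares_bound[of "\<bar>a\<bar>" "\<bar>b\<bar>"] by (simp only: mult.assoc)
  moreover have "0 \<le> \<bar>a\<bar> * \<bar>b\<bar>" by simp
  ultimately show ?thesis unfolding abs_mult by linarith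
qed

lemma integrable_YY:
  assumes "t \<in> {1..n}" "j \<in> V" "s \<in> {1..n}" "k \<in> V" shows "integrable M (\<lambda>\<omega>. Y t \<omega> j * Y s \<omega> k)"
proof (rule Bochner_Integration.integrable_bound[OF Bochner_Integration.integrable_add[OF integrable_abs_power[OF assms(1,2), of 2] integrable_abs_power[OF assms(3,4), of 2]]])
  show "AE \<omega> in M. norm (Y t \<omega> j * Y s \<omega> k) \<le> norm (\<bar>Y t \<omega> j\<bar>\<^sup>2 + \<bar>Y s \<omega> k\<bar>\<^sup>2)"
    using abs_mult_le[of "Y t _ j" "Y s _ k"] by (auto intro!: AE_I2)
qed (use assms in measurable)

definition Cyy :: "nat \<Rightarrow> nat \<Rightarrow> 'v \<Rightarrow> 'v \<Rightarrow> real" where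
  "Cyy t s j k = expectation (\<lambda>\<omega>. Y t \<omega> j * Y s \<omega> k)"

text \<open>Summed over neighbours only, as the expansion produces it. That this is the covariance
  of \<open>W\<close> is shown in \<open>expectation_WW\<close>.\<close>

definition Xi :: "'v \<Rightarrow> 'v \<Rightarrow> real" where
  "Xi j k = (\<Sum>t\<in>{1..n}. \<Sum>s\<in>nb t. Cyy t s j k) / n"

definition W :: "'a \<Rightarrow> 'v \<Rightarrow> real" where "W \<omega> j = (\<Sum>t\<in>{1..n}. Y t \<omega> j) / sqrt n"

lemma Cyy_bound:
  assumes "t \<in> {1..n}" "j \<in> V" "s \<in> {1..n}" "k \<in> V" shows "\<bar>Cyy t s j k\<bar> \<le> 24 * B\<^sup>2"
proof -
  have "\<bar>Cyy t s j k\<bar> \<le> expectation (\<lambda>\<omega>. \<bar>Y t \<omega> j * Y s \<omega> k\<bar>)"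
    unfolding Cyy_def by (rule integral_abs_bound)
  also have "\<dots> \<le> expectation (\<lambda>\<omega>. \<bar>Y t \<omega> j\<bar>\<^sup>2 + \<bar>Y s \<omega> k\<bar>\<^sup>2)"
    by (intro integral_mono integrable_abs integrable_YY Bochner_Integration.integrable_add integrable_abs_power assms abs_mult_le)
  also have "\<dots> = expectation (\<lambda>\<omega>. \<bar>Y t \<omega> j\<bar>\<^sup>2) + expectation (\<lambda>\<omega>. \<bar>Y s \<omega> k\<bar>\<^sup>2)"
    by (intro Bochner_Integration.integral_add integrable_abs_power assms)
  also have "\<dots> \<le> 6 * fact 2 * B\<^sup>2 + 6 * fact 2 * B\<^sup>2"
    by (intro add_mono expectation_abs_power assms)
  finally show ?thesis by simp
qed

lemma indep_factor:
  assumes T: "T \<subseteq> {1..n}" "J \<subseteq> {1..n}" "\<And>t. t \<in> T \<Longrightarrow> nb t \<inter> J = {}"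
    and f: "f \<in> borel_measurable (\<Pi>\<^sub>M t\<in>T. \<Pi>\<^sub>M j\<in>V. borel)" "integrable M (\<lambda>\<omega>. f (\<lambda>t\<in>T. Y t \<omega>))"
    and h: "h \<in> borel_measurable (\<Pi>\<^sub>M t\<in>J. \<Pi>\<^sub>M j\<in>V. borel)" "integrable M (\<lambda>\<omega>. h (\<lambda>t\<in>J. Y t \<omega>))"
  shows "expectation (\<lambda>\<omega>. f (\<lambda>t\<in>T. Y t \<omega>) * h (\<lambda>t\<in>J. Y t \<omega>) :: real) =
      expectation (\<lambda>\<omega>. f (\<lambda>t\<in>T. Y t \<omega>)) * expectation (\<lambda>\<omega>. h (\<lambda>t\<in>J. Y t \<omega>))"
proof -
  have "indep_var borel (f \<circ> (\<lambda>\<omega>. \<lambda>t\<in>T. Y t \<omega>)) borel (h \<circ> (\<lambda>\<omega>. \<lambda>t\<in>J. Y t \<omega>))"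
    by (rule indep_var_compose[OF indep[OF T] f(1) h(1)])
  then show ?thesis
    using indep_var_lebesgue_integral f(2) h(2) by (simp add: comp_def)
qed

lemma comp2_measurable [measurable]:
  "t \<in> T \<Longrightarrow> j \<in> V \<Longrightarrow> (\<lambda>y. y t j) \<in> borel_measurable (\<Pi>\<^sub>M t\<in>T. \<Pi>\<^sub>M j\<in>V. borel)"
  by (rule measurable_compose[OF measurable_component_singleton[of t T "\<lambda>_. \<Pi>\<^sub>M j\<in>V. borel"]])
    (auto intro: measurable_component_singleton)

text \<open>The summand \<open>B ^ 3\<close> lets one majorant also cover products in which two of
  the three factors have been replaced by a covariance of order \<open>B\<^sup>2\<close>.\<close>

definition Ttr :: "nat \<Rightarrow> 'a \<Rightarrow> 'v \<Rightarrow> real" where "Ttr r \<omega> j = B ^ 3 + \<bar>Y r \<omega> j\<bar> ^ 3"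

lemma Ttr_nonneg: "Ttr r \<omega> j \<ge> 0" using B_pos by (simp add: Ttr_def)

lemma Ttr_int: "r \<in> {1..n} \<Longrightarrow> j \<in> V \<Longrightarrow> integrable M (\<lambda>\<omega>. Ttr r \<omega> j)"
  unfolding Ttr_def by (intro Bochner_Integration.integrable_add integrable_abs_power) auto

lemma Ttr_expect: assumes "r \<in> {1..n}" "j \<in> V" shows "expectation (\<lambda>\<omega>. Ttr r \<omega> j) \<le> 37 * B ^ 3"
proof -
  have "expectation (\<lambda>\<omega>. Ttr r \<omega> j) = B ^ 3 + expectation (\<lambda>\<omega>. \<bar>Y r \<omega> j\<bar> ^ 3)"
    unfolding Ttr_def using integrable_abs_power[OF assms, of 3] by (simp add: prob_space)
  then show ?thesis using expectation_abs_power[OF assms, of 3] by (simp add: fact_numeral)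
qed

text \<open>Only half of the available exponent is spent. The other half is kept for a second
  variable that signals an exceptional value, so that the product of both is controlled by first
  exponential moments. The constant is 1 + 8 * 6, where 6 is the factorial of 3.\<close>

lemma Ttr_exp_le: "Ttr r \<omega> j \<le> 49 * B ^ 3 * exp (\<bar>Y r \<omega> j\<bar> / B / 2)"
proof -
  let ?x = "\<bar>Y r \<omega> j\<bar> / B / 2"
  have "?x ^ 3 \<le> fact 3 * exp ?x" using B_pos by (intro exp_ge_power) auto
  moreover have "exp ?x \<ge> 1" using B_pos by simp
  moreover have "1 + 8 * a \<le> 49 * e" if "a \<le> fact 3 * e" "e \<ge> 1" for a e :: real
    using that by (simp add: fact_numeral)
  ultimately have "1 + 8 * ?x ^ 3 \<le> 49 * exp ?x" by blast
  then have "B ^ 3 * (1 + 8 * ?x ^ 3) \<le> B ^ 3 * (49 * exp ?x)" using B_pos by (intro mult_left_mono) auto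
  moreover have "B ^ 3 * (1 + 8 * ?x ^ 3) = Ttr r \<omega> j" using B_pos by (simp add: Ttr_def field_simps power_divide power_mult_distrib)
  ultimately show ?thesis by (simp add: mult_ac)
qed

end

lemma (in prob_space) expectation_of_bool:
  assumes [measurable]: "Measurable.pred M P"
  shows "expectation (\<lambda>\<omega>. of_bool (P \<omega>)) = prob {\<omega> \<in> space M. P \<omega>}"
proof -
  have "expectation (\<lambda>\<omega>. of_bool (P \<omega>)) = expectation (indicator {\<omega> \<in> space M. P \<omega>})"
    by (rule Bochner_Integration.integral_cong) (auto simp: indicator_def)
  also have "\<dots> = prob {\<omega> \<in> space M. P \<omega>}" by (simp add: Int_absorb2)
  finally show ?thesis .
qed

text \<open>Letters stand for the three coordinates and numbers for the three variables of a mixed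
  product. Adding the missing six terms brings the product into the one-index form that
  \<open>D3_contract\<close> requires.\<close>

lemma nine_sum_le:
  fixes a1 :: real
  assumes "a1 \<ge> 0" "a2 \<ge> 0" "a3 \<ge> 0" "b1 \<ge> 0" "b2 \<ge> 0" "b3 \<ge> 0" "c1 \<ge> 0" "c2 \<ge> 0" "c3 \<ge> 0"
  shows "a1 + b2 + c3 \<le> 24 * (a1 + a2 + a3) + 24 * (b1 + b2 + b3) + 24 * (c1 + c2 + c3)"
    and "24 * (a1 + b2 + c3) \<le> 24 * (a1 + a2 + a3) + 24 * (b1 + b2 + b3) + 24 * (c1 + c2 + c3)"
  using assms by auto

lemma mult3_le:
  fixes a b c :: real
  assumes "a \<ge> 0" "b \<ge> 0" "c \<ge> 0" shows "a * b * c \<le> a^3 + b^3 + c^3"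
proof -
  define m where "m = max a (max b c)"
  have m: "a \<le> m" "b \<le> m" "c \<le> m" "m \<ge> 0" using assms by (auto simp: m_def)
  have "a * b * c \<le> m * m * m" using m assms by (intro mult_mono) auto
  also have "\<dots> = m ^ 3" by (simp add: power3_eq_cube)
  also have "\<dots> \<le> a^3 + b^3 + c^3" using assms by (auto simp: m_def max_def)
  finally show ?thesis .
qed

section \<open>Leaving out neighbourhoods\<close>

locale dep_shift = dep_field +
  fixes g :: "'b \<Rightarrow> real" and s :: real
  assumes s01: "0 \<le> s" "s \<le> 1"
begin

definition \<eta> where "\<eta> = s / sqrt n"
text \<open>Solves the requirement that changing the weights of \<open>3 * d1\<close> variables of
  size at most \<open>\<tau> * B\<close> moves a coordinate by at most \<open>1 / \<beta>\<close>.
  Three neighbourhoods are the most that are altered at once.\<close>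

definition \<tau> where "\<tau> = sqrt n / (3 * d1 * \<beta> * B)"
text \<open>
  In \<open>Zc c\<close> the variable \<open>Y q\<close> enters with weight \<open>c q\<close>. Thus \<open>Zc (off Q)\<close> is the sum without the
  variables in \<open>Q\<close>, and the intermediate points of the mean value theorem are again of this form.
\<close>

definition Zy :: "nat set \<Rightarrow> (nat \<Rightarrow> real) \<Rightarrow> (nat \<Rightarrow> 'b \<Rightarrow> real) \<Rightarrow> 'b \<Rightarrow> real" where
  "Zy J c y j = g j + \<eta> * (\<Sum>q\<in>J. c q * y q j)"
definition Zc :: "(nat \<Rightarrow> real) \<Rightarrow> 'a \<Rightarrow> 'b \<Rightarrow> real" where
  "Zc c \<omega> = Zy {1..n} c (\<lambda>q. Y q \<omega>)"
definition Z :: "'a \<Rightarrow> 'b \<Rightarrow> real" where "Z = Zc (\<lambda>_. 1)"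
definition off :: "nat set \<Rightarrow> nat \<Rightarrow> real" where "off Q q = (if q \<in> Q then 0 else 1)"

lemma \<eta>_nonneg: "\<eta> \<ge> 0" using s01 by (simp add: \<eta>_def)
lemma \<eta>_le: "\<eta> \<le> 1 / sqrt n" using s01 n_ge by (simp add: \<eta>_def divide_right_mono)
lemma \<tau>_pos: "\<tau> > 0" using d1_ge \<beta>_pos B_pos n_ge by (simp add: \<tau>_def)

lemma Zy_meas: "J \<subseteq> {1..n} \<Longrightarrow> j \<in> V \<Longrightarrow> (\<lambda>y. Zy J c y j) \<in> borel_measurable (\<Pi>\<^sub>M t\<in>J. \<Pi>\<^sub>M j\<in>V. borel)"
  unfolding Zy_def by measurable

lemma Zc_meas: "j \<in> V \<Longrightarrow> (\<lambda>\<omega>. Zc c \<omega> j) \<in> borel_measurable M"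
  unfolding Zc_def Zy_def by measurable

lemma smooth_meas [measurable]:
  "(\<lambda>\<omega>. lse (Zc c \<omega>)) \<in> borel_measurable M"
  "j \<in> V \<Longrightarrow> (\<lambda>\<omega>. wt (Zc c \<omega>) j) \<in> borel_measurable M"
  "(\<lambda>\<omega>. F (Zc c \<omega>)) \<in> borel_measurable M"
  "j \<in> V \<Longrightarrow> (\<lambda>\<omega>. D1 (Zc c \<omega>) j) \<in> borel_measurable M"
  "j \<in> V \<Longrightarrow> k \<in> V \<Longrightarrow> (\<lambda>\<omega>. D2 (Zc c \<omega>) j k) \<in> borel_measurable M"
  "Measurable.pred M (\<lambda>\<omega>. wnd a (Zc c \<omega>))"
  by (rule measurable_smooth; auto intro: Zc_meas)+

lemma smooth_meas_y:
  assumes "J \<subseteq> {1..n}"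
  shows "j \<in> V \<Longrightarrow> (\<lambda>y. wt (Zy J c y) j) \<in> borel_measurable (\<Pi>\<^sub>M t\<in>J. \<Pi>\<^sub>M j\<in>V. borel)"
    and "j \<in> V \<Longrightarrow> (\<lambda>y. D1 (Zy J c y) j) \<in> borel_measurable (\<Pi>\<^sub>M t\<in>J. \<Pi>\<^sub>M j\<in>V. borel)"
    and "j \<in> V \<Longrightarrow> k \<in> V \<Longrightarrow> (\<lambda>y. D2 (Zy J c y) j k) \<in> borel_measurable (\<Pi>\<^sub>M t\<in>J. \<Pi>\<^sub>M j\<in>V. borel)"
    and "Measurable.pred (\<Pi>\<^sub>M t\<in>J. \<Pi>\<^sub>M j\<in>V. borel) (\<lambda>y. wnd a (Zy J c y))"
  using assms by (auto intro!: measurable_smooth Zy_meas)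

text \<open>Without \<open>Q\<close> the sum is a function of the remaining family alone, which is
  the form that \<open>indep_factor\<close> expects.\<close>

lemma Zc_off: "Q \<subseteq> {1..n} \<Longrightarrow> Zc (off Q) \<omega> = Zy ({1..n} - Q) (\<lambda>_. 1) (\<lambda>t\<in>{1..n} - Q. Y t \<omega>)"
  unfolding Zc_def Zy_def fun_eq_iff
  by (auto simp: off_def if_distrib[of "\<lambda>x. x * _"] sum.If_cases Diff_eq cong: if_cong)

lemma Zc_line:
  "((\<lambda>r. Zc (\<lambda>q. c' q + r * (c q - c' q)) \<omega> j) has_real_derivative \<eta> * (\<Sum>q\<in>{1..n}. (c q - c' q) * Y q \<omega> j)) (at r)"
  unfolding Zc_def Zy_def by (auto intro!: derivative_eq_intros simp: sum_distrib_left mult_ac)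

text \<open>The entire sum over \<open>j\<close> is a single real function of \<open>r\<close>, so
  one intermediate point serves all terms. It depends on \<open>\<omega>\<close> in an uncontrolled,
  possibly non-measurable way, and is therefore used in pointwise bounds only.\<close>

lemma D1_mvt:
  "\<exists>r. 0 < r \<and> r < 1 \<and> (\<Sum>j\<in>V. a j * D1 (Zc c \<omega>) j) - (\<Sum>j\<in>V. a j * D1 (Zc c' \<omega>) j) =
     (\<Sum>j\<in>V. \<Sum>k\<in>V. a j * (\<eta> * (\<Sum>q\<in>{1..n}. (c q - c' q) * Y q \<omega> k)) * D2 (Zc (\<lambda>q. c' q + r * (c q - c' q)) \<omega>) j k)"
proof -
  let ?z = "\<lambda>r. Zc (\<lambda>q. c' q + r * (c q - c' q)) \<omega>"
  let ?w = "\<lambda>k. \<eta> * (\<Sum>q\<in>{1..n}. (c q - c' q) * Y q \<omega> k)"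
  have "((\<lambda>r. \<Sum>j\<in>V. a j * D1 (?z r) j) has_real_derivative (\<Sum>j\<in>V. a j * (\<Sum>k\<in>V. D2 (?z r) j k * ?w k))) (at r)" for r
    by (intro DERIV_sum DERIV_cmult DERIV_D1 Zc_line)
  from MVT2[OF zero_less_one this] obtain r where r: "0 < r" "r < 1" and
    e: "(\<Sum>j\<in>V. a j * D1 (?z 1) j) - (\<Sum>j\<in>V. a j * D1 (?z 0) j) = (1 - 0) * (\<Sum>j\<in>V. a j * (\<Sum>k\<in>V. D2 (?z r) j k * ?w k))"
    by blast
  have "(\<Sum>j\<in>V. a j * (\<Sum>k\<in>V. D2 (?z r) j k * w k)) = (\<Sum>j\<in>V. \<Sum>k\<in>V. a j * w k * D2 (?z r) j k)" for w
    by (simp add: sum_distrib_left mult_ac)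
  then show ?thesis
    by (intro exI[of _ r]) (use r e in simp)
qed

lemma D2_mvt:
  "\<exists>r. 0 < r \<and> r < 1 \<and> (\<Sum>j\<in>V. \<Sum>k\<in>V. C j k * D2 (Zc c \<omega>) j k) - (\<Sum>j\<in>V. \<Sum>k\<in>V. C j k * D2 (Zc c' \<omega>) j k) =
     \<eta> * (\<Sum>q\<in>{1..n}. (c q - c' q) * (\<Sum>j\<in>V. \<Sum>k\<in>V. C j k * (\<Sum>m\<in>V. D3 (Zc (\<lambda>q. c' q + r * (c q - c' q)) \<omega>) j k m * Y q \<omega> m)))"
proof -
  let ?z = "\<lambda>r. Zc (\<lambda>q. c' q + r * (c q - c' q)) \<omega>"
  let ?w = "\<lambda>k. \<eta> * (\<Sum>q\<in>{1..n}. (c q - c' q) * Y q \<omega> k)"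
  have "((\<lambda>r. \<Sum>j\<in>V. \<Sum>k\<in>V. C j k * D2 (?z r) j k) has_real_derivative
      (\<Sum>j\<in>V. \<Sum>k\<in>V. C j k * (\<Sum>m\<in>V. D3 (?z r) j k m * ?w m))) (at r)" for r
    by (intro DERIV_sum DERIV_cmult DERIV_D2 Zc_line)
  from MVT2[OF zero_less_one this] obtain r where r: "0 < r" "r < 1" and
    e: "(\<Sum>j\<in>V. \<Sum>k\<in>V. C j k * D2 (?z 1) j k) - (\<Sum>j\<in>V. \<Sum>k\<in>V. C j k * D2 (?z 0) j k) =
      (1 - 0) * (\<Sum>j\<in>V. \<Sum>k\<in>V. C j k * (\<Sum>m\<in>V. D3 (?z r) j k m * ?w m))"
    by blast
  have "(\<Sum>j\<in>V. \<Sum>k\<in>V. C j k * (\<Sum>m\<in>V. D3 (?z r) j k m * ?w m)) =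
     (\<Sum>j\<in>V. \<Sum>k\<in>V. \<Sum>m\<in>V. \<Sum>q\<in>{1..n}. \<eta> * ((c q - c' q) * (C j k * (D3 (?z r) j k m * Y q \<omega> m))))"
    unfolding sum_distrib_left by (intro sum.cong refl) (simp add: mult_ac)
  also have "\<dots> = (\<Sum>q\<in>{1..n}. \<Sum>j\<in>V. \<Sum>k\<in>V. \<Sum>m\<in>V. \<eta> * ((c q - c' q) * (C j k * (D3 (?z r) j k m * Y q \<omega> m))))"
    unfolding sum.swap[of _ "{1..n}" V] ..
  also have "\<dots> = \<eta> * (\<Sum>q\<in>{1..n}. (c q - c' q) * (\<Sum>j\<in>V. \<Sum>k\<in>V. C j k * (\<Sum>m\<in>V. D3 (?z r) j k m * Y q \<omega> m)))"
    by (simp add: sum_distrib_left)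
  finally show ?thesis
    by (intro exI[of _ r]) (use r e in simp)
qed

text \<open>
  \<open>\<Phi> Q r\<close> dominates \<open>\<Sum>j\<in>V. wt x j * Ttr r \<omega> j\<close> on the window, for all points \<open>x = Zc c \<omega>\<close> whose weights
  \<open>c\<close> differ from 1 only on \<open>Q\<close>. Its main part is evaluated at the sum without the neighbours of \<open>r\<close>, which
  is independent of \<open>Y r\<close>; \<open>bad\<close> covers the event that some \<open>\<bar>Y q \<omega> k\<bar>\<close> exceeds \<open>\<tau> * B\<close>.
\<close>

definition bad :: "nat set \<Rightarrow> nat \<Rightarrow> 'a \<Rightarrow> real" where
  "bad Q r \<omega> = (\<Sum>q\<in>Q. \<Sum>k\<in>V. \<Sum>j\<in>V. 25 * B ^ 3 * exp (- \<tau> / 2) * (exp (\<bar>Y q \<omega> k\<bar> / B) + exp (\<bar>Y r \<omega> j\<bar> / B)))"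

definition \<Phi> :: "nat set \<Rightarrow> nat \<Rightarrow> 'a \<Rightarrow> real" where
  "\<Phi> Q r \<omega> = 9 * (\<Sum>j\<in>V. Ttr r \<omega> j * (if wnd 1 (Zc (off (nb r)) \<omega>) then wt (Zc (off (nb r)) \<omega>) j else 0))
     + bad (Q \<union> nb r) r \<omega>"

definition regular :: "(nat \<Rightarrow> real) \<Rightarrow> nat set \<Rightarrow> bool" where
  "regular c Q \<longleftrightarrow> (\<forall>q. 0 \<le> c q \<and> c q \<le> 1 \<and> (q \<notin> Q \<longrightarrow> c q = 1))"

lemma Zc_close:
  assumes c: "regular c Q" "regular c' Q'" and Q: "Q \<subseteq> {1..n}" "Q' \<subseteq> {1..n}" and card: "card (Q \<union> Q') \<le> 3 * d1"
    and good: "\<And>q. q \<in> Q \<union> Q' \<Longrightarrow> \<bar>Y q \<omega> j\<bar> \<le> \<tau> * B"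
  shows "\<beta> * \<bar>Zc c \<omega> j - Zc c' \<omega> j\<bar> \<le> 1"
proof -
  have "Zc c \<omega> j - Zc c' \<omega> j = \<eta> * (\<Sum>q\<in>{1..n}. (c q - c' q) * Y q \<omega> j)"
    by (simp add: Zc_def Zy_def algebra_simps sum_subtractf)
  also have "(\<Sum>q\<in>{1..n}. (c q - c' q) * Y q \<omega> j) = (\<Sum>q\<in>Q \<union> Q'. (c q - c' q) * Y q \<omega> j)"
    by (rule sum.mono_neutral_right) (use c Q in \<open>auto simp: regular_def\<close>)
  finally have 1: "\<bar>Zc c \<omega> j - Zc c' \<omega> j\<bar> = \<eta> * \<bar>\<Sum>q\<in>Q \<union> Q'. (c q - c' q) * Y q \<omega> j\<bar>"
    using \<eta>_nonneg by (simp add: abs_mult)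
  have "\<bar>\<Sum>q\<in>Q \<union> Q'. (c q - c' q) * Y q \<omega> j\<bar> \<le> (\<Sum>q\<in>Q \<union> Q'. 1 * (\<tau> * B))"
  proof (rule order.trans[OF sum_abs sum_mono])
    fix q assume q: "q \<in> Q \<union> Q'"
    have "\<bar>c q - c' q\<bar> \<le> 1" using c by (auto simp: regular_def abs_le_iff algebra_simps intro: add_increasing2)
    then show "\<bar>(c q - c' q) * Y q \<omega> j\<bar> \<le> 1 * (\<tau> * B)"
      unfolding abs_mult using good[OF q] by (intro mult_mono) auto
  qed
  also have "\<dots> = card (Q \<union> Q') * (\<tau> * B)" by simp
  also have "\<dots> \<le> 3 * d1 * (\<tau> * B)" using card \<tau>_pos B_pos by (intro mult_right_mono) auto
  finally have 2: "\<bar>\<Sum>q\<in>Q \<union> Q'. (c q - c' q) * Y q \<omega> j\<bar> \<le> 3 * d1 * (\<tau> * B)" .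
  have "\<beta> * \<bar>Zc c \<omega> j - Zc c' \<omega> j\<bar> \<le> \<beta> * (1 / sqrt n * (3 * d1 * (\<tau> * B)))"
    unfolding 1 using \<beta>_pos \<eta>_nonneg \<eta>_le 2 by (intro mult_left_mono mult_mono) auto
  also have "\<dots> = 1" using \<beta>_pos B_pos d1_ge n_ge by (simp add: \<tau>_def)
  finally show ?thesis .
qed

lemma bad_nonneg: "bad Q r \<omega> \<ge> 0"
  unfolding bad_def using B_pos by (intro sum_nonneg mult_nonneg_nonneg) (auto intro: add_nonneg_nonneg)

lemma \<Phi>_nonneg: "\<Phi> Q r \<omega> \<ge> 0"
  unfolding \<Phi>_def by (intro add_nonneg_nonneg mult_nonneg_nonneg sum_nonneg bad_nonneg) (auto simp: Ttr_nonneg)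

lemma exp2_le: "exp (2::real) \<le> 9"
proof -
  have "exp (2::real) = exp 1 * exp 1" by (simp flip: exp_add)
  also have "\<dots> \<le> 3 * 3" using exp_le by (intro mult_mono) auto
  finally show ?thesis by simp
qed

lemma regular_off: "regular (off Q) Q" by (simp add: regular_def off_def)

text \<open>If all variables involved are below the threshold, passing to the sum without
  \<open>nb r\<close> changes the weights by at most \<open>exp 2 \<le> 9\<close> and widens the
  window by 1. Otherwise the weights are bounded by 1, and the variable that is too large supplies
  the factor \<open>exp (- \<tau> / 2)\<close>.\<close>

lemma \<Phi>_bound:
  assumes c: "regular c Q" and Q: "Q \<subseteq> {1..n}" and r: "r \<in> {1..n}" and card: "card (Q \<union> nb r) \<le> 3 * d1"
  shows "(if wnd 0 (Zc c \<omega>) then (\<Sum>j\<in>V. wt (Zc c \<omega>) j * Ttr r \<omega> j) else 0) \<le> \<Phi> Q r \<omega>"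
proof (cases "wnd 0 (Zc c \<omega>)")
  case w: True
  let ?Q = "Q \<union> nb r"
  show ?thesis
  proof (cases "\<forall>q\<in>?Q. \<forall>j\<in>V. \<bar>Y q \<omega> j\<bar> \<le> \<tau> * B")
    case True
    have close: "\<beta> * \<bar>Zc c \<omega> j - Zc (off (nb r)) \<omega> j\<bar> \<le> 1" if "j \<in> V" for j
      by (rule Zc_close[OF c regular_off Q nb_sub[OF r] card]) (use True that in auto)
    have w1: "wnd 1 (Zc (off (nb r)) \<omega>)" using wnd_stable[of "Zc c \<omega>" "Zc (off (nb r)) \<omega>", OF close w] by simp
    have "(\<Sum>j\<in>V. wt (Zc c \<omega>) j * Ttr r \<omega> j) \<le> (\<Sum>j\<in>V. (9 * wt (Zc (off (nb r)) \<omega>) j) * Ttr r \<omega> j)"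
    proof (intro sum_mono mult_right_mono Ttr_nonneg)
      fix j assume "j \<in> V"
      then have "wt (Zc c \<omega>) j \<le> exp 2 * wt (Zc (off (nb r)) \<omega>) j" using wt_stable(2)[of "Zc c \<omega>" "Zc (off (nb r)) \<omega>", OF close] by blast
      also have "\<dots> \<le> 9 * wt (Zc (off (nb r)) \<omega>) j" using exp2_le by (intro mult_right_mono) auto
      finally show "wt (Zc c \<omega>) j \<le> 9 * wt (Zc (off (nb r)) \<omega>) j" .
    qed
    also have "\<dots> = 9 * (\<Sum>j\<in>V. Ttr r \<omega> j * (if wnd 1 (Zc (off (nb r)) \<omega>) then wt (Zc (off (nb r)) \<omega>) j else 0))"
      using w1 by (simp add: sum_distrib_left mult_ac)
    finally show ?thesis using w bad_nonneg[of ?Q r \<omega>] by (simp add: \<Phi>_def)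
  next
    case False
    then obtain q k where q: "q \<in> ?Q" and k: "k \<in> V" and big: "\<bar>Y q \<omega> k\<bar> > \<tau> * B" by force
    have fin: "finite ?Q" using Q nb_fin[OF r] finite_subset by blast
    let ?f = "\<lambda>q k j. 25 * B ^ 3 * exp (- \<tau> / 2) * (exp (\<bar>Y q \<omega> k\<bar> / B) + exp (\<bar>Y r \<omega> j\<bar> / B))"
    have f0: "?f q k j \<ge> 0" for q k j using B_pos by (intro mult_nonneg_nonneg add_nonneg_nonneg) auto
    have "(\<Sum>j\<in>V. wt (Zc c \<omega>) j * Ttr r \<omega> j) \<le> (\<Sum>j\<in>V. ?f q k j)"
    proof (rule sum_mono)
      fix j assume j: "j \<in> V"
      let ?a = "\<bar>Y q \<omega> k\<bar> / B" and ?b = "\<bar>Y r \<omega> j\<bar> / B"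
      have "\<tau> \<le> ?a" using big B_pos by (simp add: field_simps)
      then have e1: "1 \<le> exp (- \<tau> / 2) * exp (?a / 2)" by (simp flip: exp_add)
      have e2: "exp (?a / 2) * exp (?b / 2) \<le> (exp ?a + exp ?b) / 2"
      proof -
        have "exp ?a = exp (?a/2) ^ 2" "exp ?b = exp (?b/2) ^ 2"
          by (simp_all add: power2_eq_square flip: exp_add)
        then show ?thesis using sum_squares_bound[of "exp (?a/2)" "exp (?b/2)"] by simp
      qed
      have "wt (Zc c \<omega>) j * Ttr r \<omega> j \<le> 1 * Ttr r \<omega> j"
        using wt_le_1[OF j] Ttr_nonneg by (intro mult_right_mono) auto
      also have "\<dots> \<le> 49 * B ^ 3 * exp (?b / 2)" using Ttr_exp_le by simp
      also have "\<dots> \<le> (49 * B ^ 3 * exp (?b / 2)) * (exp (- \<tau> / 2) * exp (?a / 2))"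
        using e1 B_pos mult_left_mono[OF e1, of "49 * B ^ 3 * exp (?b / 2)"] by simp
      also have "\<dots> = 49 * B ^ 3 * exp (- \<tau> / 2) * (exp (?a / 2) * exp (?b / 2))" by simp
      also have "\<dots> \<le> 49 * B ^ 3 * exp (- \<tau> / 2) * ((exp ?a + exp ?b) / 2)"
        using B_pos by (intro mult_left_mono e2) auto
      also have "\<dots> = 49/2 * (B ^ 3 * exp (- \<tau> / 2) * (exp ?a + exp ?b))" by simp
      also have "\<dots> \<le> 25 * (B ^ 3 * exp (- \<tau> / 2) * (exp ?a + exp ?b))"
        using B_pos by (intro mult_right_mono mult_nonneg_nonneg add_nonneg_nonneg) auto
      finally show "wt (Zc c \<omega>) j * Ttr r \<omega> j \<le> ?f q k j" by (simp add: mult_ac)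
    qed
    also have "\<dots> \<le> (\<Sum>k\<in>V. \<Sum>j\<in>V. ?f q k j)"
      by (rule member_le_sum[OF k]) (use f0 finite_V in \<open>auto intro!: sum_nonneg\<close>)
    also have "\<dots> \<le> bad ?Q r \<omega>" unfolding bad_def
      by (rule member_le_sum[OF q]) (use f0 fin in \<open>auto intro!: sum_nonneg\<close>)
    also have "\<dots> \<le> \<Phi> Q r \<omega>" unfolding \<Phi>_def
      by (auto intro!: sum_nonneg mult_nonneg_nonneg simp: Ttr_nonneg)
    finally show ?thesis using w by simp
  qed
qed (use \<Phi>_nonneg in simp)

lemma wt_wnd_meas: "j \<in> V \<Longrightarrow> (\<lambda>\<omega>. if wnd c (Zc d \<omega>) then wt (Zc d \<omega>) j else 0) \<in> borel_measurable M"
  by (intro measurable_If smooth_meas) simp_all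

lemma integrable_wt:
  assumes "j \<in> V" shows "integrable M (\<lambda>\<omega>. if wnd c (Zc d \<omega>) then wt (Zc d \<omega>) j else 0)"
proof (rule integrable_const_bound[of _ 1])
  show "AE \<omega> in M. norm (if wnd c (Zc d \<omega>) then wt (Zc d \<omega>) j else 0) \<le> 1"
    using wt_le_1[OF assms] by (auto intro!: AE_I2)
qed (rule wt_wnd_meas[OF assms])

text \<open>Here moments and weights separate: \<open>Y r\<close> is independent of everything
  outside \<open>nb r\<close>.\<close>

lemma Ttr_wt_factor:
  assumes r: "r \<in> {1..n}" and j: "j \<in> V"
  defines "u \<equiv> \<lambda>\<omega>. if wnd 1 (Zc (off (nb r)) \<omega>) then wt (Zc (off (nb r)) \<omega>) j else 0"
  shows "expectation (\<lambda>\<omega>. Ttr r \<omega> j * u \<omega>) = expectation (\<lambda>\<omega>. Ttr r \<omega> j) * expectation u"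
    and "integrable M (\<lambda>\<omega>. Ttr r \<omega> j * u \<omega>)"
proof -
  let ?J = "{1..n} - nb r"
  define h where "h y = (if wnd 1 (Zy ?J (\<lambda>_. 1) y) then wt (Zy ?J (\<lambda>_. 1) y) j else 0)" for y
  define f where "f y = B ^ 3 + \<bar>y r j\<bar> ^ 3" for y :: "nat \<Rightarrow> 'b \<Rightarrow> real"
  have J: "?J \<subseteq> {1..n}" by auto
  have hm: "h \<in> borel_measurable (\<Pi>\<^sub>M t\<in>?J. \<Pi>\<^sub>M j\<in>V. borel)"
    unfolding h_def by (intro measurable_If smooth_meas_y(1)[OF J j] predE smooth_meas_y(4)[OF J] measurable_const) simp
  have fm: "f \<in> borel_measurable (\<Pi>\<^sub>M t\<in>{r}. \<Pi>\<^sub>M j\<in>V. borel)"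
    unfolding f_def using j by measurable
  have hu: "h (\<lambda>t\<in>?J. Y t \<omega>) = u \<omega>" for \<omega>
    using Zc_off[OF nb_sub[OF r], of \<omega>] by (simp add: h_def u_def)
  have fu: "f (\<lambda>t\<in>{r}. Y t \<omega>) = Ttr r \<omega> j" for \<omega>
    by (simp add: f_def Ttr_def)
  show "expectation (\<lambda>\<omega>. Ttr r \<omega> j * u \<omega>) = expectation (\<lambda>\<omega>. Ttr r \<omega> j) * expectation u"
    using indep_factor[OF _ J _ fm _ hm] r Ttr_int[OF r j] integrable_wt[OF j]
    unfolding hu fu u_def by auto
  show "integrable M (\<lambda>\<omega>. Ttr r \<omega> j * u \<omega>)"
  proof (rule Bochner_Integration.integrable_bound[OF Ttr_int[OF r j]])
    show "AE \<omega> in M. norm (Ttr r \<omega> j * u \<omega>) \<le> norm (Ttr r \<omega> j)"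
      using wt_le_1[OF j] by (auto intro!: AE_I2 simp: u_def abs_mult mult_left_le)
    have "(\<lambda>\<omega>. Ttr r \<omega> j) \<in> borel_measurable M" using Ttr_int[OF r j] by simp
    moreover have "u \<in> borel_measurable M" unfolding u_def by (rule wt_wnd_meas[OF j])
    ultimately show "(\<lambda>\<omega>. Ttr r \<omega> j * u \<omega>) \<in> borel_measurable M" by measurable
  qed
qed

lemma bad_integrable: "Q \<subseteq> {1..n} \<Longrightarrow> r \<in> {1..n} \<Longrightarrow> integrable M (bad Q r)"
  unfolding bad_def
  by (intro Bochner_Integration.integrable_sum integrable_mult_right Bochner_Integration.integrable_add exp_int) auto

lemma \<Phi>_integrable: "Q \<subseteq> {1..n} \<Longrightarrow> r \<in> {1..n} \<Longrightarrow> integrable M (\<Phi> Q r)"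
  unfolding \<Phi>_def
  by (intro Bochner_Integration.integrable_sum integrable_mult_right Bochner_Integration.integrable_add
      Ttr_wt_factor(2) bad_integrable) (use nb_sub in auto)

text \<open>The sums over normals are paid in full here, and \<open>exp (- \<tau> / 2)\<close> has
  to make up for them. The constant is 3 * 25 * (6 + 6).\<close>

lemma bad_expect:
  assumes Q: "Q \<subseteq> {1..n}" and r: "r \<in> {1..n}" and card: "card Q \<le> 3 * d1"
  shows "expectation (bad Q r) \<le> 900 * B ^ 3 * (d1 * real (card V) ^ 2 * exp (- \<tau> / 2))"
proof -
  have "expectation (bad Q r) = (\<Sum>q\<in>Q. \<Sum>k\<in>V. \<Sum>j\<in>V. 25 * B ^ 3 * exp (- \<tau> / 2) *
     (expectation (\<lambda>\<omega>. exp (\<bar>Y q \<omega> k\<bar> / B)) + expectation (\<lambda>\<omega>. exp (\<bar>Y r \<omega> j\<bar> / B))))"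
    unfolding bad_def using Q r exp_int
    by (subst Bochner_Integration.integral_sum, (intro Bochner_Integration.integrable_sum integrable_mult_right Bochner_Integration.integrable_add exp_int; auto)[1],
        intro sum.cong refl)+ (auto simp: subset_iff)
  also have "\<dots> \<le> (\<Sum>q\<in>Q. \<Sum>k\<in>V. \<Sum>j\<in>V. 25 * B ^ 3 * exp (- \<tau> / 2) * (6 + 6))"
    using Q r B_pos by (intro sum_mono mult_left_mono add_mono exp_le6) auto
  also have "\<dots> = card Q * (300 * B ^ 3 * (real (card V) ^ 2 * exp (- \<tau> / 2)))"
    by (simp add: power2_eq_square)
  also have "\<dots> \<le> 3 * d1 * (300 * B ^ 3 * (real (card V) ^ 2 * exp (- \<tau> / 2)))"
    using card B_pos by (intro mult_right_mono) auto
  finally show ?thesis by (simp add: mult_ac)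
qed

text \<open>The return from the reduced to the full sum widens the window by another 1, unless some
  neighbour of \<open>r\<close> is large; that event is treated with an exponential Markov
  inequality. The error is weakened to the shape of the one in \<open>bad_expect\<close>.\<close>

lemma wnd_off_prob:
  assumes r: "r \<in> {1..n}"
  shows "prob {\<omega> \<in> space M. wnd 1 (Zc (off (nb r)) \<omega>)} \<le>
    prob {\<omega> \<in> space M. wnd 2 (Z \<omega>)} + 6 * (d1 * real (card V) ^ 2 * exp (- \<tau> / 2))"
proof -
  let ?w1 = "\<lambda>\<omega>. of_bool (wnd 1 (Zc (off (nb r)) \<omega>)) :: real"
  let ?w2 = "\<lambda>\<omega>. of_bool (wnd 2 (Z \<omega>)) :: real"
  let ?e = "\<lambda>\<omega>. \<Sum>q\<in>nb r. \<Sum>k\<in>V. exp (- \<tau>) * exp (\<bar>Y q \<omega> k\<bar> / B)"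
  have [measurable]: "Measurable.pred M (\<lambda>\<omega>. wnd c (Z \<omega>))" for c
    unfolding Z_def by measurable
  have P: "prob {\<omega> \<in> space M. wnd 1 (Zc (off (nb r)) \<omega>)} = expectation ?w1"
      "prob {\<omega> \<in> space M. wnd 2 (Z \<omega>)} = expectation ?w2"
    by (simp_all add: expectation_of_bool)
  have i1: "integrable M ?w1" "integrable M ?w2"
    by (rule integrable_const_bound[of _ 1]; auto)+
  have ie: "integrable M ?e"
    using nb_sub[OF r] by (intro Bochner_Integration.integrable_sum integrable_mult_right exp_int) auto
  have "expectation ?w1 \<le> expectation (\<lambda>\<omega>. ?w2 \<omega> + ?e \<omega>)"
  proof (rule integral_mono[OF i1(1) Bochner_Integration.integrable_add[OF i1(2) ie]])
    fix \<omega>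
    show "?w1 \<omega> \<le> ?w2 \<omega> + ?e \<omega>"
    proof (cases "\<forall>q\<in>nb r. \<forall>j\<in>V. \<bar>Y q \<omega> j\<bar> \<le> \<tau> * B")
      case True
      have "\<beta> * \<bar>Zc (off (nb r)) \<omega> j - Zc (\<lambda>_. 1) \<omega> j\<bar> \<le> 1" if "j \<in> V" for j
        by (rule Zc_close[OF regular_off, of _ "{}"])
          (use True that nb_sub[OF r] card_nb[OF r] d1_ge in \<open>auto simp: regular_def\<close>)
      from wnd_stable[of "Zc (off (nb r)) \<omega>" "Zc (\<lambda>_. 1) \<omega>" 1, OF this] have "?w1 \<omega> \<le> ?w2 \<omega>"
        by (auto simp: Z_def)
      moreover have "?e \<omega> \<ge> 0" by (intro sum_nonneg) auto
      ultimately show ?thesis by simp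
    next
      case False
      then obtain q k where q: "q \<in> nb r" "k \<in> V" "\<bar>Y q \<omega> k\<bar> > \<tau> * B" by force
      have "\<tau> \<le> \<bar>Y q \<omega> k\<bar> / B" using q B_pos by (simp add: field_simps)
      then have "1 \<le> exp (- \<tau>) * exp (\<bar>Y q \<omega> k\<bar> / B)" by (simp flip: exp_add)
      also have "\<dots> \<le> (\<Sum>k\<in>V. exp (- \<tau>) * exp (\<bar>Y q \<omega> k\<bar> / B))"
        by (rule member_le_sum[OF q(2)]) (use finite_V in auto)
      also have "\<dots> \<le> ?e \<omega>"
        by (rule member_le_sum[OF q(1)]) (use nb_fin[OF r] in \<open>auto intro!: sum_nonneg\<close>)
      finally show ?thesis by simp
    qed
  qed
  also have "\<dots> = expectation ?w2 + expectation ?e" using i1 ie by simp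
  also have "expectation ?e = (\<Sum>q\<in>nb r. \<Sum>k\<in>V. exp (- \<tau>) * expectation (\<lambda>\<omega>. exp (\<bar>Y q \<omega> k\<bar> / B)))"
    using nb_sub[OF r] exp_int
    by (subst Bochner_Integration.integral_sum, (intro Bochner_Integration.integrable_sum integrable_mult_right exp_int; auto)[1],
        intro sum.cong refl)+ (auto simp: subset_iff)
  also have "\<dots> \<le> (\<Sum>q\<in>nb r. \<Sum>k\<in>V. exp (- \<tau> / 2) * 6)"
    using nb_sub[OF r] \<tau>_pos by (intro sum_mono mult_mono exp_le6) auto
  also have "\<dots> = card (nb r) * (real (card V) * exp (- \<tau> / 2) * 6)" by simp
  also have "\<dots> \<le> d1 * (real (card V) ^ 2 * exp (- \<tau> / 2) * 6)"
  proof (intro mult_mono mult_right_mono)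
    show "real (card V) \<le> real (card V) ^ 2"
      using finite_V V_ne by (intro self_le_power) (auto simp: Suc_le_eq card_gt_0_iff)
  qed (use card_nb[OF r] d1_ge in auto)
  finally show ?thesis unfolding P by (simp add: mult_ac)
qed

definition \<Phi>m where "\<Phi>m = 3000 * B ^ 3 * (prob {\<omega> \<in> space M. wnd 2 (Z \<omega>)} + d1 * real (card V) ^ 2 * exp (- \<tau> / 2))"

lemma \<Phi>m_nonneg: "\<Phi>m \<ge> 0"
  unfolding \<Phi>m_def using B_pos d1_ge by (intro mult_nonneg_nonneg add_nonneg_nonneg) auto

lemma d2_nonneg: "d2 \<ge> 0"
proof -
  have "1 \<in> {1..n}" using n_ge by simp
  from card_nb2[OF this nb_self[OF this]] show ?thesis by linarith
qed

text \<open>After factorisation the third moments are bounded uniformly and the weights add up to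
  one, so that only the probability of the window remains. The larger coefficient is 9 * 37 * 6 +
  900 = 2898, rounded to 3000.\<close>

lemma \<Phi>_expect:
  assumes Q: "Q \<subseteq> {1..n}" and r: "r \<in> {1..n}" and card: "card (Q \<union> nb r) \<le> 3 * d1"
  shows "expectation (\<Phi> Q r) \<le> \<Phi>m"
proof -
  let ?u = "\<lambda>\<omega> j. if wnd 1 (Zc (off (nb r)) \<omega>) then wt (Zc (off (nb r)) \<omega>) j else 0"
  let ?e = "d1 * real (card V) ^ 2 * exp (- \<tau> / 2)"
  have e0: "?e \<ge> 0" using d1_ge by simp
  have B3: "B ^ 3 > 0" using B_pos by simp
  have "expectation (\<lambda>\<omega>. \<Sum>j\<in>V. Ttr r \<omega> j * ?u \<omega> j) = (\<Sum>j\<in>V. expectation (\<lambda>\<omega>. Ttr r \<omega> j) * expectation (\<lambda>\<omega>. ?u \<omega> j))"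
    using Ttr_wt_factor[OF r] by (subst Bochner_Integration.integral_sum) auto
  also have "\<dots> \<le> (\<Sum>j\<in>V. 37 * B ^ 3 * expectation (\<lambda>\<omega>. ?u \<omega> j))"
    by (intro sum_mono mult_right_mono Ttr_expect r integral_nonneg_AE AE_I2) auto
  also have "\<dots> = 37 * B ^ 3 * expectation (\<lambda>\<omega>. \<Sum>j\<in>V. ?u \<omega> j)"
    unfolding sum_distrib_left[symmetric] by (subst Bochner_Integration.integral_sum) (auto intro: integrable_wt)
  also have "(\<lambda>\<omega>. \<Sum>j\<in>V. ?u \<omega> j) = (\<lambda>\<omega>. of_bool (wnd 1 (Zc (off (nb r)) \<omega>)))"
    by (auto simp: sum_wt fun_eq_iff)
  also have "expectation (\<lambda>\<omega>. of_bool (wnd 1 (Zc (off (nb r)) \<omega>))) = prob {\<omega> \<in> space M. wnd 1 (Zc (off (nb r)) \<omega>)}"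
    by (simp add: expectation_of_bool)
  also have "37 * B ^ 3 * \<dots> \<le> 37 * B ^ 3 * (prob {\<omega> \<in> space M. wnd 2 (Z \<omega>)} + 6 * ?e)"
    using B3 by (intro mult_left_mono wnd_off_prob r) auto
  finally have 1: "expectation (\<lambda>\<omega>. \<Sum>j\<in>V. Ttr r \<omega> j * ?u \<omega> j) \<le>
     37 * B ^ 3 * (prob {\<omega> \<in> space M. wnd 2 (Z \<omega>)} + 6 * ?e)" .
  have 2: "expectation (bad (Q \<union> nb r) r) \<le> 900 * B ^ 3 * ?e"
    by (rule bad_expect) (use Q nb_sub[OF r] r card in auto)
  have "expectation (\<Phi> Q r) = 9 * expectation (\<lambda>\<omega>. \<Sum>j\<in>V. Ttr r \<omega> j * ?u \<omega> j) + expectation (bad (Q \<union> nb r) r)"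
    unfolding \<Phi>_def using Q nb_sub[OF r] r
    by (subst Bochner_Integration.integral_add)
      (auto intro!: Bochner_Integration.integrable_sum integrable_mult_right Ttr_wt_factor(2) bad_integrable)
  also have "\<dots> \<le> 9 * (37 * B ^ 3 * (prob {\<omega> \<in> space M. wnd 2 (Z \<omega>)} + 6 * ?e)) + 900 * B ^ 3 * ?e"
    using 1 2 by linarith
  also have "\<dots> = 333 * (B ^ 3 * prob {\<omega> \<in> space M. wnd 2 (Z \<omega>)}) + 2898 * (B ^ 3 * ?e)" by (simp add: algebra_simps)
  also have "\<dots> \<le> 3000 * (B ^ 3 * prob {\<omega> \<in> space M. wnd 2 (Z \<omega>)}) + 3000 * (B ^ 3 * ?e)"
    using e0 B3 by (intro add_mono mult_right_mono) auto
  also have "\<dots> = \<Phi>m" by (simp add: \<Phi>m_def algebra_simps)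
  finally show ?thesis .
qed

section \<open>The Stein expansion\<close>

abbreviation QQ :: "nat \<Rightarrow> nat \<Rightarrow> nat set" where "QQ t s' \<equiv> nb t \<union> nb s'"

text \<open>One third-order term for each \<open>l\<close> whose weight may change. The constant
  280800 is 24 * 11700, with 24 from the covariance bound and 11700 from
  \<open>D3_contract\<close>.\<close>

definition Err :: "nat \<Rightarrow> nat \<Rightarrow> 'a \<Rightarrow> real" where
  "Err t s' \<omega> = \<eta> * (\<Sum>l\<in>QQ t s'. 280800 * \<beta>^3 / L * (\<Phi> (QQ t s') t \<omega> + \<Phi> (QQ t s') s' \<omega> + \<Phi> (QQ t s') l \<omega>))"

context
  fixes t s' :: nat
  assumes t: "t \<in> {1..n}" and s': "s' \<in> nb t"
begin

lemma s'n: "s' \<in> {1..n}" using t s' nb_sub by blast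

lemma QQ_sub: "QQ t s' \<subseteq> {1..n}" using nb_sub t s'n by blast

lemma QQ_card: "r \<in> {1..n} \<Longrightarrow> card (QQ t s' \<union> nb r) \<le> 3 * d1"
proof -
  assume r: "r \<in> {1..n}"
  have "card (QQ t s' \<union> nb r) \<le> card (nb t) + card (nb s') + card (nb r)"
    by (meson add_right_mono card_Un_le order.trans)
  then show ?thesis using card_nb[OF t] card_nb[OF s'n] card_nb[OF r] by linarith
qed

lemma Err_integrable: "integrable M (Err t s')"
  unfolding Err_def using QQ_sub t s'n
  by (intro integrable_mult_right Bochner_Integration.integrable_sum Bochner_Integration.integrable_add \<Phi>_integrable) auto

lemma Err_expect: "expectation (Err t s') \<le> \<eta> * (d2 * (842400 * \<beta>^3 / L * \<Phi>m))"
proof -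
  have m: "expectation (\<Phi> (QQ t s') r) \<le> \<Phi>m" if "r \<in> {1..n}" for r
    by (rule \<Phi>_expect[OF QQ_sub that QQ_card[OF that]])
  note m0 = \<Phi>m_nonneg
  have "expectation (Err t s') = \<eta> * (\<Sum>l\<in>QQ t s'. 280800 * \<beta>^3 / L *
     (expectation (\<Phi> (QQ t s') t) + expectation (\<Phi> (QQ t s') s') + expectation (\<Phi> (QQ t s') l)))"
  proof -
    have "expectation (Err t s') = \<eta> * expectation (\<lambda>\<omega>. (\<Sum>l\<in>QQ t s'. 280800 * \<beta>^3 / L * (\<Phi> (QQ t s') t \<omega> + \<Phi> (QQ t s') s' \<omega> + \<Phi> (QQ t s') l \<omega>)))"
      unfolding Err_def by simp
    also have "expectation (\<lambda>\<omega>. (\<Sum>l\<in>QQ t s'. 280800 * \<beta>^3 / L * (\<Phi> (QQ t s') t \<omega> + \<Phi> (QQ t s') s' \<omega> + \<Phi> (QQ t s') l \<omega>)))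
       = (\<Sum>l\<in>QQ t s'. expectation (\<lambda>\<omega>. 280800 * \<beta>^3 / L * (\<Phi> (QQ t s') t \<omega> + \<Phi> (QQ t s') s' \<omega> + \<Phi> (QQ t s') l \<omega>)))"
      using QQ_sub t s'n
      by (intro Bochner_Integration.integral_sum integrable_mult_right Bochner_Integration.integrable_add \<Phi>_integrable) auto
    also have "\<dots> = (\<Sum>l\<in>QQ t s'. 280800 * \<beta>^3 / L *
     (expectation (\<Phi> (QQ t s') t) + expectation (\<Phi> (QQ t s') s') + expectation (\<Phi> (QQ t s') l)))"
    proof (intro sum.cong refl)
      fix l assume "l \<in> QQ t s'"
      then have i: "integrable M (\<Phi> (QQ t s') t)" "integrable M (\<Phi> (QQ t s') s')" "integrable M (\<Phi> (QQ t s') l)"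
        using QQ_sub t s'n by (auto intro!: \<Phi>_integrable)
      show "expectation (\<lambda>\<omega>. 280800 * \<beta>^3 / L * (\<Phi> (QQ t s') t \<omega> + \<Phi> (QQ t s') s' \<omega> + \<Phi> (QQ t s') l \<omega>)) =
        280800 * \<beta>^3 / L * (expectation (\<Phi> (QQ t s') t) + expectation (\<Phi> (QQ t s') s') + expectation (\<Phi> (QQ t s') l))"
        using i by (subst integral_mult_right_zero) simp
    qed
    finally show ?thesis .
  qed
  also have "\<dots> \<le> \<eta> * (\<Sum>l\<in>QQ t s'. 280800 * \<beta>^3 / L * (\<Phi>m + \<Phi>m + \<Phi>m))"
    using QQ_sub t s'n \<eta>_nonneg \<beta>_pos L_ge by (intro mult_left_mono sum_mono add_mono m) auto
  also have "\<dots> = \<eta> * (card (QQ t s') * (842400 * \<beta>^3 / L * \<Phi>m))" by simp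
  also have "\<dots> \<le> \<eta> * (d2 * (842400 * \<beta>^3 / L * \<Phi>m))"
    using card_nb2[OF t s'] \<eta>_nonneg \<beta>_pos L_ge m0 by (intro mult_left_mono mult_right_mono) auto
  finally show ?thesis .
qed

text \<open>Two weightings that equal 1 outside \<open>QQ t s'\<close> are joined by a segment of
  such weightings, so \<open>\<Phi>_bound\<close> holds at the intermediate point wherever it lies.
  The coefficients are left open because both the products of variables and their expectations are
  inserted.\<close>

lemma D2_diff:
  assumes c: "regular c (QQ t s')" "regular c' (QQ t s')"
    and C: "\<And>l j k m. l \<in> QQ t s' \<Longrightarrow> j \<in> V \<Longrightarrow> k \<in> V \<Longrightarrow> m \<in> V \<Longrightarrow> \<bar>C j k * Y l \<omega> m\<bar> \<le>
       24 * (Ttr t \<omega> j + Ttr s' \<omega> j + Ttr l \<omega> j) + 24 * (Ttr t \<omega> k + Ttr s' \<omega> k + Ttr l \<omega> k) + 24 * (Ttr t \<omega> m + Ttr s' \<omega> m + Ttr l \<omega> m)"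
  shows "\<bar>(\<Sum>j\<in>V. \<Sum>k\<in>V. C j k * D2 (Zc c \<omega>) j k) - (\<Sum>j\<in>V. \<Sum>k\<in>V. C j k * D2 (Zc c' \<omega>) j k)\<bar> \<le> Err t s' \<omega>"
proof -
  obtain r where r: "0 < r" "r < 1" and
    e: "(\<Sum>j\<in>V. \<Sum>k\<in>V. C j k * D2 (Zc c \<omega>) j k) - (\<Sum>j\<in>V. \<Sum>k\<in>V. C j k * D2 (Zc c' \<omega>) j k) =
     \<eta> * (\<Sum>q\<in>{1..n}. (c q - c' q) * (\<Sum>j\<in>V. \<Sum>k\<in>V. C j k * (\<Sum>m\<in>V. D3 (Zc (\<lambda>q. c' q + r * (c q - c' q)) \<omega>) j k m * Y q \<omega> m)))"
    using D2_mvt[of C c \<omega> c'] by blast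
  define c'' where "c'' = (\<lambda>q. c' q + r * (c q - c' q))"
  have c'': "regular c'' (QQ t s')"
    unfolding regular_def
  proof (intro allI)
    fix q
    have "0 \<le> c q" "c q \<le> 1" "0 \<le> c' q" "c' q \<le> 1" and 1: "q \<notin> QQ t s' \<Longrightarrow> c q = 1" "q \<notin> QQ t s' \<Longrightarrow> c' q = 1"
      using c by (auto simp: regular_def)
    then have "0 \<le> (1 - r) * c' q + r * c q" "(1 - r) * c' q + r * c q \<le> 1"
      using r convex_bound_le[of "c' q" 1 "c q" "1 - r" r] by auto
    with 1 show "0 \<le> c'' q \<and> c'' q \<le> 1 \<and> (q \<notin> QQ t s' \<longrightarrow> c'' q = 1)"
      by (auto simp: c''_def algebra_simps)
  qed
  let ?D = "\<lambda>q. \<Sum>j\<in>V. \<Sum>k\<in>V. C j k * (\<Sum>m\<in>V. D3 (Zc c'' \<omega>) j k m * Y q \<omega> m)"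
  let ?\<Phi> = "\<lambda>l. \<Phi> (QQ t s') t \<omega> + \<Phi> (QQ t s') s' \<omega> + \<Phi> (QQ t s') l \<omega>"
  have b: "\<bar>?D l\<bar> \<le> 280800 * \<beta>^3 / L * ?\<Phi> l" if l: "l \<in> QQ t s'" for l
  proof -
    have ln: "l \<in> {1..n}" using l QQ_sub by auto
    let ?W = "\<lambda>r. if wnd 0 (Zc c'' \<omega>) then (\<Sum>j\<in>V. wt (Zc c'' \<omega>) j * Ttr r \<omega> j) else 0"
    have "\<bar>?D l\<bar> \<le> (if wnd 0 (Zc c'' \<omega>) then 11700 * \<beta>^3 / L * (\<Sum>j\<in>V. wt (Zc c'' \<omega>) j * (24 * (Ttr t \<omega> j + Ttr s' \<omega> j + Ttr l \<omega> j))) else 0)"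
      by (rule D3_contract) (rule C[OF l])
    also have "\<dots> = 280800 * \<beta>^3 / L * (?W t + ?W s' + ?W l)"
      by (simp add: sum_distrib_left sum_divide_distrib sum.distrib algebra_simps)
    also have "\<dots> \<le> 280800 * \<beta>^3 / L * ?\<Phi> l"
      using \<beta>_pos L_ge t s'n ln by (intro mult_left_mono add_mono \<Phi>_bound[OF c'' QQ_sub] QQ_card) auto
    finally show ?thesis .
  qed
  have "\<bar>\<Sum>q\<in>{1..n}. (c q - c' q) * ?D q\<bar> = \<bar>\<Sum>q\<in>QQ t s'. (c q - c' q) * ?D q\<bar>"
    by (intro arg_cong[where f=abs] sum.mono_neutral_right) (use c QQ_sub in \<open>auto simp: regular_def\<close>)
  also have "\<dots> \<le> (\<Sum>q\<in>QQ t s'. 1 * (280800 * \<beta>^3 / L * ?\<Phi> q))"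
  proof (rule order.trans[OF sum_abs sum_mono])
    fix q assume q: "q \<in> QQ t s'"
    have "0 \<le> c q" "c q \<le> 1" "0 \<le> c' q" "c' q \<le> 1" using c by (auto simp: regular_def)
    then have "\<bar>c q - c' q\<bar> \<le> 1" by linarith
    then show "\<bar>(c q - c' q) * ?D q\<bar> \<le> 1 * (280800 * \<beta>^3 / L * ?\<Phi> q)"
      unfolding abs_mult[of "c q - c' q"] using b[OF q] by (intro mult_mono) auto
  qed
  finally have "\<bar>\<Sum>q\<in>{1..n}. (c q - c' q) * ?D q\<bar> \<le> (\<Sum>q\<in>QQ t s'. 280800 * \<beta>^3 / L * ?\<Phi> q)" by simp
  then show ?thesis
    unfolding e Err_def c''_def[symmetric] abs_mult using \<eta>_nonneg by (simp add: mult_left_mono)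
qed

lemma C_YY:
  assumes "l \<in> QQ t s'" "j \<in> V" "k \<in> V" "m \<in> V"
  shows "\<bar>(Y t \<omega> j * Y s' \<omega> k) * Y l \<omega> m\<bar> \<le>
       24 * (Ttr t \<omega> j + Ttr s' \<omega> j + Ttr l \<omega> j) + 24 * (Ttr t \<omega> k + Ttr s' \<omega> k + Ttr l \<omega> k) + 24 * (Ttr t \<omega> m + Ttr s' \<omega> m + Ttr l \<omega> m)"
proof -
  have "\<bar>(Y t \<omega> j * Y s' \<omega> k) * Y l \<omega> m\<bar> \<le> \<bar>Y t \<omega> j\<bar>^3 + \<bar>Y s' \<omega> k\<bar>^3 + \<bar>Y l \<omega> m\<bar>^3"
    unfolding abs_mult by (rule mult3_le) auto
  also have "\<dots> \<le> Ttr t \<omega> j + Ttr s' \<omega> k + Ttr l \<omega> m"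
    using B_pos by (simp add: Ttr_def)
  also have "\<dots> \<le> 24 * (Ttr t \<omega> j + Ttr s' \<omega> j + Ttr l \<omega> j) + 24 * (Ttr t \<omega> k + Ttr s' \<omega> k + Ttr l \<omega> k) + 24 * (Ttr t \<omega> m + Ttr s' \<omega> m + Ttr l \<omega> m)"
    by (rule nine_sum_le(1)) (rule Ttr_nonneg)+
  finally show ?thesis .
qed

text \<open>The covariance acts as two factors of size \<open>B\<close>. Its bound
  \<open>24 * B\<^sup>2\<close> is the origin of the 24 in the hypothesis of
  \<open>D2_diff\<close>.\<close>

lemma C_Cyy:
  assumes "l \<in> QQ t s'" "j \<in> V" "k \<in> V" "m \<in> V"
  shows "\<bar>Cyy t s' j k * Y l \<omega> m\<bar> \<le>
       24 * (Ttr t \<omega> j + Ttr s' \<omega> j + Ttr l \<omega> j) + 24 * (Ttr t \<omega> k + Ttr s' \<omega> k + Ttr l \<omega> k) + 24 * (Ttr t \<omega> m + Ttr s' \<omega> m + Ttr l \<omega> m)"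
proof -
  have "\<bar>Cyy t s' j k * Y l \<omega> m\<bar> \<le> 24 * B\<^sup>2 * \<bar>Y l \<omega> m\<bar>"
    unfolding abs_mult using Cyy_bound[OF t assms(2) s'n assms(3)] by (intro mult_right_mono) auto
  also have "\<dots> = 24 * (B * B * \<bar>Y l \<omega> m\<bar>)" by (simp add: power2_eq_square)
  also have "\<dots> \<le> 24 * (B^3 + B^3 + \<bar>Y l \<omega> m\<bar>^3)"
    using B_pos by (intro mult_left_mono mult3_le) auto
  also have "\<dots> \<le> 24 * (Ttr t \<omega> j + Ttr s' \<omega> k + Ttr l \<omega> m)"
    using B_pos by (simp add: Ttr_def)
  also have "\<dots> \<le> 24 * (Ttr t \<omega> j + Ttr s' \<omega> j + Ttr l \<omega> j) + 24 * (Ttr t \<omega> k + Ttr s' \<omega> k + Ttr l \<omega> k) + 24 * (Ttr t \<omega> m + Ttr s' \<omega> m + Ttr l \<omega> m)"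
    by (rule nine_sum_le(2)) (rule Ttr_nonneg)+
  finally show ?thesis .
qed

lemma integrable_D2: "j \<in> V \<Longrightarrow> k \<in> V \<Longrightarrow> integrable M (\<lambda>\<omega>. D2 (Zc c \<omega>) j k)"
  by (rule integrable_const_bound[of _ "600 * \<beta>^2"]) (use D2_bound in \<open>auto intro!: AE_I2\<close>)

lemma integrable_YYD2:
  assumes "j \<in> V" "k \<in> V" shows "integrable M (\<lambda>\<omega>. Y t \<omega> j * Y s' \<omega> k * D2 (Zc c \<omega>) j k)"
proof (rule Bochner_Integration.integrable_bound[OF integrable_mult_left[OF integrable_YY[OF t assms(1) s'n assms(2)], of "600 * \<beta>^2"]])
  show "AE \<omega> in M. norm (Y t \<omega> j * Y s' \<omega> k * D2 (Zc c \<omega>) j k) \<le> norm (Y t \<omega> j * Y s' \<omega> k * (600 * \<beta>\<^sup>2))"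
    using D2_bound[OF assms] by (auto intro!: AE_I2 mult_left_mono simp: abs_mult)
qed (intro borel_measurable_times meas_Y smooth_meas assms t s'n)

text \<open>Both neighbourhoods have to go, because the pair of variables is independent only of
  what lies outside their union.\<close>

lemma YYD2_factor:
  assumes j: "j \<in> V" and k: "k \<in> V"
  shows "expectation (\<lambda>\<omega>. Y t \<omega> j * Y s' \<omega> k * D2 (Zc (off (QQ t s')) \<omega>) j k) =
      Cyy t s' j k * expectation (\<lambda>\<omega>. D2 (Zc (off (QQ t s')) \<omega>) j k)"
proof -
  let ?J = "{1..n} - QQ t s'"
  have J: "?J \<subseteq> {1..n}" by auto
  define h where "h y = D2 (Zy ?J (\<lambda>_. 1) y) j k" for y
  define f where "f y = y t j * y s' k" for y :: "nat \<Rightarrow> 'b \<Rightarrow> real"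
  have hm: "h \<in> borel_measurable (\<Pi>\<^sub>M t\<in>?J. \<Pi>\<^sub>M j\<in>V. borel)"
    unfolding h_def by (rule smooth_meas_y(3)[OF J j k])
  have fm: "f \<in> borel_measurable (\<Pi>\<^sub>M t\<in>{t, s'}. \<Pi>\<^sub>M j\<in>V. borel)"
    unfolding f_def by (intro borel_measurable_times comp2_measurable j k) auto
  have hu: "h (\<lambda>t\<in>?J. Y t \<omega>) = D2 (Zc (off (QQ t s')) \<omega>) j k" for \<omega>
    using Zc_off[OF QQ_sub, of \<omega>] by (simp add: h_def)
  have fu: "f (\<lambda>t\<in>{t, s'}. Y t \<omega>) = Y t \<omega> j * Y s' \<omega> k" for \<omega>
    by (simp add: f_def)
  show ?thesis
    unfolding Cyy_def
    by (rule indep_factor[OF _ J _ fm _ hm, unfolded hu fu])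
      (use t s'n integrable_YY[OF t j s'n k] integrable_D2[OF j k] in auto)
qed

end

lemma YD1_zero:
  assumes t: "t \<in> {1..n}" and j: "j \<in> V"
  shows "expectation (\<lambda>\<omega>. Y t \<omega> j * D1 (Zc (off (nb t)) \<omega>) j) = 0"
proof -
  let ?J = "{1..n} - nb t"
  have J: "?J \<subseteq> {1..n}" by auto
  define h where "h y = D1 (Zy ?J (\<lambda>_. 1) y) j" for y
  define f where "f y = y t j" for y :: "nat \<Rightarrow> 'b \<Rightarrow> real"
  have hm: "h \<in> borel_measurable (\<Pi>\<^sub>M t\<in>?J. \<Pi>\<^sub>M j\<in>V. borel)"
    unfolding h_def by (rule smooth_meas_y(2)[OF J j])
  have fm: "f \<in> borel_measurable (\<Pi>\<^sub>M t\<in>{t}. \<Pi>\<^sub>M j\<in>V. borel)"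
    unfolding f_def by (intro comp2_measurable j) auto
  have hu: "h (\<lambda>t\<in>?J. Y t \<omega>) = D1 (Zc (off (nb t)) \<omega>) j" for \<omega>
    using Zc_off[OF nb_sub[OF t], of \<omega>] by (simp add: h_def)
  have fu: "f (\<lambda>t\<in>{t}. Y t \<omega>) = Y t \<omega> j" for \<omega>
    by (simp add: f_def)
  have "integrable M (\<lambda>\<omega>. D1 (Zc (off (nb t)) \<omega>) j)"
    by (rule integrable_const_bound[of _ "300 * \<beta>"]) (use j D1_bound in \<open>auto intro!: AE_I2\<close>)
  then show ?thesis
    using indep_factor[OF _ J _ fm _ hm, unfolded hu fu] t integrable_Y[OF t j] mean0[OF t j]
    by auto
qed

lemma integrable_YD1:
  assumes "t \<in> {1..n}" "j \<in> V" shows "integrable M (\<lambda>\<omega>. Y t \<omega> j * D1 (Zc c \<omega>) j)"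
proof (rule Bochner_Integration.integrable_bound[OF integrable_mult_left[OF integrable_Y[OF assms], of "300 * \<beta>"]])
  show "AE \<omega> in M. norm (Y t \<omega> j * D1 (Zc c \<omega>) j) \<le> norm (Y t \<omega> j * (300 * \<beta>))"
    using D1_bound[OF assms(2)] \<beta>_pos by (auto intro!: AE_I2 mult_left_mono simp: abs_mult)
qed (intro borel_measurable_times meas_Y smooth_meas assms)

lemma regular_mono: "regular c Q \<Longrightarrow> Q \<subseteq> Q' \<Longrightarrow> regular c Q'"
  by (auto simp: regular_def)

text \<open>A first-order expansion of \<open>D1\<close> in the neighbours of \<open>t\<close>
  leaves \<open>D2\<close> at a random point. Its weights differ from 1 only on \<open>nb t\<close>,
  so \<open>D2_diff\<close> moves it to the sum without \<open>QQ t s'\<close>.\<close>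

lemma stein_pointwise:
  assumes t: "t \<in> {1..n}"
  shows "\<bar>(\<Sum>j\<in>V. Y t \<omega> j * D1 (Z \<omega>) j) - (\<Sum>j\<in>V. Y t \<omega> j * D1 (Zc (off (nb t)) \<omega>) j)
     - \<eta> * (\<Sum>s'\<in>nb t. \<Sum>j\<in>V. \<Sum>k\<in>V. Y t \<omega> j * Y s' \<omega> k * D2 (Zc (off (QQ t s')) \<omega>) j k)\<bar>
     \<le> \<eta> * (\<Sum>s'\<in>nb t. Err t s' \<omega>)"
proof -
  let ?c = "\<lambda>r q. off (nb t) q + r * (1 - off (nb t) q)"
  obtain r where r: "0 < r" "r < 1" and
    e: "(\<Sum>j\<in>V. Y t \<omega> j * D1 (Z \<omega>) j) - (\<Sum>j\<in>V. Y t \<omega> j * D1 (Zc (off (nb t)) \<omega>) j) =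
     (\<Sum>j\<in>V. \<Sum>k\<in>V. Y t \<omega> j * (\<eta> * (\<Sum>q\<in>{1..n}. (1 - off (nb t) q) * Y q \<omega> k)) * D2 (Zc (?c r) \<omega>) j k)"
    using D1_mvt[of "Y t \<omega>" "\<lambda>_. 1" \<omega> "off (nb t)"] unfolding Z_def by blast
  have c: "regular (?c r) (nb t)" using r by (auto simp: regular_def off_def)
  have q: "(\<Sum>q\<in>{1..n}. (1 - off (nb t) q) * Y q \<omega> k) = (\<Sum>s'\<in>nb t. Y s' \<omega> k)" for k
  proof -
    have "(\<Sum>q\<in>{1..n}. (1 - off (nb t) q) * Y q \<omega> k) = (\<Sum>q\<in>nb t. (1 - off (nb t) q) * Y q \<omega> k)"
      by (rule sum.mono_neutral_right) (use nb_sub[OF t] in \<open>auto simp: off_def\<close>)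
    then show ?thesis by (simp add: off_def)
  qed
  have "(\<Sum>j\<in>V. \<Sum>k\<in>V. Y t \<omega> j * (\<eta> * (\<Sum>s'\<in>nb t. Y s' \<omega> k)) * D2 (Zc (?c r) \<omega>) j k)
     = (\<Sum>j\<in>V. \<Sum>k\<in>V. \<Sum>s'\<in>nb t. \<eta> * (Y t \<omega> j * Y s' \<omega> k * D2 (Zc (?c r) \<omega>) j k))"
    unfolding sum_distrib_left sum_distrib_right by (intro sum.cong refl) (simp add: mult_ac)
  also have "\<dots> = (\<Sum>s'\<in>nb t. \<Sum>j\<in>V. \<Sum>k\<in>V. \<eta> * (Y t \<omega> j * Y s' \<omega> k * D2 (Zc (?c r) \<omega>) j k))"
    unfolding sum.swap[of _ "nb t" V] ..
  also have "\<dots> = \<eta> * (\<Sum>s'\<in>nb t. \<Sum>j\<in>V. \<Sum>k\<in>V. Y t \<omega> j * Y s' \<omega> k * D2 (Zc (?c r) \<omega>) j k)"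
    by (simp add: sum_distrib_left)
  finally have e': "(\<Sum>j\<in>V. Y t \<omega> j * D1 (Z \<omega>) j) - (\<Sum>j\<in>V. Y t \<omega> j * D1 (Zc (off (nb t)) \<omega>) j) =
    \<eta> * (\<Sum>s'\<in>nb t. \<Sum>j\<in>V. \<Sum>k\<in>V. Y t \<omega> j * Y s' \<omega> k * D2 (Zc (?c r) \<omega>) j k)"
    using e unfolding q by simp
  have "\<bar>(\<Sum>s'\<in>nb t. \<Sum>j\<in>V. \<Sum>k\<in>V. Y t \<omega> j * Y s' \<omega> k * D2 (Zc (?c r) \<omega>) j k) -
     (\<Sum>s'\<in>nb t. \<Sum>j\<in>V. \<Sum>k\<in>V. Y t \<omega> j * Y s' \<omega> k * D2 (Zc (off (QQ t s')) \<omega>) j k)\<bar> \<le> (\<Sum>s'\<in>nb t. Err t s' \<omega>)"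
    unfolding sum_subtractf[symmetric, where A="nb t"]
  proof (rule order.trans[OF sum_abs sum_mono])
    fix s' assume s': "s' \<in> nb t"
    show "\<bar>(\<Sum>j\<in>V. \<Sum>k\<in>V. Y t \<omega> j * Y s' \<omega> k * D2 (Zc (?c r) \<omega>) j k) -
       (\<Sum>j\<in>V. \<Sum>k\<in>V. Y t \<omega> j * Y s' \<omega> k * D2 (Zc (off (QQ t s')) \<omega>) j k)\<bar> \<le> Err t s' \<omega>"
      by (rule D2_diff[OF t s' regular_mono[OF c] regular_off C_YY[OF t s']]) auto
  qed
  then show ?thesis unfolding e' right_diff_distrib[symmetric] abs_mult using \<eta>_nonneg by (simp add: mult_left_mono)
qed

text \<open>The second-order term is moved twice: from the random point to the sum without
  \<open>QQ t s'\<close>, where the covariance factors out, and from there back to the full sum.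
  This is the factor 2. The first-order term vanishes since \<open>Y t\<close> is centred and
  independent of the sum without \<open>nb t\<close>.\<close>

lemma stein_t:
  assumes t: "t \<in> {1..n}"
  shows "\<bar>expectation (\<lambda>\<omega>. \<Sum>j\<in>V. Y t \<omega> j * D1 (Z \<omega>) j)
     - \<eta> * (\<Sum>s'\<in>nb t. \<Sum>j\<in>V. \<Sum>k\<in>V. Cyy t s' j k * expectation (\<lambda>\<omega>. D2 (Z \<omega>) j k))\<bar>
     \<le> 2 * (\<eta> * (d1 * (\<eta> * (d2 * (842400 * \<beta>^3 / L * \<Phi>m)))))"
proof -
  let ?S0 = "\<lambda>\<omega>. \<Sum>j\<in>V. Y t \<omega> j * D1 (Z \<omega>) j"
  let ?S1 = "\<lambda>\<omega>. \<Sum>j\<in>V. Y t \<omega> j * D1 (Zc (off (nb t)) \<omega>) j"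
  let ?S2 = "\<lambda>\<omega>. \<Sum>s'\<in>nb t. \<Sum>j\<in>V. \<Sum>k\<in>V. Y t \<omega> j * Y s' \<omega> k * D2 (Zc (off (QQ t s')) \<omega>) j k"
  let ?E = "\<lambda>\<omega>. \<Sum>s'\<in>nb t. Err t s' \<omega>"
  let ?T1 = "\<Sum>s'\<in>nb t. \<Sum>j\<in>V. \<Sum>k\<in>V. Cyy t s' j k * expectation (\<lambda>\<omega>. D2 (Zc (off (QQ t s')) \<omega>) j k)"
  let ?T2 = "\<Sum>s'\<in>nb t. \<Sum>j\<in>V. \<Sum>k\<in>V. Cyy t s' j k * expectation (\<lambda>\<omega>. D2 (Z \<omega>) j k)"
  have i: "integrable M ?S0" "integrable M ?S1" "integrable M ?S2" "integrable M ?E"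
    unfolding Z_def using t by (auto intro!: Bochner_Integration.integrable_sum integrable_YD1 integrable_YYD2 Err_integrable)
  have E1: "expectation ?S1 = 0"
    using t by (subst Bochner_Integration.integral_sum) (auto intro: integrable_YD1 simp: YD1_zero)
  have E2: "expectation ?S2 = ?T1"
  proof -
    have "expectation ?S2 = (\<Sum>s'\<in>nb t. expectation (\<lambda>\<omega>. \<Sum>j\<in>V. \<Sum>k\<in>V. Y t \<omega> j * Y s' \<omega> k * D2 (Zc (off (QQ t s')) \<omega>) j k))"
      using t by (intro Bochner_Integration.integral_sum Bochner_Integration.integrable_sum integrable_YYD2)
    also have "\<dots> = (\<Sum>s'\<in>nb t. \<Sum>j\<in>V. expectation (\<lambda>\<omega>. \<Sum>k\<in>V. Y t \<omega> j * Y s' \<omega> k * D2 (Zc (off (QQ t s')) \<omega>) j k))"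
      using t by (intro sum.cong refl Bochner_Integration.integral_sum Bochner_Integration.integrable_sum integrable_YYD2)
    also have "\<dots> = (\<Sum>s'\<in>nb t. \<Sum>j\<in>V. \<Sum>k\<in>V. expectation (\<lambda>\<omega>. Y t \<omega> j * Y s' \<omega> k * D2 (Zc (off (QQ t s')) \<omega>) j k))"
      using t by (intro sum.cong refl Bochner_Integration.integral_sum Bochner_Integration.integrable_sum integrable_YYD2)
    also have "\<dots> = ?T1" using t by (intro sum.cong refl YYD2_factor)
    finally show ?thesis .
  qed
  have EE: "expectation ?E \<le> d1 * (\<eta> * (d2 * (842400 * \<beta>^3 / L * \<Phi>m)))" (is "_ \<le> d1 * ?b")
  proof -
    have b0: "?b \<ge> 0"
      using \<eta>_nonneg d2_nonneg \<Phi>m_nonneg \<beta>_pos L_ge by (intro mult_nonneg_nonneg divide_nonneg_nonneg) auto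
    have "expectation ?E = (\<Sum>s'\<in>nb t. expectation (Err t s'))"
      using t by (intro Bochner_Integration.integral_sum Err_integrable)
    also have "\<dots> \<le> (\<Sum>s'\<in>nb t. ?b)" using t by (intro sum_mono Err_expect)
    also have "\<dots> = card (nb t) * ?b" by simp
    also have "\<dots> \<le> d1 * ?b" using card_nb[OF t] b0 by (intro mult_right_mono)
    finally show ?thesis .
  qed
  have "\<bar>expectation ?S0 - expectation ?S1 - \<eta> * expectation ?S2\<bar> = \<bar>expectation (\<lambda>\<omega>. ?S0 \<omega> - ?S1 \<omega> - \<eta> * ?S2 \<omega>)\<bar>"
    using i by simp
  also have "\<dots> \<le> expectation (\<lambda>\<omega>. \<bar>?S0 \<omega> - ?S1 \<omega> - \<eta> * ?S2 \<omega>\<bar>)" by (rule integral_abs_bound)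
  also have "\<dots> \<le> expectation (\<lambda>\<omega>. \<eta> * ?E \<omega>)"
    using i t by (intro integral_mono stein_pointwise integrable_abs Bochner_Integration.integrable_diff integrable_mult_right)
  also have "\<dots> = \<eta> * expectation ?E" by simp
  finally have 1: "\<bar>expectation ?S0 - \<eta> * ?T1\<bar> \<le> \<eta> * expectation ?E" unfolding E1 E2 by simp
  have "\<bar>?T1 - ?T2\<bar> \<le> (\<Sum>s'\<in>nb t. expectation (Err t s'))"
    unfolding sum_subtractf[symmetric, where A="nb t"]
  proof (rule order.trans[OF sum_abs sum_mono])
    fix s' assume s': "s' \<in> nb t"
    let ?f = "\<lambda>c \<omega>. \<Sum>j\<in>V. \<Sum>k\<in>V. Cyy t s' j k * D2 (Zc c \<omega>) j k"
    have if': "integrable M (?f c)" for c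
      using integrable_D2[OF t s'] by (intro Bochner_Integration.integrable_sum integrable_mult_right)
    have ef: "(\<Sum>j\<in>V. \<Sum>k\<in>V. Cyy t s' j k * expectation (\<lambda>\<omega>. D2 (Zc c \<omega>) j k)) = expectation (?f c)" for c
      using integrable_D2[OF t s'] by (simp add: Bochner_Integration.integral_sum)
    have "\<bar>expectation (?f (off (QQ t s'))) - expectation (?f (\<lambda>_. 1))\<bar> = \<bar>expectation (\<lambda>\<omega>. ?f (off (QQ t s')) \<omega> - ?f (\<lambda>_. 1) \<omega>)\<bar>"
      using if' by (subst Bochner_Integration.integral_diff) auto
    also have "\<dots> \<le> expectation (\<lambda>\<omega>. \<bar>?f (off (QQ t s')) \<omega> - ?f (\<lambda>_. 1) \<omega>\<bar>)" by (rule integral_abs_bound)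
    also have "\<dots> \<le> expectation (Err t s')"
    proof (intro integral_mono integrable_abs Bochner_Integration.integrable_diff if' Err_integrable t s')
      fix \<omega>
      show "\<bar>?f (off (QQ t s')) \<omega> - ?f (\<lambda>_. 1) \<omega>\<bar> \<le> Err t s' \<omega>"
        by (rule D2_diff[OF t s' regular_off _ C_Cyy[OF t s']]) (auto simp: regular_def)
    qed
    finally show "\<bar>(\<Sum>j\<in>V. \<Sum>k\<in>V. Cyy t s' j k * expectation (\<lambda>\<omega>. D2 (Zc (off (QQ t s')) \<omega>) j k)) -
       (\<Sum>j\<in>V. \<Sum>k\<in>V. Cyy t s' j k * expectation (\<lambda>\<omega>. D2 (Z \<omega>) j k))\<bar> \<le> expectation (Err t s')"
      unfolding Z_def ef .
  qed
  also have "\<dots> = expectation ?E" using t by (intro Bochner_Integration.integral_sum[symmetric] Err_integrable)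
  finally have "\<eta> * \<bar>?T1 - ?T2\<bar> \<le> \<eta> * expectation ?E" using \<eta>_nonneg by (intro mult_left_mono)
  then have 2: "\<bar>\<eta> * ?T1 - \<eta> * ?T2\<bar> \<le> \<eta> * expectation ?E"
    using \<eta>_nonneg by (simp add: abs_mult flip: right_diff_distrib)
  have "\<eta> * expectation ?E \<le> \<eta> * (d1 * (\<eta> * (d2 * (842400 * \<beta>^3 / L * \<Phi>m))))"
    using EE \<eta>_nonneg by (intro mult_left_mono)
  with 1 2 show ?thesis by linarith
qed

lemma Z_eq: "Z \<omega> j = g j + s * W \<omega> j"
  by (simp add: Z_def Zc_def Zy_def \<eta>_def W_def)

text \<open>The \<open>n\<close> contributions each carry \<open>\<eta> * \<eta>\<close>, which is
  at most \<open>1 / n\<close>; the remaining \<open>1 / sqrt n\<close> stems from \<open>W\<close>.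
  The constant is 2 * 842400 * 3000.\<close>

theorem stein_bound:
  "\<bar>expectation (\<lambda>\<omega>. \<Sum>j\<in>V. D1 (Z \<omega>) j * W \<omega> j) - s * (\<Sum>j\<in>V. \<Sum>k\<in>V. Xi j k * expectation (\<lambda>\<omega>. D2 (Z \<omega>) j k))\<bar>
    \<le> 5054400000 * (d1 * d2 * (\<beta>^3 * B^3) / (L * sqrt n)) *
       (prob {\<omega> \<in> space M. wnd 2 (Z \<omega>)} + d1 * real (card V) ^ 2 * exp (- \<tau> / 2))"
proof -
  let ?b = "842400 * \<beta>^3 / L * \<Phi>m"
  let ?T = "\<lambda>t. \<Sum>s'\<in>nb t. \<Sum>j\<in>V. \<Sum>k\<in>V. Cyy t s' j k * expectation (\<lambda>\<omega>. D2 (Z \<omega>) j k)"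
  have n0: "real n > 0" using n_ge by simp
  note m0 = \<Phi>m_nonneg and d2 = d2_nonneg
  have "(\<Sum>j\<in>V. D1 (Z \<omega>) j * W \<omega> j) = (\<Sum>t\<in>{1..n}. \<Sum>j\<in>V. Y t \<omega> j * D1 (Z \<omega>) j) / sqrt n" for \<omega>
  proof -
    have "(\<Sum>j\<in>V. D1 (Z \<omega>) j * W \<omega> j) = (\<Sum>j\<in>V. \<Sum>t\<in>{1..n}. Y t \<omega> j * D1 (Z \<omega>) j / sqrt n)"
      unfolding W_def sum_divide_distrib sum_distrib_left by (intro sum.cong refl) simp
    also have "\<dots> = (\<Sum>t\<in>{1..n}. \<Sum>j\<in>V. Y t \<omega> j * D1 (Z \<omega>) j / sqrt n)" by (rule sum.swap)
    finally show ?thesis by (simp add: sum_divide_distrib)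
  qed
  then have "expectation (\<lambda>\<omega>. \<Sum>j\<in>V. D1 (Z \<omega>) j * W \<omega> j) =
      expectation (\<lambda>\<omega>. \<Sum>t\<in>{1..n}. \<Sum>j\<in>V. Y t \<omega> j * D1 (Z \<omega>) j) / sqrt n" by simp
  also have "expectation (\<lambda>\<omega>. \<Sum>t\<in>{1..n}. \<Sum>j\<in>V. Y t \<omega> j * D1 (Z \<omega>) j) =
      (\<Sum>t\<in>{1..n}. expectation (\<lambda>\<omega>. \<Sum>j\<in>V. Y t \<omega> j * D1 (Z \<omega>) j))"
    unfolding Z_def by (intro Bochner_Integration.integral_sum Bochner_Integration.integrable_sum integrable_YD1)
  finally have E: "expectation (\<lambda>\<omega>. \<Sum>j\<in>V. D1 (Z \<omega>) j * W \<omega> j) =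
     (\<Sum>t\<in>{1..n}. expectation (\<lambda>\<omega>. \<Sum>j\<in>V. Y t \<omega> j * D1 (Z \<omega>) j)) / sqrt n" .
  have X: "s * (\<Sum>j\<in>V. \<Sum>k\<in>V. Xi j k * expectation (\<lambda>\<omega>. D2 (Z \<omega>) j k)) = (\<Sum>t\<in>{1..n}. \<eta> * ?T t) / sqrt n"
  proof -
    define e where "e j k = expectation (\<lambda>\<omega>. D2 (Z \<omega>) j k)" for j k
    have "s * (\<Sum>j\<in>V. \<Sum>k\<in>V. Xi j k * e j k) = (\<Sum>j\<in>V. \<Sum>k\<in>V. \<Sum>t\<in>{1..n}. \<Sum>s'\<in>nb t. s / n * (Cyy t s' j k * e j k))"
      unfolding Xi_def sum_divide_distrib sum_distrib_left sum_distrib_right by (intro sum.cong refl) simp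
    also have "\<dots> = (\<Sum>t\<in>{1..n}. \<Sum>j\<in>V. \<Sum>k\<in>V. \<Sum>s'\<in>nb t. s / n * (Cyy t s' j k * e j k))"
      unfolding sum.swap[of _ "{1..n}" V] ..
    also have "\<dots> = (\<Sum>t\<in>{1..n}. \<Sum>s'\<in>nb t. \<Sum>j\<in>V. \<Sum>k\<in>V. s / n * (Cyy t s' j k * e j k))"
      unfolding sum.swap[of _ "nb _" V] ..
    also have "s / n = \<eta> / sqrt n" using n0 by (simp add: \<eta>_def)
    finally show ?thesis unfolding e_def[symmetric]
      by (simp add: sum_distrib_left sum_divide_distrib)
  qed
  have "\<bar>(\<Sum>t\<in>{1..n}. expectation (\<lambda>\<omega>. \<Sum>j\<in>V. Y t \<omega> j * D1 (Z \<omega>) j)) - (\<Sum>t\<in>{1..n}. \<eta> * ?T t)\<bar>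
     \<le> (\<Sum>t\<in>{1..n}. 2 * (\<eta> * (d1 * (\<eta> * (d2 * ?b)))))"
    unfolding sum_subtractf[symmetric, where A="{1..n}"]
    by (rule order.trans[OF sum_abs sum_mono]) (rule stein_t)
  also have "\<dots> = n * (\<eta> * \<eta>) * (2 * (d1 * (d2 * ?b)))" by simp
  also have "\<dots> \<le> 1 * (2 * (d1 * (d2 * ?b)))"
  proof (rule mult_right_mono)
    have "\<eta> * \<eta> \<le> 1 / sqrt n * (1 / sqrt n)" using \<eta>_le \<eta>_nonneg by (intro mult_mono) auto
    then show "n * (\<eta> * \<eta>) \<le> 1" using n0 by (simp add: field_simps)
    show "0 \<le> 2 * (d1 * (d2 * ?b))" using m0 d1_ge d2 \<beta>_pos L_ge by simp
  qed
  finally have "\<bar>(\<Sum>t\<in>{1..n}. expectation (\<lambda>\<omega>. \<Sum>j\<in>V. Y t \<omega> j * D1 (Z \<omega>) j)) - (\<Sum>t\<in>{1..n}. \<eta> * ?T t)\<bar> / sqrt n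
      \<le> 2 * (d1 * (d2 * ?b)) / sqrt n" using n0 by (intro divide_right_mono) auto
  also have "\<dots> = 5054400000 * (d1 * d2 * (\<beta>^3 * B^3) / (L * sqrt n)) *
       (prob {\<omega> \<in> space M. wnd 2 (Z \<omega>)} + d1 * real (card V) ^ 2 * exp (- \<tau> / 2))"
    by (simp add: \<Phi>m_def)
  finally show ?thesis unfolding E X using n0 by (simp add: abs_divide flip: diff_divide_distrib)
qed

end

section \<open>Interpolation between the sum and its Gaussian analogue\<close>

text \<open>The mean value theorem bounds all difference quotients by \<open>h\<close>, so dominated
  convergence applies along every sequence.\<close>

lemma DERIV_integral:
  fixes f f' :: "real \<Rightarrow> 'a \<Rightarrow> real"
  assumes int: "\<And>r. integrable M (f r)"
    and d: "\<And>r x. ((\<lambda>r. f r x) has_real_derivative f' r x) (at r)"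
    and b: "\<And>r x. \<bar>f' r x\<bar> \<le> h x" and h: "integrable M h" and m: "\<And>r. f' r \<in> borel_measurable M"
  shows "((\<lambda>r. \<integral>x. f r x \<partial>M) has_real_derivative (\<integral>x. f' r x \<partial>M)) (at r)"
  unfolding DERIV_def tendsto_at_iff_sequentially
proof (intro allI impI)
  fix X :: "nat \<Rightarrow> real" assume X: "\<forall>i. X i \<in> UNIV - {0}" "X \<longlonglongrightarrow> 0"
  have eq: "((\<lambda>k. ((\<integral>x. f (r + k) x \<partial>M) - (\<integral>x. f r x \<partial>M)) / k) \<circ> X) i = (\<integral>x. (f (r + X i) x - f r x) / X i \<partial>M)" for i
    using int by simp
  have "(\<lambda>i. \<integral>x. (f (r + X i) x - f r x) / X i \<partial>M) \<longlonglongrightarrow> (\<integral>x. f' r x \<partial>M)"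
  proof (rule integral_dominated_convergence[where w = h])
    show "f' r \<in> borel_measurable M" by (rule m)
    show "(\<lambda>x. (f (r + X i) x - f r x) / X i) \<in> borel_measurable M" for i
      using int by (intro borel_measurable_divide borel_measurable_diff) auto
    show "AE x in M. (\<lambda>i. (f (r + X i) x - f r x) / X i) \<longlonglongrightarrow> f' r x"
      using d[of _ r] X unfolding DERIV_def tendsto_at_iff_sequentially by (auto simp: comp_def)
    show "AE x in M. norm ((f (r + X i) x - f r x) / X i) \<le> h x" for i
    proof (rule AE_I2)
      fix x
      have X0: "X i \<noteq> 0" using X by simp
      have "\<bar>f (r + X i) x - f r x\<bar> \<le> h x * \<bar>r + X i - r\<bar>"
        using field_differentiable_bound[of UNIV "\<lambda>r. f r x" "\<lambda>r. f' r x" "h x" "r + X i" r] d b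
        by (auto simp: has_field_derivative_at_within)
      then show "norm ((f (r + X i) x - f r x) / X i) \<le> h x"
        using X0 by (simp add: abs_divide field_simps)
    qed
  qed (rule h)
  then show "((\<lambda>k. ((\<integral>x. f (r + k) x \<partial>M) - (\<integral>x. f r x \<partial>M)) / k) \<circ> X) \<longlonglongrightarrow> (\<integral>x. f' r x \<partial>M)"
    unfolding eq[abs_def, symmetric] .
qed

lemma (in pair_prob_space) integrable_comp_fst:
  fixes f :: "_ \<Rightarrow> real"
  assumes f: "integrable M1 f" shows "integrable (M1 \<Otimes>\<^sub>M M2) (\<lambda>w. f (fst w))"
proof (rule integrableI_bounded)
  have [measurable]: "f \<in> borel_measurable M1" using f by simp
  show "(\<lambda>w. f (fst w)) \<in> borel_measurable (M1 \<Otimes>\<^sub>M M2)" by measurable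
  have "(\<integral>\<^sup>+w. ennreal (norm (f (fst w))) \<partial>(M1 \<Otimes>\<^sub>M M2)) = (\<integral>\<^sup>+x. ennreal (norm (f x)) \<partial>M1)"
    by (subst M2.nn_integral_fst[symmetric]) (auto simp: M2.emeasure_space_1)
  also have "\<dots> < \<infinity>" using f by (simp add: integrable_iff_bounded)
  finally show "(\<integral>\<^sup>+w. ennreal (norm (f (fst w))) \<partial>(M1 \<Otimes>\<^sub>M M2)) < \<infinity>" .
qed

lemma (in pair_prob_space) integrable_comp_snd:
  fixes f :: "_ \<Rightarrow> real"
  assumes f: "integrable M2 f" shows "integrable (M1 \<Otimes>\<^sub>M M2) (\<lambda>w. f (snd w))"
proof (rule integrableI_bounded)
  have [measurable]: "f \<in> borel_measurable M2" using f by simp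
  show "(\<lambda>w. f (snd w)) \<in> borel_measurable (M1 \<Otimes>\<^sub>M M2)" by measurable
  have "(\<integral>\<^sup>+w. ennreal (norm (f (snd w))) \<partial>(M1 \<Otimes>\<^sub>M M2)) = (\<integral>\<^sup>+x. ennreal (norm (f x)) \<partial>M2)"
    by (subst M2.nn_integral_fst[symmetric]) (auto simp: M1.emeasure_space_1)
  also have "\<dots> < \<infinity>" using f by (simp add: integrable_iff_bounded)
  finally show "(\<integral>\<^sup>+w. ennreal (norm (f (snd w))) \<partial>(M1 \<Otimes>\<^sub>M M2)) < \<infinity>" .
qed

lemma gaussP_linear_measurable: "(\<lambda>z. \<Sum>l\<in>I. (a l :: real) * z l) \<in> borel_measurable (gaussP I)"
  by measurable

text \<open>\<open>lr\<close> expresses the Gaussian coordinates through independent standard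
  normals. The covariance matrix over \<open>V\<close> may be singular; only the single variances
  are bounded away from 0.\<close>

locale dep_gauss = dep_field +
  fixes I :: "'i set" and lr :: "'b \<Rightarrow> 'i \<Rightarrow> real" and \<sigma> :: real
  assumes fin_I: "finite I" and \<sigma>_pos: "\<sigma> > 0"
    and lr_cov: "j \<in> V \<Longrightarrow> k \<in> V \<Longrightarrow> Xi j k = (\<Sum>l\<in>I. lr j l * lr k l)"
    and lr_var: "j \<in> V \<Longrightarrow> (\<Sum>l\<in>I. (lr j l)\<^sup>2) \<ge> \<sigma>\<^sup>2"
begin

definition G :: "('i \<Rightarrow> real) \<Rightarrow> 'b \<Rightarrow> real" where "G z j = (\<Sum>l\<in>I. lr j l * z l)"

definition PP :: "('a \<times> ('i \<Rightarrow> real)) measure" where "PP = M \<Otimes>\<^sub>M gaussP I"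

definition Zt :: "('b \<Rightarrow> real) \<Rightarrow> real \<Rightarrow> real \<Rightarrow> 'a \<Rightarrow> ('i \<Rightarrow> real) \<Rightarrow> 'b \<Rightarrow> real" where
  "Zt b s c \<omega> z j = s * W \<omega> j + c * G z j - b j"

lemma W_meas [measurable]: "j \<in> V \<Longrightarrow> (\<lambda>\<omega>. W \<omega> j) \<in> borel_measurable M"
  unfolding W_def by (intro borel_measurable_divide borel_measurable_sum borel_measurable_const meas_Y)

lemma G_meas [measurable]: "(\<lambda>z. G z j) \<in> borel_measurable (gaussP I)"
  unfolding G_def by (rule gaussP_linear_measurable)

interpretation GP: prob_space "gaussP I" by (rule prob_space_gaussP)

lemma pair_MG: "pair_prob_space M (gaussP I)"
  by (simp add: pair_prob_space_def pair_sigma_finite_def prob_space_imp_sigma_finite prob_space_axioms prob_space_gaussP)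

interpretation MG: pair_prob_space M "gaussP I" by (rule pair_MG)

lemma Zt_meas: "j \<in> V \<Longrightarrow> (\<lambda>w. Zt b s c (fst w) (snd w) j) \<in> borel_measurable PP"
proof -
  assume j: "j \<in> V"
  have 1: "(\<lambda>w. W (fst w) j) \<in> borel_measurable PP"
    unfolding PP_def by (rule measurable_compose[OF measurable_fst W_meas[OF j]])
  have 2: "(\<lambda>w. G (snd w) j) \<in> borel_measurable PP"
    unfolding PP_def by (rule measurable_compose[OF measurable_snd G_meas])
  show ?thesis unfolding Zt_def
    by (intro borel_measurable_diff borel_measurable_add borel_measurable_times borel_measurable_const 1 2)
qed

lemma smooth_meas_P:
  "(\<lambda>w. F (Zt b s c (fst w) (snd w))) \<in> borel_measurable PP"
  "j \<in> V \<Longrightarrow> (\<lambda>w. D1 (Zt b s c (fst w) (snd w)) j) \<in> borel_measurable PP"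
  "j \<in> V \<Longrightarrow> k \<in> V \<Longrightarrow> (\<lambda>w. D2 (Zt b s c (fst w) (snd w)) j k) \<in> borel_measurable PP"
  "Measurable.pred PP (\<lambda>w. wnd a (Zt b s c (fst w) (snd w)))"
  by (rule measurable_smooth; auto intro: Zt_meas)+

lemma Zt_meas_z: "(\<lambda>z. Zt b s c \<omega> z j) \<in> borel_measurable (gaussP I)"
  unfolding Zt_def
  by (intro borel_measurable_diff borel_measurable_add borel_measurable_times borel_measurable_const G_meas)

lemma smooth_meas_z:
  "(\<lambda>z. F (Zt b s c \<omega> z)) \<in> borel_measurable (gaussP I)"
  "j \<in> V \<Longrightarrow> (\<lambda>z. D1 (Zt b s c \<omega> z) j) \<in> borel_measurable (gaussP I)"
  "j \<in> V \<Longrightarrow> k \<in> V \<Longrightarrow> (\<lambda>z. D2 (Zt b s c \<omega> z) j k) \<in> borel_measurable (gaussP I)"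
  "Measurable.pred (gaussP I) (\<lambda>z. wnd a (Zt b s c \<omega> z))"
  by (rule measurable_smooth; auto intro: Zt_meas_z)+

lemma Zt_meas_w: "j \<in> V \<Longrightarrow> (\<lambda>\<omega>. Zt b s c \<omega> z j) \<in> borel_measurable M"
  unfolding Zt_def
  by (intro borel_measurable_diff borel_measurable_add borel_measurable_times borel_measurable_const W_meas)

lemma smooth_meas_w:
  "(\<lambda>\<omega>. F (Zt b s c \<omega> z)) \<in> borel_measurable M"
  "Measurable.pred M (\<lambda>\<omega>. wnd a (Zt b s c \<omega> z))"
  by (rule measurable_smooth; auto intro: Zt_meas_w)+

lemma W_int: "j \<in> V \<Longrightarrow> integrable M (\<lambda>\<omega>. W \<omega> j)"
  unfolding W_def by (intro integrable_divide Bochner_Integration.integrable_sum integrable_Y) auto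

lemma G_int: "integrable (gaussP I) (\<lambda>z. G z j)"
  unfolding G_def by (intro Bochner_Integration.integrable_sum integrable_mult_right integrable_gaussP_component fin_I)

lemma WP_int: "j \<in> V \<Longrightarrow> integrable PP (\<lambda>w. W (fst w) j)"
  and GP_int: "integrable PP (\<lambda>w. G (snd w) j)"
proof -
  show "integrable PP (\<lambda>w. W (fst w) j)" if "j \<in> V"
    unfolding PP_def by (rule MG.integrable_comp_fst[OF W_int[OF that]])
  show "integrable PP (\<lambda>w. G (snd w) j)"
    unfolding PP_def by (rule MG.integrable_comp_snd[OF G_int])
qed

definition PW :: "('b \<Rightarrow> real) \<Rightarrow> real" where "PW b = prob {\<omega> \<in> space M. \<forall>j\<in>V. W \<omega> j \<le> b j}"
definition PG :: "('b \<Rightarrow> real) \<Rightarrow> real" where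
  "PG b = measure (gaussP I) {z \<in> space (gaussP I). \<forall>j\<in>V. G z j \<le> b j}"
text \<open>Anti-concentration at rate \<open>sqrt L / \<sigma>\<close> times a width of order
  \<open>L / \<beta>\<close>.\<close>

definition \<Lambda> :: real where "\<Lambda> = L * sqrt L / (\<beta> * \<sigma>)"
definition err :: real where "err = d1 * real (card V) ^ 2 * exp (- (sqrt n / (3 * d1 * \<beta> * B)) / 2)"
definition KK :: real where "KK = 5054400000 * (d1 * d2 * (\<beta>^3 * B^3) / (L * sqrt n))"

lemma W_set: "{\<omega> \<in> space M. \<forall>j\<in>V. W \<omega> j \<le> b j} \<in> sets M"
  by (intro sets.sets_Collect_finite_All finite_V borel_measurable_le W_meas borel_measurable_const)

lemma G_set: "{z \<in> space (gaussP I). \<forall>j\<in>V. G z j \<le> b j} \<in> sets (gaussP I)"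
  by (intro sets.sets_Collect_finite_All finite_V borel_measurable_le G_meas borel_measurable_const)

section \<open>Probability of the transition window\<close>

lemma PG_diff:
  assumes "\<eta> \<ge> 0" shows "PG (\<lambda>j. b j + \<eta>) - PG b \<le> 45 * sqrt L * \<eta> / \<sigma>"
proof -
  let ?A = "{z \<in> space (gaussP I). \<forall>j\<in>V. G z j \<le> b j + \<eta>}" and ?B = "{z \<in> space (gaussP I). \<forall>j\<in>V. G z j \<le> b j}"
  have sub: "?B \<subseteq> ?A" using assms by (auto intro: add_increasing2)
  have "PG (\<lambda>j. b j + \<eta>) - PG b = GP.prob (?A - ?B)"
    unfolding PG_def by (rule GP.finite_measure_Diff[symmetric, OF G_set G_set sub])
  also have "?A - ?B = {z \<in> space (gaussP I). (\<exists>j\<in>V. b j < (\<Sum>i\<in>I. lr j i * z i)) \<and> (\<forall>j\<in>V. (\<Sum>i\<in>I. lr j i * z i) \<le> b j + \<eta>)}"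
    unfolding G_def by (auto simp: not_le)
  also have "GP.prob \<dots> \<le> 45 * sqrt L * \<eta> / \<sigma>"
    by (rule gauss_anti_var[OF fin_I finite_V lr_var \<sigma>_pos L_ge card_V assms])
  finally show ?thesis .
qed

text \<open>The level 3 exceeds the slack 2 strictly, as \<open>wnd_gt\<close> demands, and
  \<open>L \<ge> 1\<close> fits \<open>2 * L + 2\<close> into \<open>- 3 + 7 * L\<close>.\<close>

lemma wnd_window:
  assumes "wnd 2 x" shows "\<exists>j\<in>V. - 3 / \<beta> < x j" "j \<in> V \<Longrightarrow> x j \<le> - 3 / \<beta> + 7 * L / \<beta>"
proof -
  show "\<exists>j\<in>V. - 3 / \<beta> < x j" using wnd_gt[OF assms, of 3] by simp
  assume "j \<in> V"
  then have "x j \<le> (2 * L + 2) / \<beta>" by (rule wnd_le[OF assms])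
  also have "\<dots> \<le> (- 3 + 7 * L) / \<beta>" using L_ge \<beta>_pos by (intro divide_right_mono) auto
  finally show "x j \<le> - 3 / \<beta> + 7 * L / \<beta>" by (simp add: add_divide_distrib diff_divide_distrib)
qed

text \<open>Division by \<open>r\<close> moves the thresholds, which are arbitrary, and stretches
  the width 7 by at most 3/2.\<close>

lemma wnd_scaled:
  assumes "r \<ge> 2/3" and w: "wnd 2 (\<lambda>j. r * x j + y j)"
  shows "\<exists>j\<in>V. (- 3 / \<beta> - y j) / r < x j" "\<forall>j\<in>V. x j \<le> (- 3 / \<beta> - y j) / r + 21/2 * L / \<beta>"
proof -
  have r: "r > 0" using assms by simp
  show "\<exists>j\<in>V. (- 3 / \<beta> - y j) / r < x j"
    using wnd_window(1)[OF w] r by (auto simp: field_simps)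
  show "\<forall>j\<in>V. x j \<le> (- 3 / \<beta> - y j) / r + 21/2 * L / \<beta>"
  proof
    fix j assume "j \<in> V"
    then have "r * x j \<le> - 3 / \<beta> - y j + 7 * L / \<beta>" using wnd_window(2)[OF w, of j] by linarith
    then have "x j \<le> (- 3 / \<beta> - y j) / r + (7 * L / \<beta>) / r"
      using r by (simp add: field_simps)
    also have "(7 * L / \<beta>) / r \<le> (7 * L / \<beta>) / (2/3)"
      using assms L_ge \<beta>_pos by (intro divide_left_mono) auto
    also have "\<dots> = 21/2 * L / \<beta>" by simp
    finally show "x j \<le> (- 3 / \<beta> - y j) / r + 21/2 * L / \<beta>" by simp
  qed
qed

lemma \<Lambda>_eq: "45 * sqrt L * (21/2 * L / \<beta>) / \<sigma> = 945/2 * \<Lambda>"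
  by (simp add: \<Lambda>_def mult_ac)

lemma \<Lambda>_nonneg: "\<Lambda> \<ge> 0" using L_ge \<beta>_pos \<sigma>_pos by (simp add: \<Lambda>_def)

lemma \<eta>0: "21/2 * L / \<beta> \<ge> 0" using L_ge \<beta>_pos by simp

lemma wnd_prob_z:
  assumes "c \<ge> 2/3"
  shows "measure (gaussP I) {z \<in> space (gaussP I). wnd 2 (Zt b s c \<omega> z)} \<le> 945/2 * \<Lambda>"
proof -
  let ?b = "\<lambda>j. (- 3 / \<beta> - (s * W \<omega> j - b j)) / c" and ?\<eta> = "21/2 * L / \<beta>"
  let ?A = "{z \<in> space (gaussP I). \<forall>j\<in>V. G z j \<le> ?b j + ?\<eta>}" and ?B = "{z \<in> space (gaussP I). \<forall>j\<in>V. G z j \<le> ?b j}"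
  have sub: "?B \<subseteq> ?A" using \<eta>0 by (auto intro: add_increasing2)
  have Z: "Zt b s c \<omega> z = (\<lambda>j. c * G z j + (s * W \<omega> j - b j))" for z
    by (simp add: Zt_def fun_eq_iff)
  have "{z \<in> space (gaussP I). wnd 2 (Zt b s c \<omega> z)} \<subseteq> ?A - ?B"
  proof (rule subsetI)
    fix z assume z: "z \<in> {z \<in> space (gaussP I). wnd 2 (Zt b s c \<omega> z)}"
    then have w: "wnd 2 (\<lambda>j. c * G z j + (s * W \<omega> j - b j))" unfolding Z by simp
    obtain j where "j \<in> V" "?b j < G z j" using wnd_scaled(1)[OF assms w] by blast
    then have "z \<notin> ?B" by (simp add: bexI[of _ j] not_le)
    moreover have "z \<in> ?A" using wnd_scaled(2)[OF assms w] z by simp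
    ultimately show "z \<in> ?A - ?B" by blast
  qed
  then have "GP.prob {z \<in> space (gaussP I). wnd 2 (Zt b s c \<omega> z)} \<le> GP.prob (?A - ?B)"
    by (intro GP.finite_measure_mono sets.Diff G_set)
  also have "\<dots> = PG (\<lambda>j. ?b j + ?\<eta>) - PG ?b"
    unfolding PG_def by (rule GP.finite_measure_Diff[OF G_set G_set sub])
  also have "\<dots> \<le> 45 * sqrt L * ?\<eta> / \<sigma>" by (rule PG_diff[OF \<eta>0])
  finally show ?thesis unfolding \<Lambda>_eq .
qed

text \<open>The event is contained in a difference of two orthant events for \<open>W\<close>. Each
  of them is exchanged for its Gaussian counterpart at the price \<open>\<rho>\<close>, and this is
  how the unknown distance enters its own bound.\<close>

lemma wnd_prob_w:
  assumes "s \<ge> 2/3" and \<rho>: "\<And>b. \<bar>PW b - PG b\<bar> \<le> \<rho>"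
  shows "prob {\<omega> \<in> space M. wnd 2 (Zt b s c \<omega> z)} \<le> 2 * \<rho> + 945/2 * \<Lambda>"
proof -
  let ?b = "\<lambda>j. (- 3 / \<beta> - (c * G z j - b j)) / s" and ?\<eta> = "21/2 * L / \<beta>"
  let ?A = "{\<omega> \<in> space M. \<forall>j\<in>V. W \<omega> j \<le> ?b j + ?\<eta>}" and ?B = "{\<omega> \<in> space M. \<forall>j\<in>V. W \<omega> j \<le> ?b j}"
  have sub: "?B \<subseteq> ?A" using \<eta>0 by (auto intro: add_increasing2)
  have Z: "Zt b s c \<omega> z = (\<lambda>j. s * W \<omega> j + (c * G z j - b j))" for \<omega>
    by (simp add: Zt_def fun_eq_iff)
  have "{\<omega> \<in> space M. wnd 2 (Zt b s c \<omega> z)} \<subseteq> ?A - ?B"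
  proof (rule subsetI)
    fix \<omega> assume \<omega>: "\<omega> \<in> {\<omega> \<in> space M. wnd 2 (Zt b s c \<omega> z)}"
    then have w: "wnd 2 (\<lambda>j. s * W \<omega> j + (c * G z j - b j))" unfolding Z by simp
    obtain j where "j \<in> V" "?b j < W \<omega> j" using wnd_scaled(1)[OF assms(1) w] by blast
    then have "\<omega> \<notin> ?B" by (simp add: bexI[of _ j] not_le)
    moreover have "\<omega> \<in> ?A" using wnd_scaled(2)[OF assms(1) w] \<omega> by simp
    ultimately show "\<omega> \<in> ?A - ?B" by blast
  qed
  then have "prob {\<omega> \<in> space M. wnd 2 (Zt b s c \<omega> z)} \<le> prob (?A - ?B)"
    by (intro finite_measure_mono sets.Diff W_set)
  also have "\<dots> = PW (\<lambda>j. ?b j + ?\<eta>) - PW ?b"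
    unfolding PW_def by (rule finite_measure_Diff[OF W_set W_set sub])
  also have "\<dots> \<le> 2 * \<rho> + (PG (\<lambda>j. ?b j + ?\<eta>) - PG ?b)"
    using \<rho>[of ?b] \<rho>[of "\<lambda>j. ?b j + ?\<eta>"] by linarith
  also have "PG (\<lambda>j. ?b j + ?\<eta>) - PG ?b \<le> 45 * sqrt L * ?\<eta> / \<sigma>" by (rule PG_diff[OF \<eta>0])
  finally show ?thesis unfolding \<Lambda>_eq by simp
qed

definition wP :: "('b \<Rightarrow> real) \<Rightarrow> real \<Rightarrow> real \<Rightarrow> real" where
  "wP b s c = (\<integral>w. of_bool (wnd 2 (Zt b s c (fst w) (snd w))) \<partial>PP)"

lemma prob_space_PP: "prob_space PP"
  unfolding PP_def by (rule MG.P.prob_space_axioms)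

lemma integrable_PP_bounded:
  fixes f :: "_ \<Rightarrow> real"
  assumes "f \<in> borel_measurable PP" "\<And>w. \<bar>f w\<bar> \<le> C" shows "integrable PP f"
proof (rule finite_measure.integrable_const_bound)
  show "finite_measure PP" using prob_space_PP by (rule prob_space.finite_measure)
  show "AE w in PP. norm (f w) \<le> C" by (rule AE_I2) (simp add: assms(2))
qed (rule assms(1))

lemma wnd_of_bool_int: "integrable PP (\<lambda>w. of_bool (wnd 2 (Zt b s c (fst w) (snd w))) :: real)"
proof (rule integrable_PP_bounded[of _ 1])
  have "Measurable.pred PP (\<lambda>w. wnd 2 (Zt b s c (fst w) (snd w)))" by (rule smooth_meas_P)
  then show "(\<lambda>w. of_bool (wnd 2 (Zt b s c (fst w) (snd w))) :: real) \<in> borel_measurable PP"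
    by (rule measurable_compose) simp
qed simp

text \<open>Both orders of integration are provided, since \<open>wP_bound\<close> conditions on one
  component when the coefficient of the other is at least 2/3.\<close>

lemma wP_z: "wP b s c = (\<integral>z. prob {\<omega> \<in> space M. wnd 2 (Zt b s c \<omega> z)} \<partial>gaussP I)"
  and wP_z_int: "integrable (gaussP I) (\<lambda>z. prob {\<omega> \<in> space M. wnd 2 (Zt b s c \<omega> z)})"
proof -
  have i: "integrable (M \<Otimes>\<^sub>M gaussP I) (\<lambda>(\<omega>, z). of_bool (wnd 2 (Zt b s c \<omega> z)) :: real)"
    using wnd_of_bool_int[of b s c] by (simp add: PP_def split_beta')
  have e: "prob {\<omega> \<in> space M. wnd 2 (Zt b s c \<omega> z)} = (\<integral>\<omega>. of_bool (wnd 2 (Zt b s c \<omega> z)) \<partial>M)" for z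
    by (rule expectation_of_bool[symmetric]) (rule smooth_meas_w)
  show "wP b s c = (\<integral>z. prob {\<omega> \<in> space M. wnd 2 (Zt b s c \<omega> z)} \<partial>gaussP I)"
    unfolding e wP_def PP_def using MG.integral_snd[OF i] by (simp add: split_beta')
  show "integrable (gaussP I) (\<lambda>z. prob {\<omega> \<in> space M. wnd 2 (Zt b s c \<omega> z)})"
    unfolding e by (rule MG.integrable_snd[OF i])
qed

lemma wP_w: "wP b s c = (\<integral>\<omega>. measure (gaussP I) {z \<in> space (gaussP I). wnd 2 (Zt b s c \<omega> z)} \<partial>M)"
  and wP_w_int: "integrable M (\<lambda>\<omega>. measure (gaussP I) {z \<in> space (gaussP I). wnd 2 (Zt b s c \<omega> z)})"
proof -
  have i: "integrable (M \<Otimes>\<^sub>M gaussP I) (\<lambda>(\<omega>, z). of_bool (wnd 2 (Zt b s c \<omega> z)) :: real)"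
    using wnd_of_bool_int[of b s c] by (simp add: PP_def split_beta')
  have e: "GP.prob {z \<in> space (gaussP I). wnd 2 (Zt b s c \<omega> z)} = (\<integral>z. of_bool (wnd 2 (Zt b s c \<omega> z)) \<partial>gaussP I)" for \<omega>
    by (rule GP.expectation_of_bool[symmetric]) (rule smooth_meas_z)
  show "wP b s c = (\<integral>\<omega>. measure (gaussP I) {z \<in> space (gaussP I). wnd 2 (Zt b s c \<omega> z)} \<partial>M)"
    unfolding e wP_def PP_def using MG.integral_fst[OF i] by (simp add: split_beta')
  show "integrable M (\<lambda>\<omega>. measure (gaussP I) {z \<in> space (gaussP I). wnd 2 (Zt b s c \<omega> z)})"
    unfolding e by (rule MG.integrable_fst[OF i])
qed

text \<open>
  If \<open>s \<ge> 2/3\<close>, condition on the Gaussian part and compare \<open>W\<close> with \<open>G\<close>; otherwise \<open>c \<ge> 2/3\<close>, and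
  the anti-concentration of \<open>G\<close> applies after conditioning on \<open>W\<close>.
\<close>

lemma wP_bound:
  assumes sc: "s\<^sup>2 + c\<^sup>2 = 1" "s \<ge> 0" "c \<ge> 0" and \<rho>: "\<And>b. \<bar>PW b - PG b\<bar> \<le> \<rho>"
  shows "wP b s c \<le> 2 * \<rho> + 945/2 * \<Lambda>"
proof (cases "c \<ge> 2/3")
  case True
  have \<rho>0: "\<rho> \<ge> 0" using \<rho>[of b] by linarith
  have "wP b s c \<le> (\<integral>\<omega>. 945/2 * \<Lambda> \<partial>M)"
    unfolding wP_w by (intro integral_mono wP_w_int wnd_prob_z True) simp
  also have "\<dots> = 945/2 * \<Lambda>" by (simp add: prob_space)
  finally show ?thesis using \<rho>0 by simp
next
  case False
  have "s \<ge> 2/3"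
  proof (rule ccontr)
    assume "\<not> s \<ge> 2/3"
    then have "s\<^sup>2 \<le> (2/3)\<^sup>2" "c\<^sup>2 \<le> (2/3)\<^sup>2" using False sc by (intro power_mono; simp)+
    with sc(1) show False by (simp add: power2_eq_square)
  qed
  then have "wP b s c \<le> (\<integral>z. 2 * \<rho> + 945/2 * \<Lambda> \<partial>gaussP I)"
    unfolding wP_z by (intro integral_mono wP_z_int wnd_prob_w \<rho>) simp
  also have "\<dots> = 2 * \<rho> + 945/2 * \<Lambda>" by (simp add: GP.prob_space)
  finally show ?thesis .
qed

section \<open>The derivative along the path\<close>

lemma D1W_int: "j \<in> V \<Longrightarrow> integrable PP (\<lambda>w. D1 (Zt b s c (fst w) (snd w)) j * W (fst w) j)"
proof -
  assume j: "j \<in> V"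
  show ?thesis
  proof (rule Bochner_Integration.integrable_bound[OF integrable_mult_right[OF WP_int[OF j], of "300 * \<beta>"]])
    show "(\<lambda>w. D1 (Zt b s c (fst w) (snd w)) j * W (fst w) j) \<in> borel_measurable PP"
      using WP_int[OF j] by (intro borel_measurable_times smooth_meas_P(2) j) simp
    show "AE w in PP. norm (D1 (Zt b s c (fst w) (snd w)) j * W (fst w) j) \<le> norm (300 * \<beta> * W (fst w) j)"
      using D1_bound[OF j] \<beta>_pos by (intro AE_I2) (simp add: abs_mult mult_right_mono)
  qed
qed

lemma D1G_int: "j \<in> V \<Longrightarrow> integrable PP (\<lambda>w. D1 (Zt b s c (fst w) (snd w)) j * G (snd w) j)"
proof -
  assume j: "j \<in> V"
  show ?thesis
  proof (rule Bochner_Integration.integrable_bound[OF integrable_mult_right[OF GP_int, of "300 * \<beta>"]])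
    show "(\<lambda>w. D1 (Zt b s c (fst w) (snd w)) j * G (snd w) j) \<in> borel_measurable PP"
      using GP_int[of j] by (intro borel_measurable_times smooth_meas_P(2) j) simp
    show "AE w in PP. norm (D1 (Zt b s c (fst w) (snd w)) j * G (snd w) j) \<le> norm (300 * \<beta> * G (snd w) j)"
      using D1_bound[OF j] \<beta>_pos by (intro AE_I2) (simp add: abs_mult mult_right_mono)
  qed
qed

lemma D2_int: "j \<in> V \<Longrightarrow> k \<in> V \<Longrightarrow> integrable PP (\<lambda>w. D2 (Zt b s c (fst w) (snd w)) j k)"
  by (rule integrable_PP_bounded[of _ "600 * \<beta>^2"], rule smooth_meas_P(3), assumption+, rule D2_bound)

definition QD :: "('b \<Rightarrow> real) \<Rightarrow> real \<Rightarrow> real \<Rightarrow> real" where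
  "QD b s c = (\<Sum>j\<in>V. \<Sum>k\<in>V. Xi j k * (\<integral>w. D2 (Zt b s c (fst w) (snd w)) j k \<partial>PP))"

text \<open>For a fixed Gaussian vector, \<open>c * G z j - b j\<close> is a deterministic base
  point, so \<open>stein_bound\<close> applies conditionally. Integrating over \<open>z\<close> uses
  that the two components are independent in the product space.\<close>

lemma stein_part:
  assumes s: "0 \<le> s" "s \<le> 1"
  shows "\<bar>(\<integral>w. (\<Sum>j\<in>V. D1 (Zt b s c (fst w) (snd w)) j * W (fst w) j) \<partial>PP) - s * QD b s c\<bar> \<le> KK * (wP b s c + err)"
proof -
  let ?f = "\<lambda>\<omega> z. \<Sum>j\<in>V. D1 (Zt b s c \<omega> z) j * W \<omega> j"
  have iz: "integrable PP (\<lambda>w. ?f (fst w) (snd w))" by (intro Bochner_Integration.integrable_sum D1W_int)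
  then have i: "integrable (M \<Otimes>\<^sub>M gaussP I) (\<lambda>(\<omega>, z). ?f \<omega> z)" by (simp add: PP_def split_beta')
  have i2: "integrable (M \<Otimes>\<^sub>M gaussP I) (\<lambda>(\<omega>, z). D2 (Zt b s c \<omega> z) j k)" if "j \<in> V" "k \<in> V" for j k
    using D2_int[OF that, of b s c] by (simp add: PP_def split_beta')
  define A where "A z = (\<integral>\<omega>. ?f \<omega> z \<partial>M)" for z
  define E where "E j k z = (\<integral>\<omega>. D2 (Zt b s c \<omega> z) j k \<partial>M)" for j k z
  have A: "integrable (gaussP I) A" "(\<integral>z. A z \<partial>gaussP I) = (\<integral>w. ?f (fst w) (snd w) \<partial>PP)"
    unfolding A_def PP_def using MG.integrable_snd[OF i] MG.integral_snd[OF i] by (simp_all add: split_beta')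
  have E: "integrable (gaussP I) (E j k)" "(\<integral>z. E j k z \<partial>gaussP I) = (\<integral>w. D2 (Zt b s c (fst w) (snd w)) j k \<partial>PP)"
    if "j \<in> V" "k \<in> V" for j k
    unfolding E_def PP_def using MG.integrable_snd[OF i2[OF that]] MG.integral_snd[OF i2[OF that]] by (simp_all add: split_beta')
  define R where "R z = A z - s * (\<Sum>j\<in>V. \<Sum>k\<in>V. Xi j k * E j k z)" for z
  have Ri: "integrable (gaussP I) R" unfolding R_def
    by (intro Bochner_Integration.integrable_diff A integrable_mult_right Bochner_Integration.integrable_sum E)
  have "(\<integral>z. (\<Sum>j\<in>V. \<Sum>k\<in>V. Xi j k * E j k z) \<partial>gaussP I) = QD b s c"
  proof -
    have "(\<integral>z. (\<Sum>j\<in>V. \<Sum>k\<in>V. Xi j k * E j k z) \<partial>gaussP I) = (\<Sum>j\<in>V. \<integral>z. (\<Sum>k\<in>V. Xi j k * E j k z) \<partial>gaussP I)"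
      by (intro Bochner_Integration.integral_sum Bochner_Integration.integrable_sum integrable_mult_right E)
    also have "\<dots> = (\<Sum>j\<in>V. \<Sum>k\<in>V. \<integral>z. Xi j k * E j k z \<partial>gaussP I)"
      by (intro sum.cong refl Bochner_Integration.integral_sum integrable_mult_right E)
    also have "\<dots> = QD b s c" unfolding QD_def by (intro sum.cong refl) (simp add: E)
    finally show ?thesis .
  qed
  then have "(\<integral>z. R z \<partial>gaussP I) = (\<integral>w. ?f (fst w) (snd w) \<partial>PP) - s * QD b s c"
    unfolding R_def A(2)[symmetric]
    by (subst Bochner_Integration.integral_diff)
      (auto intro!: A integrable_mult_right Bochner_Integration.integrable_sum E)
  moreover have "\<bar>\<integral>z. R z \<partial>gaussP I\<bar> \<le> (\<integral>z. \<bar>R z\<bar> \<partial>gaussP I)" by (rule integral_abs_bound)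
  moreover have "(\<integral>z. \<bar>R z\<bar> \<partial>gaussP I) \<le> (\<integral>z. KK * (prob {\<omega> \<in> space M. wnd 2 (Zt b s c \<omega> z)} + err) \<partial>gaussP I)"
  proof (intro integral_mono integrable_abs Ri integrable_mult_right Bochner_Integration.integrable_add wP_z_int)
    fix z
    interpret S: dep_shift M V \<beta> L Y n nb B d1 d2 "\<lambda>j. c * G z j - b j" s
      by unfold_locales (fact s)+
    have Z: "S.Z = (\<lambda>\<omega>. Zt b s c \<omega> z)"
      by (intro ext) (simp add: S.Z_eq Zt_def)
    show "\<bar>R z\<bar> \<le> KK * (prob {\<omega> \<in> space M. wnd 2 (Zt b s c \<omega> z)} + err)"
      using S.stein_bound unfolding Z R_def A_def E_def KK_def err_def S.\<tau>_def .
  qed simp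
  moreover have "(\<integral>z. KK * (prob {\<omega> \<in> space M. wnd 2 (Zt b s c \<omega> z)} + err) \<partial>gaussP I) = KK * (wP b s c + err)"
    unfolding wP_z using wP_z_int[of b s c] by (simp add: GP.prob_space)
  ultimately show ?thesis by linarith
qed

lemma G_upd: "l \<in> I \<Longrightarrow> ((\<lambda>x. G (z(l := x)) j) has_real_derivative lr j l) (at x)"
proof -
  assume l: "l \<in> I"
  have "G (z(l := x)) j = lr j l * x + (\<Sum>i\<in>I - {l}. lr j i * z i)" for x
    unfolding G_def using l fin_I by (subst sum.remove[of _ l]) auto
  then show ?thesis by (auto intro!: derivative_eq_intros)
qed

text \<open>Integration by parts in each standard coordinate \<open>l\<close> brings out
  \<open>c * lr k l\<close>, and the sum over \<open>l\<close> reassembles \<open>Xi\<close>. Unlike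
  the Stein expansion, this leaves no remainder.\<close>

lemma gauss_part_z:
  "(\<integral>z. (\<Sum>j\<in>V. D1 (Zt b s c \<omega> z) j * G z j) \<partial>gaussP I) =
     c * (\<Sum>j\<in>V. \<Sum>k\<in>V. Xi j k * (\<integral>z. D2 (Zt b s c \<omega> z) j k \<partial>gaussP I))"
proof -
  define g where "g l z = (\<Sum>j\<in>V. lr j l * D1 (Zt b s c \<omega> z) j)" for l z
  define g' where "g' l z = (\<Sum>j\<in>V. lr j l * (\<Sum>k\<in>V. D2 (Zt b s c \<omega> z) j k * (c * lr k l)))" for l z
  have d2i: "integrable (gaussP I) (\<lambda>z. D2 (Zt b s c \<omega> z) j k)" if "j \<in> V" "k \<in> V" for j k
    by (rule GP.integrable_const_bound[of _ "600 * \<beta>^2"], rule AE_I2, unfold real_norm_def, rule D2_bound[OF that],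
      rule smooth_meas_z(3)[OF that])
  have gm: "g l \<in> borel_measurable (gaussP I)" for l
    unfolding g_def by (intro borel_measurable_sum borel_measurable_times borel_measurable_const smooth_meas_z)
  have g'm: "g' l \<in> borel_measurable (gaussP I)" for l
    unfolding g'_def by (intro borel_measurable_sum borel_measurable_times borel_measurable_const smooth_meas_z)
  have dZ: "((\<lambda>x. Zt b s c \<omega> (z(l := x)) k) has_real_derivative c * lr k l) (at x)" if "l \<in> I" for l z k x
    unfolding Zt_def by (rule DERIV_cong[OF DERIV_diff[OF DERIV_add[OF DERIV_const DERIV_cmult[OF G_upd[OF that]]] DERIV_const]]) simp
  have gb: "\<bar>g l z\<bar> \<le> (\<Sum>j\<in>V. \<bar>lr j l\<bar> * (300 * \<beta>))" for l z
    unfolding g_def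
    by (rule order.trans[OF sum_abs sum_mono]) (simp only: abs_mult, intro mult_left_mono D1_bound abs_ge_zero)
  have g'b: "\<bar>g' l z\<bar> \<le> (\<Sum>j\<in>V. \<bar>lr j l\<bar> * (\<Sum>k\<in>V. 600 * \<beta>^2 * \<bar>c * lr k l\<bar>))" for l z
    unfolding g'_def
  proof (rule order.trans[OF sum_abs sum_mono])
    fix j assume j: "j \<in> V"
    have "\<bar>\<Sum>k\<in>V. D2 (Zt b s c \<omega> z) j k * (c * lr k l)\<bar> \<le> (\<Sum>k\<in>V. 600 * \<beta>^2 * \<bar>c * lr k l\<bar>)"
      by (rule order.trans[OF sum_abs sum_mono], subst abs_mult, intro mult_right_mono D2_bound j abs_ge_zero)
    then show "\<bar>lr j l * (\<Sum>k\<in>V. D2 (Zt b s c \<omega> z) j k * (c * lr k l))\<bar> \<le> \<bar>lr j l\<bar> * (\<Sum>k\<in>V. 600 * \<beta>^2 * \<bar>c * lr k l\<bar>)"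
      unfolding abs_mult[of "lr j l"] by (rule mult_left_mono) simp
  qed
  have st: "(\<integral>z. z l * g l z \<partial>gaussP I) = (\<integral>z. g' l z \<partial>gaussP I)" if l: "l \<in> I" for l
  proof (rule gauss_stein[OF fin_I l gm g'm])
    show "((\<lambda>x. g l (z(l := x))) has_real_derivative g' l (z(l := x))) (at x)" for z x
      unfolding g_def g'_def by (intro DERIV_sum DERIV_cmult DERIV_D1 dZ l)
    show "isCont (\<lambda>x. g' l (z(l := x))) x" for z x
      unfolding g'_def by (intro continuous_intros DERIV_isCont[OF DERIV_D2[where x' = "\<lambda>k. c * lr k l"]] dZ l)
    let ?C = "max (\<Sum>j\<in>V. \<bar>lr j l\<bar> * (300 * \<beta>)) (\<Sum>j\<in>V. \<bar>lr j l\<bar> * (\<Sum>k\<in>V. 600 * \<beta>^2 * \<bar>c * lr k l\<bar>))"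
    show "\<bar>g l z\<bar> \<le> ?C" for z using gb[of l z] by simp
    show "\<bar>g' l z\<bar> \<le> ?C" for z using g'b[of l z] by simp
  qed
  have gi: "integrable (gaussP I) (\<lambda>z. z l * g l z)" if l: "l \<in> I" for l
  proof (rule Bochner_Integration.integrable_bound[OF integrable_mult_left[OF integrable_gaussP_component[OF fin_I l], of "\<Sum>j\<in>V. \<bar>lr j l\<bar> * (300 * \<beta>)"]])
    show "(\<lambda>z. z l * g l z) \<in> borel_measurable (gaussP I)"
      using integrable_gaussP_component[OF fin_I l] by (intro borel_measurable_times gm) simp
    show "AE z in gaussP I. norm (z l * g l z) \<le> norm (z l * (\<Sum>j\<in>V. \<bar>lr j l\<bar> * (300 * \<beta>)))"
    proof (rule AE_I2)
      fix z
      have "\<bar>g l z\<bar> \<le> \<bar>\<Sum>j\<in>V. \<bar>lr j l\<bar> * (300 * \<beta>)\<bar>" using gb[of l z] by linarith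
      then show "norm (z l * g l z) \<le> norm (z l * (\<Sum>j\<in>V. \<bar>lr j l\<bar> * (300 * \<beta>)))"
        unfolding real_norm_def abs_mult[of "z l"] by (rule mult_left_mono) simp
    qed
  qed
  have "(\<Sum>j\<in>V. D1 (Zt b s c \<omega> z) j * G z j) = (\<Sum>l\<in>I. z l * g l z)" for z
  proof -
    have "(\<Sum>j\<in>V. D1 (Zt b s c \<omega> z) j * G z j) = (\<Sum>j\<in>V. \<Sum>l\<in>I. z l * (lr j l * D1 (Zt b s c \<omega> z) j))"
      unfolding G_def sum_distrib_left by (intro sum.cong refl) simp
    also have "\<dots> = (\<Sum>l\<in>I. \<Sum>j\<in>V. z l * (lr j l * D1 (Zt b s c \<omega> z) j))" by (rule sum.swap)
    finally show ?thesis unfolding g_def sum_distrib_left .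
  qed
  then have "(\<integral>z. (\<Sum>j\<in>V. D1 (Zt b s c \<omega> z) j * G z j) \<partial>gaussP I) = (\<integral>z. (\<Sum>l\<in>I. z l * g l z) \<partial>gaussP I)" by simp
  also have "\<dots> = (\<Sum>l\<in>I. \<integral>z. g' l z \<partial>gaussP I)"
    by (subst Bochner_Integration.integral_sum, rule gi, assumption, intro sum.cong refl st)
  also have "\<dots> = (\<Sum>l\<in>I. \<Sum>j\<in>V. \<Sum>k\<in>V. c * ((lr j l * lr k l) * (\<integral>z. D2 (Zt b s c \<omega> z) j k \<partial>gaussP I)))"
  proof (intro sum.cong refl)
    fix l
    have "(\<integral>z. g' l z \<partial>gaussP I) = (\<integral>z. (\<Sum>j\<in>V. \<Sum>k\<in>V. (c * (lr j l * lr k l)) * D2 (Zt b s c \<omega> z) j k) \<partial>gaussP I)"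
      unfolding g'_def sum_distrib_left by (intro Bochner_Integration.integral_cong sum.cong refl) simp
    also have "\<dots> = (\<Sum>j\<in>V. \<integral>z. (\<Sum>k\<in>V. (c * (lr j l * lr k l)) * D2 (Zt b s c \<omega> z) j k) \<partial>gaussP I)"
      by (intro Bochner_Integration.integral_sum Bochner_Integration.integrable_sum integrable_mult_right d2i)
    also have "\<dots> = (\<Sum>j\<in>V. \<Sum>k\<in>V. \<integral>z. (c * (lr j l * lr k l)) * D2 (Zt b s c \<omega> z) j k \<partial>gaussP I)"
      by (intro sum.cong refl Bochner_Integration.integral_sum integrable_mult_right d2i)
    also have "\<dots> = (\<Sum>j\<in>V. \<Sum>k\<in>V. c * ((lr j l * lr k l) * (\<integral>z. D2 (Zt b s c \<omega> z) j k \<partial>gaussP I)))"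
      by (simp add: mult.assoc)
    finally show "(\<integral>z. g' l z \<partial>gaussP I) = \<dots>" .
  qed
  also have "\<dots> = (\<Sum>j\<in>V. \<Sum>k\<in>V. \<Sum>l\<in>I. c * ((lr j l * lr k l) * (\<integral>z. D2 (Zt b s c \<omega> z) j k \<partial>gaussP I)))"
    unfolding sum.swap[of _ V I] ..
  also have "\<dots> = c * (\<Sum>j\<in>V. \<Sum>k\<in>V. Xi j k * (\<integral>z. D2 (Zt b s c \<omega> z) j k \<partial>gaussP I))"
    unfolding sum_distrib_left by (intro sum.cong refl) (simp add: lr_cov sum_distrib_left sum_distrib_right)
  finally show ?thesis .
qed

lemma gauss_part:
  "(\<integral>w. (\<Sum>j\<in>V. D1 (Zt b s c (fst w) (snd w)) j * G (snd w) j) \<partial>PP) = c * QD b s c"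
proof -
  let ?f = "\<lambda>\<omega> z. \<Sum>j\<in>V. D1 (Zt b s c \<omega> z) j * G z j"
  have "integrable PP (\<lambda>w. ?f (fst w) (snd w))" by (intro Bochner_Integration.integrable_sum D1G_int)
  then have i: "integrable (M \<Otimes>\<^sub>M gaussP I) (\<lambda>(\<omega>, z). ?f \<omega> z)" by (simp add: PP_def split_beta')
  have i2: "integrable (M \<Otimes>\<^sub>M gaussP I) (\<lambda>(\<omega>, z). D2 (Zt b s c \<omega> z) j k)" if "j \<in> V" "k \<in> V" for j k
    using D2_int[OF that, of b s c] by (simp add: PP_def split_beta')
  define E where "E j k \<omega> = (\<integral>z. D2 (Zt b s c \<omega> z) j k \<partial>gaussP I)" for j k \<omega>
  have E: "integrable M (E j k)" "(\<integral>\<omega>. E j k \<omega> \<partial>M) = (\<integral>w. D2 (Zt b s c (fst w) (snd w)) j k \<partial>PP)"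
    if "j \<in> V" "k \<in> V" for j k
    unfolding E_def PP_def using MG.integrable_fst[OF i2[OF that]] MG.integral_fst[OF i2[OF that]] by (simp_all add: split_beta')
  have "(\<integral>w. ?f (fst w) (snd w) \<partial>PP) = (\<integral>\<omega>. (\<integral>z. ?f \<omega> z \<partial>gaussP I) \<partial>M)"
    unfolding PP_def using MG.integral_fst[OF i] by (simp add: split_beta')
  also have "\<dots> = (\<integral>\<omega>. c * (\<Sum>j\<in>V. \<Sum>k\<in>V. Xi j k * E j k \<omega>) \<partial>M)"
    unfolding gauss_part_z E_def ..
  also have "\<dots> = c * (\<integral>\<omega>. (\<Sum>j\<in>V. \<Sum>k\<in>V. Xi j k * E j k \<omega>) \<partial>M)" by simp
  also have "(\<integral>\<omega>. (\<Sum>j\<in>V. \<Sum>k\<in>V. Xi j k * E j k \<omega>) \<partial>M) = (\<Sum>j\<in>V. \<integral>\<omega>. (\<Sum>k\<in>V. Xi j k * E j k \<omega>) \<partial>M)"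
    by (intro Bochner_Integration.integral_sum Bochner_Integration.integrable_sum integrable_mult_right E)
  also have "\<dots> = (\<Sum>j\<in>V. \<Sum>k\<in>V. \<integral>\<omega>. Xi j k * E j k \<omega> \<partial>M)"
    by (intro sum.cong refl Bochner_Integration.integral_sum integrable_mult_right E)
  also have "\<dots> = QD b s c" unfolding QD_def by (intro sum.cong refl) (simp add: E)
  finally show ?thesis .
qed

definition H :: "('b \<Rightarrow> real) \<Rightarrow> real \<Rightarrow> real" where
  "H b \<theta> = (\<integral>w. F (Zt b (sin \<theta>) (cos \<theta>) (fst w) (snd w)) \<partial>PP)"

lemma F_abs: "\<bar>F x\<bar> \<le> 1"
  using F_range[of x] by linarith

lemma F_int: "integrable PP (\<lambda>w. F (Zt b s c (fst w) (snd w)))"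
  by (rule integrable_PP_bounded[of _ 1], rule smooth_meas_P, rule F_abs)

text \<open>The Gaussian half of the derivative is \<open>- sin \<theta> * cos \<theta>\<close>
  times \<open>QD\<close>. Taking out \<open>cos \<theta>\<close> leaves precisely the difference
  that \<open>stein_part\<close> bounds; the choice of sine and cosine serves this
  cancellation.\<close>

lemma H_deriv:
  "(H b has_real_derivative cos \<theta> * ((\<integral>w. (\<Sum>j\<in>V. D1 (Zt b (sin \<theta>) (cos \<theta>) (fst w) (snd w)) j * W (fst w) j) \<partial>PP)
     - sin \<theta> * QD b (sin \<theta>) (cos \<theta>))) (at \<theta>)"
proof -
  let ?Z = "\<lambda>\<theta> w. Zt b (sin \<theta>) (cos \<theta>) (fst w) (snd w)"
  let ?f' = "\<lambda>\<theta> w. \<Sum>j\<in>V. D1 (?Z \<theta> w) j * (cos \<theta> * W (fst w) j - sin \<theta> * G (snd w) j)"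
  let ?h = "\<lambda>w. \<Sum>j\<in>V. 300 * \<beta> * (\<bar>W (fst w) j\<bar> + \<bar>G (snd w) j\<bar>)"
  have split: "?f' \<theta> w = cos \<theta> * (\<Sum>j\<in>V. D1 (?Z \<theta> w) j * W (fst w) j) - sin \<theta> * (\<Sum>j\<in>V. D1 (?Z \<theta> w) j * G (snd w) j)" for \<theta> w
    unfolding sum_distrib_left sum_subtractf[symmetric] by (intro sum.cong refl) (simp add: algebra_simps)
  have i1: "integrable PP (\<lambda>w. \<Sum>j\<in>V. D1 (?Z \<theta> w) j * W (fst w) j)" for \<theta>
    by (intro Bochner_Integration.integrable_sum D1W_int)
  have i2: "integrable PP (\<lambda>w. \<Sum>j\<in>V. D1 (?Z \<theta> w) j * G (snd w) j)" for \<theta>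
    by (intro Bochner_Integration.integrable_sum D1G_int)
  have "((\<lambda>\<theta>. \<integral>w. F (?Z \<theta> w) \<partial>PP) has_real_derivative (\<integral>w. ?f' \<theta> w \<partial>PP)) (at \<theta>)"
  proof (rule DERIV_integral[where h = ?h])
    show "integrable PP (\<lambda>w. F (?Z \<theta> w))" for \<theta> by (rule F_int)
    show "((\<lambda>\<theta>. F (?Z \<theta> w)) has_real_derivative ?f' \<theta> w) (at \<theta>)" for \<theta> w
    proof (rule DERIV_F)
      fix j
      show "((\<lambda>\<theta>. ?Z \<theta> w j) has_real_derivative cos \<theta> * W (fst w) j - sin \<theta> * G (snd w) j) (at \<theta>)"
        unfolding Zt_def by (auto intro!: derivative_eq_intros)
    qed
    show "\<bar>?f' \<theta> w\<bar> \<le> ?h w" for \<theta> w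
    proof (rule order.trans[OF sum_abs sum_mono])
      fix j assume j: "j \<in> V"
      have "\<bar>cos \<theta> * W (fst w) j - sin \<theta> * G (snd w) j\<bar> \<le> \<bar>cos \<theta> * W (fst w) j\<bar> + \<bar>sin \<theta> * G (snd w) j\<bar>"
        by (rule abs_triangle_ineq4)
      also have "\<dots> \<le> 1 * \<bar>W (fst w) j\<bar> + 1 * \<bar>G (snd w) j\<bar>"
        unfolding abs_mult by (intro add_mono mult_right_mono) auto
      finally show "\<bar>D1 (?Z \<theta> w) j * (cos \<theta> * W (fst w) j - sin \<theta> * G (snd w) j)\<bar> \<le> 300 * \<beta> * (\<bar>W (fst w) j\<bar> + \<bar>G (snd w) j\<bar>)"
        unfolding abs_mult[of "D1 _ _"] using D1_bound[OF j] \<beta>_pos by (intro mult_mono) auto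
    qed
    show "integrable PP ?h"
      by (intro Bochner_Integration.integrable_sum integrable_mult_right Bochner_Integration.integrable_add integrable_abs WP_int GP_int)
    show "?f' \<theta> \<in> borel_measurable PP" for \<theta>
      unfolding split using i1[of \<theta>] i2[of \<theta>]
      by (intro borel_measurable_diff borel_measurable_times borel_measurable_const) auto
  qed
  also have "(\<integral>w. ?f' \<theta> w \<partial>PP) = cos \<theta> * (\<integral>w. (\<Sum>j\<in>V. D1 (?Z \<theta> w) j * W (fst w) j) \<partial>PP)
      - sin \<theta> * (\<integral>w. (\<Sum>j\<in>V. D1 (?Z \<theta> w) j * G (snd w) j) \<partial>PP)"
    unfolding split using i1[of \<theta>] i2[of \<theta>] by (subst Bochner_Integration.integral_diff) auto
  also have "\<dots> = cos \<theta> * ((\<integral>w. (\<Sum>j\<in>V. D1 (?Z \<theta> w) j * W (fst w) j) \<partial>PP) - sin \<theta> * QD b (sin \<theta>) (cos \<theta>))"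
    unfolding gauss_part by (simp add: algebra_simps)
  finally show ?thesis unfolding H_def[abs_def] .
qed

lemma KK_nonneg: "KK \<ge> 0"
proof -
  have "1 \<in> {1..n}" using n_ge by simp
  from card_nb2[OF this nb_self[OF this]] have "d2 \<ge> 0" by linarith
  then show ?thesis unfolding KK_def using d1_ge \<beta>_pos B_pos L_ge by simp
qed

lemma err_nonneg: "err \<ge> 0" unfolding err_def using d1_ge by simp

text \<open>The window is controlled at every angle, so the mean value theorem replaces an integral
  over the path. The factor 2 bounds \<open>pi / 2\<close>.\<close>

lemma H_bound:
  assumes \<rho>: "\<And>b. \<bar>PW b - PG b\<bar> \<le> \<rho>"
  shows "\<bar>H b (pi / 2) - H b 0\<bar> \<le> 2 * (KK * (2 * \<rho> + 945/2 * \<Lambda> + err))"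
proof -
  obtain \<theta> where \<theta>: "0 < \<theta>" "\<theta> < pi / 2" and
    e: "H b (pi / 2) - H b 0 = (pi / 2 - 0) * (cos \<theta> * ((\<integral>w. (\<Sum>j\<in>V. D1 (Zt b (sin \<theta>) (cos \<theta>) (fst w) (snd w)) j * W (fst w) j) \<partial>PP)
     - sin \<theta> * QD b (sin \<theta>) (cos \<theta>)))"
    using MVT2[of 0 "pi/2" "H b", OF _ H_deriv] by auto
  have sc: "0 \<le> sin \<theta>" "0 \<le> cos \<theta>" using \<theta> by (auto intro!: sin_ge_zero cos_ge_zero)
  let ?R = "(\<integral>w. (\<Sum>j\<in>V. D1 (Zt b (sin \<theta>) (cos \<theta>) (fst w) (snd w)) j * W (fst w) j) \<partial>PP) - sin \<theta> * QD b (sin \<theta>) (cos \<theta>)"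
  have "\<bar>?R\<bar> \<le> KK * (wP b (sin \<theta>) (cos \<theta>) + err)" by (rule stein_part) (use sc in auto)
  also have "\<dots> \<le> KK * (2 * \<rho> + 945/2 * \<Lambda> + err)"
    using KK_nonneg sc by (intro mult_left_mono add_mono wP_bound \<rho>) auto
  finally have R: "\<bar>?R\<bar> \<le> KK * (2 * \<rho> + 945/2 * \<Lambda> + err)" .
  have "\<bar>H b (pi / 2) - H b 0\<bar> = (pi / 2) * (cos \<theta> * \<bar>?R\<bar>)"
    unfolding e using sc by (simp add: abs_mult)
  also have "\<dots> \<le> 2 * (1 * \<bar>?R\<bar>)"
    using sc pi_less_4 by (intro mult_mono mult_right_mono) auto
  finally show ?thesis using R by simp
qed

lemma H_W: "H b (pi / 2) = expectation (\<lambda>\<omega>. F (\<lambda>j. W \<omega> j - b j))"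
proof -
  have i: "integrable (M \<Otimes>\<^sub>M gaussP I) (\<lambda>(\<omega>, z). F (Zt b 1 0 \<omega> z))"
    using F_int[of b 1 0] by (simp add: PP_def split_beta')
  have "H b (pi / 2) = (\<integral>\<omega>. (\<integral>z. F (Zt b 1 0 \<omega> z) \<partial>gaussP I) \<partial>M)"
    unfolding H_def PP_def using MG.integral_fst[OF i] by (simp add: split_beta')
  also have "\<dots> = expectation (\<lambda>\<omega>. F (\<lambda>j. W \<omega> j - b j))"
    by (simp add: Zt_def[abs_def] GP.prob_space)
  finally show ?thesis .
qed

lemma H_G: "H b 0 = (\<integral>z. F (\<lambda>j. G z j - b j) \<partial>gaussP I)"
proof -
  have i: "integrable (M \<Otimes>\<^sub>M gaussP I) (\<lambda>(\<omega>, z). F (Zt b 0 1 \<omega> z))"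
    using F_int[of b 0 1] by (simp add: PP_def split_beta')
  have "H b 0 = (\<integral>\<omega>. (\<integral>z. F (Zt b 0 1 \<omega> z) \<partial>gaussP I) \<partial>M)"
    unfolding H_def PP_def using MG.integral_fst[OF i] by (simp add: split_beta')
  also have "\<dots> = (\<integral>z. F (\<lambda>j. G z j - b j) \<partial>gaussP I)"
    by (simp add: Zt_def[abs_def] prob_space)
  finally show ?thesis .
qed

section \<open>From the smooth function back to orthants\<close>

lemma F_indicator:
  "of_bool (\<forall>j\<in>V. x j \<le> b j) \<le> F (\<lambda>j. x j - b j)"
  "F (\<lambda>j. x j - b j) \<le> of_bool (\<forall>j\<in>V. x j \<le> b j + 2 * L / \<beta>)"
proof -
  show "of_bool (\<forall>j\<in>V. x j \<le> b j) \<le> F (\<lambda>j. x j - b j)"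
    using F_eq_1[of "\<lambda>j. x j - b j"] F_range(1)[of "\<lambda>j. x j - b j"] by auto
  show "F (\<lambda>j. x j - b j) \<le> of_bool (\<forall>j\<in>V. x j \<le> b j + 2 * L / \<beta>)"
  proof (cases "\<forall>j\<in>V. x j \<le> b j + 2 * L / \<beta>")
    case False
    then obtain j where "j \<in> V" "x j - b j > 2 * L / \<beta>" by (auto simp: not_le algebra_simps)
    then show ?thesis using F_eq_0[of j "\<lambda>j. x j - b j"] by auto
  qed (use F_range in auto)
qed

lemma W_pred: "Measurable.pred M (\<lambda>\<omega>. \<forall>j\<in>V. W \<omega> j \<le> b j)"
  unfolding pred_def by (rule W_set)

lemma G_pred: "Measurable.pred (gaussP I) (\<lambda>z. \<forall>j\<in>V. G z j \<le> b j)"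
  unfolding pred_def by (rule G_set)

lemma PW_H: "PW b \<le> H b (pi / 2)" "H b (pi / 2) \<le> PW (\<lambda>j. b j + 2 * L / \<beta>)"
proof -
  have m: "(\<lambda>\<omega>. F (\<lambda>j. W \<omega> j - b j)) \<in> borel_measurable M"
  proof -
    have "Zt b 1 0 \<omega> undefined = (\<lambda>j. W \<omega> j - b j)" for \<omega> by (simp add: Zt_def fun_eq_iff)
    then show ?thesis using smooth_meas_w(1)[of b 1 0 undefined] by (simp only:)
  qed
  have i: "integrable M (\<lambda>\<omega>. F (\<lambda>j. W \<omega> j - b j))"
    by (rule integrable_const_bound[OF _ m, of 1], rule AE_I2, unfold real_norm_def, rule F_abs)
  have io: "integrable M (\<lambda>\<omega>. of_bool (\<forall>j\<in>V. W \<omega> j \<le> b j) :: real)" for b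
    by (rule integrable_const_bound[of _ 1], rule AE_I2, simp, rule measurable_compose[OF W_pred], simp)
  have e: "PW b = expectation (\<lambda>\<omega>. of_bool (\<forall>j\<in>V. W \<omega> j \<le> b j))" for b
    unfolding PW_def by (rule expectation_of_bool[symmetric, OF W_pred])
  show "PW b \<le> H b (pi / 2)" unfolding e H_W by (intro integral_mono io i F_indicator)
  show "H b (pi / 2) \<le> PW (\<lambda>j. b j + 2 * L / \<beta>)" unfolding e H_W by (intro integral_mono io i F_indicator)
qed

lemma PG_H: "PG b \<le> H b 0" "H b 0 \<le> PG (\<lambda>j. b j + 2 * L / \<beta>)"
proof -
  have m: "(\<lambda>z. F (\<lambda>j. G z j - b j)) \<in> borel_measurable (gaussP I)"
  proof -
    have "Zt b 0 1 undefined z = (\<lambda>j. G z j - b j)" for z by (simp add: Zt_def fun_eq_iff)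
    then show ?thesis using smooth_meas_z(1)[of b 0 1 undefined] by (simp only:)
  qed
  have i: "integrable (gaussP I) (\<lambda>z. F (\<lambda>j. G z j - b j))"
    by (rule GP.integrable_const_bound[OF _ m, of 1], rule AE_I2, unfold real_norm_def, rule F_abs)
  have io: "integrable (gaussP I) (\<lambda>z. of_bool (\<forall>j\<in>V. G z j \<le> b j) :: real)" for b
    by (rule GP.integrable_const_bound[of _ 1], rule AE_I2, simp, rule measurable_compose[OF G_pred], simp)
  have e: "PG b = (\<integral>z. of_bool (\<forall>j\<in>V. G z j \<le> b j) \<partial>gaussP I)" for b
    unfolding PG_def by (rule GP.expectation_of_bool[symmetric, OF G_pred])
  show "PG b \<le> H b 0" unfolding e H_G by (intro integral_mono io i F_indicator)
  show "H b 0 \<le> PG (\<lambda>j. b j + 2 * L / \<beta>)" unfolding e H_G by (intro integral_mono io i F_indicator)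
qed

text \<open>The supremum \<open>\<rho>\<close> is finite, so an inequality with
  \<open>\<rho>\<close> on both sides can be solved. The hypothesis brings its coefficient on the
  right down to 1/2, and 2 * (90 + 473/4) = 416.5 is rounded to 420.\<close>

theorem gaussian_approximation:
  assumes KK: "8 * KK \<le> 1"
  shows "\<bar>PW b - PG b\<bar> \<le> 420 * \<Lambda> + err"
proof -
  define \<rho> where "\<rho> = (SUP b. \<bar>PW b - PG b\<bar>)"
  have bdd: "bdd_above (range (\<lambda>b. \<bar>PW b - PG b\<bar>))"
  proof (rule bdd_aboveI2)
    fix b
    have "0 \<le> PW b" "PW b \<le> 1" "0 \<le> PG b" "PG b \<le> 1" unfolding PW_def PG_def by auto
    then show "\<bar>PW b - PG b\<bar> \<le> 1" by linarith
  qed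
  have \<rho>: "\<bar>PW b - PG b\<bar> \<le> \<rho>" for b unfolding \<rho>_def by (rule cSUP_upper[OF UNIV_I bdd])
  have \<rho>0: "\<rho> \<ge> 0" using \<rho>[of b] by linarith
  let ?\<delta> = "2 * L / \<beta>"
  have \<delta>0: "?\<delta> \<ge> 0" using L_ge \<beta>_pos by simp
  have \<delta>: "PG (\<lambda>j. b j + ?\<delta>) - PG b \<le> 90 * \<Lambda>" for b
    using PG_diff[OF \<delta>0, of b] by (simp add: \<Lambda>_def mult_ac)
  define R where "R = 2 * (KK * (2 * \<rho> + 945/2 * \<Lambda> + err))"
  have HB: "\<bar>H b (pi / 2) - H b 0\<bar> \<le> R" for b unfolding R_def by (rule H_bound[OF \<rho>])
  have "\<bar>PW b - PG b\<bar> \<le> 90 * \<Lambda> + R" for b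
  proof -
    let ?b = "\<lambda>j. b j - ?\<delta>"
    have "PW b - PG b \<le> 90 * \<Lambda> + R"
      using PW_H(1)[of b] HB[of b] PG_H(2)[of b] \<delta>[of b] by linarith
    \<comment> \<open>For this direction the thresholds are lowered by the width of the transition
      zone, so that the smooth function lies below the indicator of the given orthant.\<close>
    moreover have "PG b - PW b \<le> 90 * \<Lambda> + R"
      using PW_H(2)[of ?b] HB[of ?b] PG_H(1)[of ?b] \<delta>[of ?b] by simp
    ultimately show ?thesis by linarith
  qed
  then have "\<rho> \<le> 90 * \<Lambda> + R" unfolding \<rho>_def by (intro cSUP_least) auto
  moreover have "4 * R \<le> 2 * \<rho> + 473 * \<Lambda> + err"
  proof -
    have "4 * R = 8 * KK * (2 * \<rho> + 945/2 * \<Lambda> + err)" by (simp add: R_def)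
    also have "\<dots> \<le> 1 * (2 * \<rho> + 945/2 * \<Lambda> + err)"
      using KK \<rho>0 \<Lambda>_nonneg err_nonneg by (intro mult_right_mono) auto
    also have "\<dots> \<le> 2 * \<rho> + 473 * \<Lambda> + err" using \<Lambda>_nonneg by simp
    finally show ?thesis .
  qed
  ultimately have "\<rho> \<le> 420 * \<Lambda> + err" using \<Lambda>_nonneg err_nonneg by linarith
  then show ?thesis using \<rho>[of b] by linarith
qed

end

section \<open>Half-spaces and simple convex sets\<close>

context dep_field
begin

lemma Cyy_nonneighbour:
  assumes t: "t \<in> {1..n}" and s: "s \<in> {1..n}" "s \<notin> nb t" and j: "j \<in> V" and k: "k \<in> V"
  shows "Cyy t s j k = 0"
proof -
  define f where "f y = y t j" for y :: "nat \<Rightarrow> 'v \<Rightarrow> real"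
  define h where "h y = y s k" for y :: "nat \<Rightarrow> 'v \<Rightarrow> real"
  have fm: "f \<in> borel_measurable (\<Pi>\<^sub>M t\<in>{t}. \<Pi>\<^sub>M j\<in>V. borel)"
    unfolding f_def by (intro comp2_measurable j) auto
  have hm: "h \<in> borel_measurable (\<Pi>\<^sub>M t\<in>{s}. \<Pi>\<^sub>M j\<in>V. borel)"
    unfolding h_def by (intro comp2_measurable k) auto
  have f: "f (\<lambda>t\<in>{t}. Y t \<omega>) = Y t \<omega> j" for \<omega> by (simp add: f_def)
  have h: "h (\<lambda>t\<in>{s}. Y t \<omega>) = Y s \<omega> k" for \<omega> by (simp add: h_def)
  have "expectation (\<lambda>\<omega>. Y t \<omega> j * Y s \<omega> k) = expectation (\<lambda>\<omega>. Y t \<omega> j) * expectation (\<lambda>\<omega>. Y s \<omega> k)"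
    by (rule indep_factor[OF _ _ _ fm _ hm, unfolded f h])
      (use t s integrable_Y[OF t j] integrable_Y[OF s(1) k] in auto)
  then show ?thesis using mean0[OF t j] by (simp add: Cyy_def)
qed

text \<open>Non-adjacent variables are independent and centred, so the double sum reduces to
  neighbours. This links the covariance of the normal law to the one produced by the
  expansion.\<close>

lemma expectation_WW:
  assumes j: "j \<in> V" and k: "k \<in> V"
  shows "expectation (\<lambda>\<omega>. W \<omega> j * W \<omega> k) = Xi j k"
proof -
  have e: "W \<omega> j * W \<omega> k = (\<Sum>t\<in>{1..n}. \<Sum>s\<in>{1..n}. Y t \<omega> j * Y s \<omega> k) / n" for \<omega>
  proof -
    have "W \<omega> j * W \<omega> k = ((\<Sum>t\<in>{1..n}. Y t \<omega> j) * (\<Sum>s\<in>{1..n}. Y s \<omega> k)) / (sqrt n * sqrt n)"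
      by (simp add: W_def)
    then show ?thesis by (simp add: sum_product)
  qed
  have "expectation (\<lambda>\<omega>. W \<omega> j * W \<omega> k) = expectation (\<lambda>\<omega>. \<Sum>t\<in>{1..n}. \<Sum>s\<in>{1..n}. Y t \<omega> j * Y s \<omega> k) / n"
    unfolding e by simp
  also have "expectation (\<lambda>\<omega>. \<Sum>t\<in>{1..n}. \<Sum>s\<in>{1..n}. Y t \<omega> j * Y s \<omega> k) =
      (\<Sum>t\<in>{1..n}. expectation (\<lambda>\<omega>. \<Sum>s\<in>{1..n}. Y t \<omega> j * Y s \<omega> k))"
    by (intro Bochner_Integration.integral_sum Bochner_Integration.integrable_sum integrable_YY j k)
  also have "\<dots> = (\<Sum>t\<in>{1..n}. \<Sum>s\<in>{1..n}. Cyy t s j k)"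
    unfolding Cyy_def by (intro sum.cong refl Bochner_Integration.integral_sum integrable_YY j k)
  also have "\<dots> = (\<Sum>t\<in>{1..n}. \<Sum>s\<in>nb t. Cyy t s j k)"
    by (intro sum.cong refl sum.mono_neutral_right nb_sub)
      (auto intro!: Cyy_nonneighbour j k)
  finally show ?thesis by (simp add: Xi_def)
qed

lemma W_mean: "j \<in> V \<Longrightarrow> expectation (\<lambda>\<omega>. W \<omega> j) = 0"
  unfolding W_def by (subst integral_divide_zero, subst Bochner_Integration.integral_sum) (auto intro: integrable_Y simp: mean0)

end

section \<open>From vectors to their projections on the normals\<close>

lemma dot_measurable: "dot p v \<in> borel_measurable (borel_vec p)"
  unfolding dot_def borel_vec_def by measurable

lemma space_borel_vec: "space (borel_vec p) = vecs p"
  by (simp add: borel_vec_def vecs_def space_PiM)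

text \<open>
  The factor 2 makes it irrelevant whether the infimum defining the norm is attained.
\<close>

lemma nn_integral_exp_psi_norm:
  assumes psi: "psi_norm M \<gamma> \<xi> \<le> ereal B" and B: "B > 0" and \<gamma>: "\<gamma> \<ge> 1"
    and M: "prob_space M" and [measurable]: "\<xi> \<in> borel_measurable M"
  shows "(\<integral>\<^sup>+\<omega>. ennreal (exp (\<bar>\<xi> \<omega>\<bar> / (2 * B))) \<partial>M) \<le> 6"
proof -
  interpret prob_space M by fact
  have "psi_norm M \<gamma> \<xi> < ereal (2 * B)" using psi B by (auto intro: le_less_trans)
  then obtain u where u: "u > 0" "u < 2 * B" and i: "(\<integral>\<^sup>+\<omega>. ennreal (exp ((\<bar>\<xi> \<omega>\<bar> / u) powr \<gamma>) - 1) \<partial>M) \<le> 1"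
    unfolding psi_norm_def Inf_less_iff by auto
  have "ennreal (exp (\<bar>\<xi> \<omega>\<bar> / (2 * B))) \<le> ennreal (exp 1) * (ennreal (exp ((\<bar>\<xi> \<omega>\<bar> / u) powr \<gamma>) - 1) + 1)" for \<omega>
  proof -
    have "\<bar>\<xi> \<omega>\<bar> / (2 * B) \<le> \<bar>\<xi> \<omega>\<bar> / u" using u B by (intro divide_left_mono) auto
    \<comment> \<open>Either the quotient is at most 1 or, because of
      \<open>\<gamma> \<ge> 1\<close>, at most its power. The added 1 costs a factor
      \<open>exp 1 \<le> 3\<close>, and 3 * (1 + 1) is the final 6.\<close>
    also have "\<dots> \<le> 1 + (\<bar>\<xi> \<omega>\<bar> / u) powr \<gamma>"
    proof (cases "\<bar>\<xi> \<omega>\<bar> / u \<le> 1")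
      case True
      then show ?thesis by (simp add: add_increasing2)
    next
      case False
      then have "(\<bar>\<xi> \<omega>\<bar> / u) powr 1 \<le> (\<bar>\<xi> \<omega>\<bar> / u) powr \<gamma>" using \<gamma> by (intro powr_mono) auto
      then show ?thesis using False u by simp
    qed
    finally have "exp (\<bar>\<xi> \<omega>\<bar> / (2 * B)) \<le> exp 1 * exp ((\<bar>\<xi> \<omega>\<bar> / u) powr \<gamma>)" by (simp flip: exp_add)
    also have "\<dots> = exp 1 * ((exp ((\<bar>\<xi> \<omega>\<bar> / u) powr \<gamma>) - 1) + 1)" by simp
    finally have "ennreal (exp (\<bar>\<xi> \<omega>\<bar> / (2 * B))) \<le> ennreal (exp 1 * ((exp ((\<bar>\<xi> \<omega>\<bar> / u) powr \<gamma>) - 1) + 1))"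
      by (rule ennreal_leI)
    also have "\<dots> = ennreal (exp 1) * (ennreal (exp ((\<bar>\<xi> \<omega>\<bar> / u) powr \<gamma>) - 1) + ennreal 1)"
      by (subst ennreal_plus[symmetric]) (simp_all add: ennreal_mult)
    finally show ?thesis by simp
  qed
  then have "(\<integral>\<^sup>+\<omega>. ennreal (exp (\<bar>\<xi> \<omega>\<bar> / (2 * B))) \<partial>M) \<le>
      (\<integral>\<^sup>+\<omega>. ennreal (exp 1) * (ennreal (exp ((\<bar>\<xi> \<omega>\<bar> / u) powr \<gamma>) - 1) + 1) \<partial>M)"
    by (intro nn_integral_mono)
  also have "\<dots> = ennreal (exp 1) * ((\<integral>\<^sup>+\<omega>. ennreal (exp ((\<bar>\<xi> \<omega>\<bar> / u) powr \<gamma>) - 1) \<partial>M) + 1)"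
    by (subst nn_integral_cmult, measurable, subst nn_integral_add) (auto simp: emeasure_space_1)
  also have "\<dots> \<le> ennreal 3 * (1 + 1)"
    using i exp_le by (intro mult_mono add_mono ennreal_leI) auto
  also have "\<dots> = 6" by (simp flip: ennreal_numeral ennreal_mult ennreal_1 ennreal_plus)
  finally show ?thesis .
qed

lemma (in prob_space) expectation_exp_psi_norm:
  assumes psi: "psi_norm M \<gamma> \<xi> \<le> ereal B" and B: "B > 0" and \<gamma>: "\<gamma> \<ge> 1"
    and m: "\<xi> \<in> borel_measurable M"
  shows "integrable M (\<lambda>\<omega>. exp (\<bar>\<xi> \<omega>\<bar> / (2 * B)))"
    and "expectation (\<lambda>\<omega>. exp (\<bar>\<xi> \<omega>\<bar> / (2 * B))) \<le> 6"
proof -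
  note le = nn_integral_exp_psi_norm[OF psi B \<gamma> prob_space_axioms m]
  show i: "integrable M (\<lambda>\<omega>. exp (\<bar>\<xi> \<omega>\<bar> / (2 * B)))"
  proof (rule integrableI_bounded)
    show "(\<lambda>\<omega>. exp (\<bar>\<xi> \<omega>\<bar> / (2 * B))) \<in> borel_measurable M" using m by measurable
    have "(6::ennreal) < \<infinity>" by simp
    then show "(\<integral>\<^sup>+\<omega>. ennreal (norm (exp (\<bar>\<xi> \<omega>\<bar> / (2 * B)))) \<partial>M) < \<infinity>"
      using le by (auto intro: le_less_trans)
  qed
  have "ennreal (expectation (\<lambda>\<omega>. exp (\<bar>\<xi> \<omega>\<bar> / (2 * B)))) = (\<integral>\<^sup>+\<omega>. ennreal (exp (\<bar>\<xi> \<omega>\<bar> / (2 * B))) \<partial>M)"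
    by (rule nn_integral_eq_integral[symmetric, OF i]) simp
  also have "\<dots> \<le> ennreal 6" using le by simp
  finally show "expectation (\<lambda>\<omega>. exp (\<bar>\<xi> \<omega>\<bar> / (2 * B))) \<le> 6" by (subst (asm) ennreal_le_iff) auto
qed

text \<open>The loops make \<open>t\<close> its own neighbour, so both \<open>nbhd n E t\<close> and
  \<open>nbhd n E s\<close> occur in the union that defines the second degree.\<close>

lemma nbhd_degree:
  assumes dg: "dependency_graph p n M X E" and t: "t \<in> {1..n}"
  shows "nbhd n E t \<subseteq> {1..n}" "t \<in> nbhd n E t" "card (nbhd n E t) \<le> degree1 n E"
    "s \<in> nbhd n E t \<Longrightarrow> card (nbhd n E t \<union> nbhd n E s) \<le> degree2 n E"
proof -
  show "nbhd n E t \<subseteq> {1..n}" by (auto simp: nbhd_def)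
  show tt: "t \<in> nbhd n E t" using dg t by (auto simp: nbhd_def dependency_graph_def)
  show "card (nbhd n E t) \<le> degree1 n E"
    unfolding degree1_def using t by (intro Max_ge) auto
  assume s: "s \<in> nbhd n E t"
  have "card (nbhd n E t \<union> nbhd n E s) \<le> card (\<Union>l\<in>nbhd n E t. nbhd n E l)"
    using s tt by (intro card_mono) (auto simp: nbhd_def)
  also have "\<dots> \<le> degree2 n E"
    unfolding degree2_def using t by (intro Max_ge) auto
  finally show "card (nbhd n E t \<union> nbhd n E s) \<le> degree2 n E" .
qed

lemma dot_norm_sum: "dot p v (norm_sum p n X \<omega>) = (\<Sum>t=1..n. dot p v (X t \<omega>)) / sqrt n"
proof -
  have "dot p v (norm_sum p n X \<omega>) = (\<Sum>j<p. \<Sum>t=1..n. v j * X t \<omega> j / sqrt n)"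
    unfolding dot_def norm_sum_def by (intro sum.cong refl) (simp add: sum_distrib_left sum_divide_distrib)
  also have "\<dots> = (\<Sum>t=1..n. \<Sum>j<p. v j * X t \<omega> j / sqrt n)" by (rule sum.swap)
  finally show ?thesis by (simp add: dot_def sum_divide_distrib)
qed

lemma norm_sum_measurable:
  assumes "\<And>t. t \<in> {1..n} \<Longrightarrow> X t \<in> M \<rightarrow>\<^sub>M borel_vec p"
  shows "norm_sum p n X \<in> M \<rightarrow>\<^sub>M borel_vec p"
  unfolding norm_sum_def[abs_def] borel_vec_def
proof (intro measurable_restrict borel_measurable_divide borel_measurable_sum borel_measurable_const)
  fix j t assume j: "j \<in> {..<p}" and t: "t \<in> {1..n}"
  show "(\<lambda>\<omega>. X t \<omega> j) \<in> borel_measurable M"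
    by (rule measurable_compose[OF assms[OF t, unfolded borel_vec_def] measurable_component_singleton[OF j]])
qed

definition half_spaces :: "nat \<Rightarrow> (nat \<Rightarrow> real) set \<Rightarrow> ((nat \<Rightarrow> real) \<Rightarrow> real) \<Rightarrow> (nat \<Rightarrow> real) set" where
  "half_spaces p V b = {w \<in> vecs p. \<forall>v\<in>V. dot p v w \<le> b v}"

lemma half_spaces_measurable: "finite V \<Longrightarrow> half_spaces p V b \<in> sets (borel_vec p)"
  unfolding half_spaces_def space_borel_vec[symmetric]
  by (intro sets.sets_Collect_finite_All borel_measurable_le dot_measurable borel_measurable_const)

text \<open>The quantity \<open>err\<close> of \<open>dep_gauss\<close> outside its locale. The
  number of normals is a real argument so that \<open>exp L\<close> can be put in its place.\<close>

definition rate_err :: "nat \<Rightarrow> real \<Rightarrow> real \<Rightarrow> real \<Rightarrow> real \<Rightarrow> real" where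
  "rate_err n d K \<beta> B = d * K ^ 2 * exp (- (sqrt n / (3 * d * \<beta> * B)) / 2)"

text \<open>The projections on the normals form a \<open>dep_field\<close>, and projecting the rows
  of a factor of the covariance matrix yields \<open>lr\<close>. Intersections of half-spaces
  thereby become orthants.\<close>

lemma polytope_bound:
  fixes M :: "'a measure" and \<sigma> L \<beta> :: real
  assumes n: "n \<ge> 1" and M: "prob_space M"
    and X: "\<And>t. t \<in> {1..n} \<Longrightarrow> X t \<in> M \<rightarrow>\<^sub>M borel_vec p"
    and Xint: "\<And>t j. t \<in> {1..n} \<Longrightarrow> j < p \<Longrightarrow> integrable M (\<lambda>\<omega>. X t \<omega> j)"
    and Xmean: "\<And>t j. t \<in> {1..n} \<Longrightarrow> j < p \<Longrightarrow> (LINT \<omega>|M. X t \<omega> j) = 0"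
    and sq: "\<And>j. j < p \<Longrightarrow> integrable M (\<lambda>\<omega>. (norm_sum p n X \<omega> j)\<^sup>2)"
    and N: "centered_normal p (cov M (norm_sum p n X)) N"
    and dg: "dependency_graph p n M X E"
    and B: "B > 0" and \<gamma>: "\<gamma> \<ge> 1" and V: "finite V" "V \<noteq> {}"
    and psi: "\<And>t v. t \<in> {1..n} \<Longrightarrow> v \<in> V \<Longrightarrow> psi_norm M \<gamma> (\<lambda>\<omega>. dot p v (X t \<omega>)) \<le> ereal B"
    and \<sigma>: "\<sigma> > 0" and var: "\<And>v. v \<in> V \<Longrightarrow>
       prob_space.variance M (\<lambda>\<omega>. (\<Sum>t=1..n. dot p v (X t \<omega>)) / sqrt n) \<ge> \<sigma>\<^sup>2"
    and L: "L \<ge> 1" "ln (card V) \<le> L" and \<beta>: "\<beta> > 0"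
    and small: "8 * (5054400000 * (real (degree1 n E) * real (degree2 n E) * (\<beta>^3 * (2 * B)^3) / (L * sqrt n))) \<le> 1"
  shows "\<bar>measure M {\<omega> \<in> space M. norm_sum p n X \<omega> \<in> half_spaces p V b} - measure N (half_spaces p V b)\<bar>
      \<le> 420 * (L * sqrt L / (\<beta> * \<sigma>)) + rate_err n (degree1 n E) (card V) \<beta> (2 * B)"
    and "\<eta> \<ge> 0 \<Longrightarrow> measure N (half_spaces p V (\<lambda>v. b v + \<eta>)) - measure N (half_spaces p V b) \<le> 45 * sqrt L * \<eta> / \<sigma>"
proof -
  interpret prob_space M by fact
  let ?S = "norm_sum p n X"
  obtain k :: nat and Lm :: "nat \<Rightarrow> nat \<Rightarrow> real" where Lm: "\<And>i j. i < p \<Longrightarrow> j < p \<Longrightarrow> cov M ?S i j = (\<Sum>l<k. Lm i l * Lm j l)"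
    and N_eq: "N = distr (gaussP {..<k}) (borel_vec p) (\<lambda>z. \<lambda>i\<in>{..<p}. \<Sum>l<k. Lm i l * z l)"
    using N unfolding centered_normal_def by blast
  define Y where "Y t \<omega> = (\<lambda>v\<in>V. dot p v (X t \<omega>))" for t \<omega>
  define lr where "lr v l = (\<Sum>i<p. v i * Lm i l)" for v l
  have dotX: "(\<lambda>\<omega>. dot p v (X t \<omega>)) \<in> borel_measurable M" if "t \<in> {1..n}" for t v
    by (rule measurable_compose[OF X[OF that] dot_measurable])
  have dotX_mean: "expectation (\<lambda>\<omega>. dot p v (X t \<omega>)) = 0" if "t \<in> {1..n}" for t v
    unfolding dot_def using that by (subst Bochner_Integration.integral_sum) (auto intro: Xint simp: Xmean)
  have smax: "smooth_max V \<beta> L" using V L \<beta> by unfold_locales auto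
  interpret smooth_max V \<beta> L by (rule smax)
  interpret DF: dep_field M V \<beta> L Y n "nbhd n E" "2 * B" "degree1 n E" "degree2 n E"
  proof unfold_locales
    show "Y t \<in> M \<rightarrow>\<^sub>M (\<Pi>\<^sub>M j\<in>V. borel)" if "t \<in> {1..n}" for t
      unfolding Y_def[abs_def] by (intro measurable_restrict dotX that)
    show "indep_var (\<Pi>\<^sub>M t\<in>T. \<Pi>\<^sub>M j\<in>V. borel) (\<lambda>\<omega>. \<lambda>t\<in>T. Y t \<omega>) (\<Pi>\<^sub>M t\<in>J. \<Pi>\<^sub>M j\<in>V. borel) (\<lambda>\<omega>. \<lambda>t\<in>J. Y t \<omega>)"
      if T: "T \<subseteq> {1..n}" and J: "J \<subseteq> {1..n}" and sep: "\<And>t. t \<in> T \<Longrightarrow> nbhd n E t \<inter> J = {}" for T J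
    proof -
      \<comment> \<open>Independence of families passes to their images under a measurable map, here
        the projection of every member on all normals.\<close>
      define \<phi> where "\<phi> T x = (\<lambda>t\<in>T. \<lambda>v\<in>V. dot p v (x t))" for T :: "nat set" and x :: "nat \<Rightarrow> nat \<Rightarrow> real"
      have \<phi>: "\<phi> T \<in> (\<Pi>\<^sub>M t\<in>T. borel_vec p) \<rightarrow>\<^sub>M (\<Pi>\<^sub>M t\<in>T. \<Pi>\<^sub>M j\<in>V. borel)" for T
        unfolding \<phi>_def[abs_def]
      proof (intro measurable_restrict)
        fix t v assume t: "t \<in> T"
        show "(\<lambda>x. dot p v (x t)) \<in> borel_measurable (\<Pi>\<^sub>M t\<in>T. borel_vec p)"
          by (rule measurable_compose[OF measurable_component_singleton[OF t] dot_measurable])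
      qed
      have "(T \<times> J) \<inter> E = {}" using sep J by (fastforce simp: nbhd_def)
      then have "indep_var (\<Pi>\<^sub>M t\<in>T. borel_vec p) (\<lambda>\<omega>. \<lambda>t\<in>T. X t \<omega>) (\<Pi>\<^sub>M s\<in>J. borel_vec p) (\<lambda>\<omega>. \<lambda>s\<in>J. X s \<omega>)"
        using dg T J unfolding dependency_graph_def by blast
      from indep_var_compose[OF this \<phi> \<phi>]
      have "indep_var (\<Pi>\<^sub>M t\<in>T. \<Pi>\<^sub>M j\<in>V. borel) (\<phi> T \<circ> (\<lambda>\<omega>. \<lambda>t\<in>T. X t \<omega>)) (\<Pi>\<^sub>M t\<in>J. \<Pi>\<^sub>M j\<in>V. borel) (\<phi> J \<circ> (\<lambda>\<omega>. \<lambda>s\<in>J. X s \<omega>))" .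
      moreover have "\<phi> T \<circ> (\<lambda>\<omega>. \<lambda>t\<in>T. X t \<omega>) = (\<lambda>\<omega>. \<lambda>t\<in>T. Y t \<omega>)" for T
        by (auto simp: \<phi>_def Y_def fun_eq_iff restrict_def)
      ultimately show ?thesis by simp
    qed
    show "expectation (\<lambda>\<omega>. Y t \<omega> j) = 0" if "t \<in> {1..n}" "j \<in> V" for t j
      using dotX_mean[OF that(1), of j] that(2) by (simp add: Y_def)
    show "integrable M (\<lambda>\<omega>. exp (\<bar>Y t \<omega> j\<bar> / (2 * B)))" if "t \<in> {1..n}" "j \<in> V" for t j
      using expectation_exp_psi_norm(1)[OF psi[OF that] B \<gamma> dotX[OF that(1)]] that(2) by (simp add: Y_def)
    show "expectation (\<lambda>\<omega>. exp (\<bar>Y t \<omega> j\<bar> / (2 * B))) \<le> 6" if "t \<in> {1..n}" "j \<in> V" for t j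
      using expectation_exp_psi_norm(2)[OF psi[OF that] B \<gamma> dotX[OF that(1)]] that(2) by (simp add: Y_def)
    show "real (card (nbhd n E t)) \<le> real (degree1 n E)" if "t \<in> {1..n}" for t
      using nbhd_degree(3)[OF dg that] by simp
    show "real (card (nbhd n E t \<union> nbhd n E s)) \<le> real (degree2 n E)" if "t \<in> {1..n}" "s \<in> nbhd n E t" for t s
      using nbhd_degree(4)[OF dg that] by simp
  qed (use n B nbhd_degree[OF dg] in auto)
  have W: "DF.W \<omega> v = dot p v (?S \<omega>)" if "v \<in> V" for \<omega> v
    unfolding DF.W_def dot_norm_sum using that by (simp add: Y_def)
  have Smean: "(LINT \<omega>|M. ?S \<omega> i) = 0" if "i < p" for i
  proof -
    have "(LINT \<omega>|M. ?S \<omega> i) = (LINT \<omega>|M. (\<Sum>t=1..n. X t \<omega> i)) / sqrt n"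
      using that by (simp add: norm_sum_def)
    also have "(LINT \<omega>|M. (\<Sum>t=1..n. X t \<omega> i)) = 0"
      using that by (subst Bochner_Integration.integral_sum) (auto intro: Xint simp: Xmean)
    finally show ?thesis by simp
  qed
  have Sm: "(\<lambda>\<omega>. ?S \<omega> i) \<in> borel_measurable M" if "i < p" for i
  proof -
    have S: "?S \<in> M \<rightarrow>\<^sub>M (\<Pi>\<^sub>M j\<in>{..<p}. borel)"
      using norm_sum_measurable[OF X] by (simp only: borel_vec_def)
    have "i \<in> {..<p}" using that by simp
    from measurable_compose[OF S measurable_component_singleton[OF this]] show ?thesis .
  qed
  have SS: "integrable M (\<lambda>\<omega>. ?S \<omega> i * ?S \<omega> j)" if "i < p" "j < p" for i j
  proof (rule Bochner_Integration.integrable_bound[OF Bochner_Integration.integrable_add[OF sq[OF that(1)] sq[OF that(2)]]])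
    show "AE \<omega> in M. norm (?S \<omega> i * ?S \<omega> j) \<le> norm ((?S \<omega> i)\<^sup>2 + (?S \<omega> j)\<^sup>2)"
    proof (rule AE_I2)
      fix \<omega>
      show "norm (?S \<omega> i * ?S \<omega> j) \<le> norm ((?S \<omega> i)\<^sup>2 + (?S \<omega> j)\<^sup>2)"
        using DF.abs_mult_le[of "?S \<omega> i" "?S \<omega> j"] by simp
    qed
  qed (intro borel_measurable_times Sm that)
  have cov: "cov M ?S i j = expectation (\<lambda>\<omega>. ?S \<omega> i * ?S \<omega> j)" if "i < p" "j < p" for i j
    using that by (simp add: cov_def Smean)
  \<comment> \<open>Bilinearity carries the factorisation of the covariance matrix over to the
    normals. The mixed moments exist because each coordinate of the sum is square
    integrable.\<close>
  have lr_cov: "DF.Xi v w = (\<Sum>l<k. lr v l * lr w l)" if "v \<in> V" "w \<in> V" for v w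
  proof -
    have "DF.Xi v w = expectation (\<lambda>\<omega>. dot p v (?S \<omega>) * dot p w (?S \<omega>))"
      using DF.expectation_WW[OF that] by (simp add: W that)
    also have "\<dots> = expectation (\<lambda>\<omega>. \<Sum>i<p. \<Sum>j<p. v i * w j * (?S \<omega> i * ?S \<omega> j))"
      unfolding dot_def sum_product by (intro Bochner_Integration.integral_cong sum.cong refl) (simp add: mult_ac)
    also have "\<dots> = (\<Sum>i<p. expectation (\<lambda>\<omega>. \<Sum>j<p. v i * w j * (?S \<omega> i * ?S \<omega> j)))"
      by (intro Bochner_Integration.integral_sum Bochner_Integration.integrable_sum integrable_mult_right SS) auto
    also have "\<dots> = (\<Sum>i<p. \<Sum>j<p. expectation (\<lambda>\<omega>. v i * w j * (?S \<omega> i * ?S \<omega> j)))"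
      by (intro sum.cong refl Bochner_Integration.integral_sum integrable_mult_right SS) auto
    also have "\<dots> = (\<Sum>i<p. \<Sum>j<p. v i * w j * (\<Sum>l<k. Lm i l * Lm j l))"
      by (intro sum.cong refl) (simp add: cov[symmetric] Lm)
    also have "\<dots> = (\<Sum>i<p. \<Sum>j<p. \<Sum>l<k. (v i * Lm i l) * (w j * Lm j l))"
      unfolding sum_distrib_left by (intro sum.cong refl) (simp add: mult_ac)
    also have "\<dots> = (\<Sum>l<k. \<Sum>i<p. \<Sum>j<p. (v i * Lm i l) * (w j * Lm j l))"
      unfolding sum.swap[of _ "{..<k}" "{..<p}"] ..
    finally show ?thesis by (simp add: lr_def sum_product)
  qed
  have lr_var: "(\<Sum>l<k. (lr v l)\<^sup>2) \<ge> \<sigma>\<^sup>2" if v: "v \<in> V" for v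
  proof -
    have e: "(\<Sum>t=1..n. dot p v (X t \<omega>)) / sqrt n = DF.W \<omega> v" for \<omega>
      using v by (simp add: W dot_norm_sum)
    have "\<sigma>\<^sup>2 \<le> expectation (\<lambda>\<omega>. (DF.W \<omega> v - expectation (\<lambda>\<omega>. DF.W \<omega> v))\<^sup>2)"
      using var[OF v] unfolding e .
    also have "\<dots> = expectation (\<lambda>\<omega>. DF.W \<omega> v * DF.W \<omega> v)"
      using DF.W_mean[OF v] by (simp add: power2_eq_square)
    also have "\<dots> = (\<Sum>l<k. lr v l * lr v l)"
      unfolding DF.expectation_WW[OF v v] by (rule lr_cov[OF v v])
    finally show ?thesis by (simp add: power2_eq_square)
  qed
  interpret DG: dep_gauss M V \<beta> L Y n "nbhd n E" "2 * B" "degree1 n E" "degree2 n E" "{..<k}" lr \<sigma>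
    by unfold_locales (use \<sigma> lr_cov lr_var in auto)
  have PW: "measure M {\<omega> \<in> space M. ?S \<omega> \<in> half_spaces p V b} = DG.PW b" for b
    unfolding DG.PW_def half_spaces_def
    by (intro arg_cong[where f="measure M"] Collect_cong) (auto simp: W norm_sum_def vecs_def)
  have PG: "measure N (half_spaces p V b) = DG.PG b" for b
  proof -
    let ?T = "\<lambda>z. \<lambda>i\<in>{..<p}. \<Sum>l<k. Lm i l * z l"
    have Tm: "?T \<in> gaussP {..<k} \<rightarrow>\<^sub>M borel_vec p"
      unfolding borel_vec_def by (intro measurable_restrict gaussP_linear_measurable)
    have T: "dot p v (?T z) = DG.G z v" for v z
    proof -
      have "dot p v (?T z) = (\<Sum>i<p. \<Sum>l<k. v i * Lm i l * z l)"
        unfolding dot_def by (intro sum.cong refl) (simp add: sum_distrib_left mult.assoc)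
      also have "\<dots> = (\<Sum>l<k. \<Sum>i<p. v i * Lm i l * z l)" by (rule sum.swap)
      finally show ?thesis by (simp add: DG.G_def lr_def sum_distrib_right)
    qed
    have "measure N (half_spaces p V b) = measure (gaussP {..<k}) (?T -` half_spaces p V b \<inter> space (gaussP {..<k}))"
      unfolding N_eq by (rule measure_distr[OF Tm half_spaces_measurable[OF V(1)]])
    also have "?T -` half_spaces p V b \<inter> space (gaussP {..<k}) = {z \<in> space (gaussP {..<k}). \<forall>v\<in>V. DG.G z v \<le> b v}"
      unfolding half_spaces_def vimage_def by (auto simp: T vecs_def)
    finally show ?thesis by (simp add: DG.PG_def)
  qed
  show "\<bar>measure M {\<omega> \<in> space M. ?S \<omega> \<in> half_spaces p V b} - measure N (half_spaces p V b)\<bar>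
      \<le> 420 * (L * sqrt L / (\<beta> * \<sigma>)) + rate_err n (degree1 n E) (card V) \<beta> (2 * B)"
    using DG.gaussian_approximation[of b, unfolded DG.KK_def, OF small]
    unfolding PW PG DG.\<Lambda>_def DG.err_def rate_err_def .
  show "measure N (half_spaces p V (\<lambda>v. b v + \<eta>)) - measure N (half_spaces p V b) \<le> 45 * sqrt L * \<eta> / \<sigma>" if "\<eta> \<ge> 0"
    unfolding PG by (rule DG.PG_diff[OF that])
qed

text \<open>
  A normal in whose direction the set is unbounded imposes no constraint and is dropped.
\<close>

lemma enlarge_half_spaces:
  assumes A: "A \<noteq> {}" and V: "V' = {v \<in> V. support_fun p A v \<noteq> \<infinity>}"
  shows "enlarge p A V \<epsilon> = half_spaces p V' (\<lambda>v. real_of_ereal (support_fun p A v) + \<epsilon>)"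
proof -
  obtain w0 where "w0 \<in> A" using A by auto
  then have "ereal (dot p v w0) \<le> support_fun p A v" for v unfolding support_fun_def by (rule SUP_upper)
  then have fin: "support_fun p A v \<noteq> - \<infinity>" for v by (metis MInfty_neq_ereal(1) ereal_infty_less_eq(2))
  have "(\<forall>v\<in>V. ereal (dot p v w) \<le> support_fun p A v + ereal \<epsilon>) \<longleftrightarrow>
      (\<forall>v\<in>V'. dot p v w \<le> real_of_ereal (support_fun p A v) + \<epsilon>)" for w
  proof -
    have "ereal (dot p v w) \<le> support_fun p A v + ereal \<epsilon> \<longleftrightarrow>
       (support_fun p A v \<noteq> \<infinity> \<longrightarrow> dot p v w \<le> real_of_ereal (support_fun p A v) + \<epsilon>)" for v
      using fin[of v] by (cases "support_fun p A v") auto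
    then show ?thesis unfolding V by auto
  qed
  then show ?thesis by (simp add: enlarge_def half_spaces_def)
qed

text \<open>The support function of the empty set is \<open>- \<infinity>\<close>, and a finite
  enlargement leaves it there.\<close>

lemma enlarge_empty: "V \<noteq> {} \<Longrightarrow> enlarge p {} V \<epsilon> = {}"
  by (auto simp: enlarge_def support_fun_def bot_ereal_def)

lemma vecs_ne: "vecs p \<noteq> {}"
  by (auto simp: vecs_def PiE_eq_empty_iff)

text \<open>A squeeze between two intersections of half-spaces with the same normals: both laws are
  monotone, and the Gaussian mass between the two sets is an anti-concentration term of width
  \<open>a / n\<close>. For an empty or unconstrained approximating set the discrepancy is
  0.\<close>

lemma simple_convex_bound:
  fixes M :: "'a measure" and \<sigma> L \<beta> :: real
  assumes n: "n \<ge> 1" and M: "prob_space M"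
    and X: "\<And>t. t \<in> {1..n} \<Longrightarrow> X t \<in> M \<rightarrow>\<^sub>M borel_vec p"
    and Xint: "\<And>t j. t \<in> {1..n} \<Longrightarrow> j < p \<Longrightarrow> integrable M (\<lambda>\<omega>. X t \<omega> j)"
    and Xmean: "\<And>t j. t \<in> {1..n} \<Longrightarrow> j < p \<Longrightarrow> (LINT \<omega>|M. X t \<omega> j) = 0"
    and sq: "\<And>j. j < p \<Longrightarrow> integrable M (\<lambda>\<omega>. (norm_sum p n X \<omega> j)\<^sup>2)"
    and N: "centered_normal p (cov M (norm_sum p n X)) N"
    and dg: "dependency_graph p n M X E"
    and B: "B > 0" and \<gamma>: "\<gamma> \<ge> 1"
    and A: "approximates p n a d A\<^sub>K V A" "A \<in> sets (borel_vec p)" "A \<subseteq> vecs p"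
    and psi: "\<And>t v. t \<in> {1..n} \<Longrightarrow> v \<in> V \<Longrightarrow> psi_norm M \<gamma> (\<lambda>\<omega>. dot p v (X t \<omega>)) \<le> ereal B"
    and \<sigma>: "\<sigma> > 0" and var: "\<And>v. v \<in> V \<Longrightarrow>
       prob_space.variance M (\<lambda>\<omega>. (\<Sum>t=1..n. dot p v (X t \<omega>)) / sqrt n) \<ge> \<sigma>\<^sup>2"
    and a: "a \<ge> 0" and pn: "p \<ge> 1" and L: "L \<ge> 1" "d * (ln p + ln n) \<le> L" and \<beta>: "\<beta> > 0"
    and small: "8 * (5054400000 * (real (degree1 n E) * real (degree2 n E) * (\<beta>^3 * (2 * B)^3) / (L * sqrt n))) \<le> 1"
  shows "\<bar>measure M {\<omega> \<in> space M. norm_sum p n X \<omega> \<in> A} - measure N A\<bar>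
      \<le> 420 * (L * sqrt L / (\<beta> * \<sigma>)) + rate_err n (degree1 n E) (exp L) \<beta> (2 * B) + 45 * sqrt L * (a / n) / \<sigma>"
proof -
  interpret prob_space M by fact
  let ?S = "norm_sum p n X"
  obtain k :: nat and Lm :: "nat \<Rightarrow> nat \<Rightarrow> real" where N_eq: "N = distr (gaussP {..<k}) (borel_vec p) (\<lambda>z. \<lambda>i\<in>{..<p}. \<Sum>l<k. Lm i l * z l)"
    using N unfolding centered_normal_def by blast
  have Tm: "(\<lambda>z. \<lambda>i\<in>{..<p}. \<Sum>l<k. Lm i l * z l) \<in> gaussP {..<k} \<rightarrow>\<^sub>M borel_vec p"
    unfolding borel_vec_def by (intro measurable_restrict gaussP_linear_measurable)
  have N_prob: "prob_space N" unfolding N_eq by (rule prob_space.prob_space_distr[OF prob_space_gaussP Tm])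
  interpret N: prob_space N by (rule N_prob)
  have sN: "sets N = sets (borel_vec p)" "space N = vecs p" unfolding N_eq by (simp_all add: space_borel_vec)
  let ?R = "420 * (L * sqrt L / (\<beta> * \<sigma>)) + rate_err n (degree1 n E) (exp L) \<beta> (2 * B) + 45 * sqrt L * (a / n) / \<sigma>"
  have R0: "?R \<ge> 0" using L \<beta> \<sigma> a by (simp add: rate_err_def)
  have Sv: "?S \<omega> \<in> vecs p" for \<omega> by (simp add: norm_sum_def vecs_def)
  from A(1) obtain K where K: "K_generated p K A\<^sub>K V" "real K \<le> (real p * real n) powr d"
    and sub: "A\<^sub>K \<subseteq> A" "A \<subseteq> enlarge p A\<^sub>K V (a / n)"
    unfolding approximates_def by auto
  have V: "finite V" "card V = K" and AK: "A\<^sub>K = enlarge p A\<^sub>K V 0"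
    using K(1) by (auto simp: K_generated_def)
  show ?thesis
  proof (cases "A\<^sub>K = {}")
    case True
    \<comment> \<open>With no normals at all the intersection would be the whole space, which is not
      empty.\<close>
    have "V \<noteq> {}"
    proof
      assume "V = {}"
      then have "enlarge p A\<^sub>K V 0 = vecs p" by (simp add: enlarge_def)
      with AK True vecs_ne show False by metis
    qed
    then have "A = {}" using sub(2) True enlarge_empty by auto
    then show ?thesis using R0 by simp
  next
    case False
    define V' where "V' = {v \<in> V. support_fun p A\<^sub>K v \<noteq> \<infinity>}"
    define h where "h = (\<lambda>v. real_of_ereal (support_fun p A\<^sub>K v))"
    have V': "finite V'" "V' \<subseteq> V" using V by (auto simp: V'_def)
    have lo: "A\<^sub>K = half_spaces p V' h"
      using AK enlarge_half_spaces[OF False V'_def, of 0] by (simp add: h_def)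
    have hi: "enlarge p A\<^sub>K V (a / n) = half_spaces p V' (\<lambda>v. h v + a / n)"
      using enlarge_half_spaces[OF False V'_def] by (simp add: h_def)
    show ?thesis
    proof (cases "V' = {}")
      case True
      then have "A = vecs p" using lo sub(1) A(3) by (auto simp: half_spaces_def)
      then have "measure M {\<omega> \<in> space M. ?S \<omega> \<in> A} = 1" "measure N A = 1"
        using Sv prob_space N.prob_space by (simp_all add: sN(2)[symmetric])
      then show ?thesis using R0 by simp
    next
      case V'ne: False
      have c0: "card V' > 0" using V' V'ne by (simp add: card_gt_0_iff)
      have "card V' \<le> K" using V V' by (metis card_mono)
      then have cK: "real (card V') \<le> (real p * real n) powr d" using K(2) by linarith
      have pn0: "real p > 0" "real n > 0" using pn n by auto
      have "ln (real (card V')) \<le> ln ((real p * real n) powr d)"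
        using cK c0 pn0 by (subst ln_le_cancel_iff) auto
      also have "\<dots> = d * (ln p + ln n)" using pn0 by (simp add: ln_powr ln_mult)
      finally have lnV: "ln (real (card V')) \<le> L" using L(2) by linarith
      have cV: "real (card V') \<le> exp L"
        using lnV c0 by (metis exp_le_cancel_iff exp_ln of_nat_0_less_iff)
      have psi': "\<And>t v. t \<in> {1..n} \<Longrightarrow> v \<in> V' \<Longrightarrow> psi_norm M \<gamma> (\<lambda>\<omega>. dot p v (X t \<omega>)) \<le> ereal B"
        using psi V'(2) by blast
      have var': "\<And>v. v \<in> V' \<Longrightarrow> prob_space.variance M (\<lambda>\<omega>. (\<Sum>t=1..n. dot p v (X t \<omega>)) / sqrt n) \<ge> \<sigma>\<^sup>2"
        using var V'(2) by blast
      have pb1: "\<bar>measure M {\<omega> \<in> space M. ?S \<omega> \<in> half_spaces p V' b} - measure N (half_spaces p V' b)\<bar>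
        \<le> 420 * (L * sqrt L / (\<beta> * \<sigma>)) + rate_err n (degree1 n E) (card V') \<beta> (2 * B)" for b
        by (rule polytope_bound(1)[OF n M _ _ _ _ N dg B \<gamma> V'(1) V'ne _ \<sigma> _ L(1) lnV \<beta> small])
          (fact X Xint Xmean sq psi' var')+
      have pb2: "measure N (half_spaces p V' (\<lambda>v. b v + \<eta>)) - measure N (half_spaces p V' b) \<le> 45 * sqrt L * \<eta> / \<sigma>"
        if "\<eta> \<ge> 0" for b \<eta>
        by (rule polytope_bound(2)[OF n M _ _ _ _ N dg B \<gamma> V'(1) V'ne _ \<sigma> _ L(1) lnV \<beta> small that])
          (fact X Xint Xmean sq psi' var')+
      have er: "rate_err n (degree1 n E) (card V') \<beta> (2 * B) \<le> rate_err n (degree1 n E) (exp L) \<beta> (2 * B)"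
        unfolding rate_err_def using cV by (intro mult_right_mono mult_left_mono power_mono) auto
      have mS: "{\<omega> \<in> space M. ?S \<omega> \<in> C} \<in> sets M" if "C \<in> sets (borel_vec p)" for C
        using measurable_sets[OF norm_sum_measurable[OF X] that] by (simp add: vimage_def Int_def conj_commute)
      note hm = half_spaces_measurable[OF V'(1)]
      let ?P = "\<lambda>C. measure M {\<omega> \<in> space M. ?S \<omega> \<in> C}"
      have Pmono: "?P C \<le> ?P C'" if "C \<subseteq> C'" "C' \<in> sets (borel_vec p)" for C C'
        by (rule finite_measure_mono) (use that mS in auto)
      have Nmono: "measure N C \<le> measure N C'" if "C \<subseteq> C'" "C' \<in> sets (borel_vec p)" for C C'
        by (rule N.finite_measure_mono) (use that sN in auto)
      let ?lo = "half_spaces p V' h" and ?hi = "half_spaces p V' (\<lambda>v. h v + a / n)"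
      have "?P ?lo \<le> ?P A" "measure N ?lo \<le> measure N A" "?P A \<le> ?P ?hi" "measure N A \<le> measure N ?hi"
        using sub lo hi A(2) hm by (auto intro!: Pmono Nmono)
      moreover have "measure N ?hi - measure N ?lo \<le> 45 * sqrt L * (a / n) / \<sigma>"
        by (rule pb2) (use a in simp)
      moreover have "\<bar>?P ?lo - measure N ?lo\<bar> \<le> 420 * (L * sqrt L / (\<beta> * \<sigma>)) + rate_err n (degree1 n E) (exp L) \<beta> (2 * B)"
        using pb1[of h] er by linarith
      moreover have "\<bar>?P ?hi - measure N ?hi\<bar> \<le> 420 * (L * sqrt L / (\<beta> * \<sigma>)) + rate_err n (degree1 n E) (exp L) \<beta> (2 * B)"
        using pb1[of "\<lambda>v. h v + a / n"] er by linarith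
      ultimately show ?thesis unfolding abs_le_iff by linarith
    qed
  qed
qed

section \<open>The rate of convergence\<close>

text \<open>
  All quantities except the exponential are monomials, so the estimates are linear in the logarithms.
\<close>

lemma rate_err_le:
  fixes n :: nat and d1 d2 B \<Lambda> K\<^sub>0 :: real
  assumes n: "n \<ge> 1" and B: "B \<ge> 1" and d1: "d1 \<ge> 1" and d2: "d2 \<ge> d1" and K0: "K\<^sub>0 \<ge> 1"
    and \<Lambda>: "\<Lambda> \<ge> (8 * K\<^sub>0\<^sup>2)\<^sup>2" and q: "real n powr (1/4) \<ge> 8 * K\<^sub>0 * ln n"
  defines "R \<equiv> B * (d1 * d2) powr (1/3) * \<Lambda> powr (7/6) / n powr (1/6)"
    and "L \<equiv> K\<^sub>0 * \<Lambda>"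
  defines "\<beta> \<equiv> n powr (1/6) * L powr (1/3) / (8000 * B * (d1 * d2) powr (1/3))"
  assumes R: "R < 1"
  shows "rate_err n d1 (exp L) \<beta> (2 * B) \<le> R"
proof -
  have n0: "real n > 0" using n by simp
  have "1 \<le> 8 * K\<^sub>0\<^sup>2" using K0 one_le_power[of K\<^sub>0 2] by linarith
  then have "1 \<le> (8 * K\<^sub>0\<^sup>2)\<^sup>2" by (rule one_le_power)
  with \<Lambda> have \<Lambda>1: "\<Lambda> \<ge> 1" by linarith
  have L0: "L > 0" using \<Lambda>1 K0 by (simp add: L_def)
  have pos: "B > 0" "d1 > 0" "d2 > 0" "\<Lambda> > 0" "K\<^sub>0 > 0" using B d1 d2 \<Lambda>1 K0 by auto
  define N where "N = ln (real n)"
  define D1 where "D1 = ln d1"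
  define D2 where "D2 = ln d2"
  define l where "l = ln \<Lambda>"
  have N0: "N \<ge> 0" using n by (simp add: N_def)
  have ge0: "D1 \<ge> 0" "D2 \<ge> D1" "l \<ge> 0" "ln B \<ge> 0" "ln K\<^sub>0 \<ge> 0"
    using d1 d2 \<Lambda>1 B K0 by (auto simp: D1_def D2_def l_def)
  have R0: "R > 0" using pos n0 by (simp add: R_def)
  have lnR: "ln R = ln B + (D1 + D2) / 3 + 7/6 * l - N / 6"
    using pos n0 by (simp add: R_def ln_mult ln_div ln_powr D1_def D2_def l_def N_def)
  have R1: "ln R < 0" using R R0 by simp
  \<comment> \<open>Since \<open>ln R\<close> is negative, this says that \<open>n\<close> exceeds
    the product of \<open>B^6\<close>, \<open>d1^2\<close>, \<open>d2^2\<close> and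
    \<open>\<Lambda>^7\<close>. All later comparisons draw on this surplus.\<close>
  have R6: "6 * ln R = 6 * ln B + 2 * D1 + 2 * D2 + 7 * l - N" using lnR by simp
  define \<tau> where "\<tau> = sqrt n / (3 * d1 * \<beta> * (2 * B))"
  have \<beta>: "\<beta> > 0" using pos n0 L0 by (simp add: \<beta>_def)
  have \<tau>0: "\<tau> > 0" using pos n0 \<beta> by (simp add: \<tau>_def)
  have ln_sqrt_n: "ln (sqrt n) = N / 2" using n0 by (simp add: N_def ln_sqrt)
  have ln\<beta>: "ln \<beta> = N / 6 + (ln K\<^sub>0 + l) / 3 - (ln 8000 + ln B + (D1 + D2) / 3)"
    using pos n0 L0 by (simp add: \<beta>_def L_def ln_mult ln_div ln_powr D1_def D2_def l_def N_def)
  have ln6: "ln (6::real) = ln 3 + ln 2" using ln_mult[of 3 "2::real"] by simp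
  have "ln \<tau> = N / 2 - (ln 3 + D1 + ln \<beta> + (ln 2 + ln B))"
    using pos n0 \<beta> by (simp add: \<tau>_def ln_mult ln_div ln_sqrt_n D1_def ln6)
  also have "\<dots> = N / 3 + (D1 + D2) / 3 - D1 - (ln K\<^sub>0 + l) / 3 + (ln 8000 - ln 3 - ln 2)"
    unfolding ln\<beta> by (simp add: field_simps)
  \<comment> \<open>Of \<open>N / 3\<close> only \<open>N / 4\<close> is kept; the remaining
    \<open>N / 12\<close> pays for the degrees and for \<open>\<Lambda>\<close>, and 8000 exceeds
    6.\<close>
  also have "\<dots> \<ge> N / 4 - ln K\<^sub>0"
  proof -
    have "ln (6::real) \<le> ln 8000" by simp
    with ln6 have "ln 8000 - ln 3 - ln (2::real) \<ge> 0" by linarith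
    moreover define \<delta> where "\<delta> = ln 8000 - ln 3 - ln (2::real)"
    ultimately have "3 * N - 12 * ln K\<^sub>0 \<le> 4 * N + 4 * D1 + 4 * D2 - 12 * D1 - 4 * ln K\<^sub>0 - 4 * l + 12 * \<delta>"
      using R6 R1 ge0 N0 by linarith
    then show ?thesis unfolding \<delta>_def[symmetric] by (simp add: field_simps)
  qed
  finally have "exp (N / 4 - ln K\<^sub>0) \<le> exp (ln \<tau>)" by simp
  then have "exp (N / 4 - ln K\<^sub>0) \<le> \<tau>" using \<tau>0 by simp
  moreover define Q where "Q = exp (N / 4)"
  ultimately have \<tau>Q: "Q / K\<^sub>0 \<le> \<tau>" using pos by (simp add: exp_diff)
  have Q1: "Q \<ge> 8 * K\<^sub>0 * N"
    using q n0 by (simp add: Q_def N_def powr_def)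
  have Q2: "Q \<ge> \<Lambda> * (8 * K\<^sub>0\<^sup>2)"
  proof -
    have "8 * K\<^sub>0\<^sup>2 \<le> sqrt \<Lambda>" using \<Lambda> K0 by (intro real_le_rsqrt) auto
    also have "sqrt \<Lambda> = exp (ln (sqrt \<Lambda>))" using pos by simp
    also have "ln (sqrt \<Lambda>) = l / 2" using pos by (simp add: l_def ln_sqrt)
    finally have "\<Lambda> * (8 * K\<^sub>0\<^sup>2) \<le> exp l * exp (l / 2)"
      using pos by (simp add: l_def)
    also have "\<dots> = exp (3/2 * l)" by (simp flip: exp_add)
    also have "\<dots> \<le> Q" 
    proof -
      have "6 * l \<le> N" using R6 R1 ge0 by linarith
      then show ?thesis by (simp add: Q_def)
    qed
    finally show ?thesis .
  qed
  \<comment> \<open>\<open>2 * L\<close> pays for the square of \<open>exp L\<close> in the error.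
    \<open>2 * N\<close> pays for \<open>D1\<close>, which is at most \<open>N / 4\<close>, and for
    reaching \<open>ln R\<close>, which is at least \<open>- N / 6\<close>.\<close>
  have "2 * N + 2 * L \<le> \<tau> / 2"
  proof -
    have "2 * N \<le> Q / (4 * K\<^sub>0)" using Q1 pos by (simp add: field_simps)
    moreover have "2 * L \<le> Q / (4 * K\<^sub>0)" using Q2 pos by (simp add: field_simps L_def power2_eq_square)
    moreover have "Q / (4 * K\<^sub>0) + Q / (4 * K\<^sub>0) = Q / K\<^sub>0 / 2" using pos by (simp add: field_simps)
    ultimately show ?thesis using \<tau>Q by linarith
  qed
  moreover have "4 * D1 \<le> N" "- N \<le> 6 * ln R" using R6 R1 ge0 by linarith+
  ultimately have le: "D1 + 2 * L - \<tau> / 2 \<le> ln R" using N0 by linarith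
  have "rate_err n d1 (exp L) \<beta> (2 * B) = exp D1 * exp (2 * L) * exp (- \<tau> / 2)"
    using pos by (simp add: rate_err_def \<tau>_def D1_def flip: exp_double)
  also have "\<dots> = exp (D1 + 2 * L - \<tau> / 2)" by (simp flip: exp_add)
  also have "\<dots> \<le> exp (ln R)" using le by simp
  finally show ?thesis using R0 by simp
qed

text \<open>\<open>\<beta>\<close> is defined so that all variable quantities cancel here. What
  remains is 8 * 5054400000, about 4.04e10, against the cube of 4000, which is 6.4e10; this is the
  purpose of the 8000.\<close>

lemma beta_small:
  fixes n :: nat and d1 d2 B L :: real
  assumes n: "n \<ge> 1" and B: "B > 0" and d: "d1 > 0" "d2 > 0" and L: "L > 0"
  defines "\<beta> \<equiv> n powr (1/6) * L powr (1/3) / (8000 * B * (d1 * d2) powr (1/3))"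
  shows "8 * (5054400000 * (d1 * d2 * (\<beta>^3 * (2 * B)^3) / (L * sqrt n))) \<le> 1"
proof -
  have n0: "real n > 0" using n by simp
  have c: "(x powr (1/3)) ^ 3 = x" if "x > 0" for x :: real
    using that by (simp add: powr_powr flip: powr_realpow)
  have c6: "(real n powr (1/6)) ^ 3 = sqrt n"
    using n0 by (simp add: powr_powr powr_half_sqrt flip: powr_realpow)
  have "\<beta>^3 * (2 * B)^3 = (\<beta> * (2 * B)) ^ 3" by (simp add: power_mult_distrib)
  also have "\<beta> * (2 * B) = n powr (1/6) * L powr (1/3) / (4000 * (d1 * d2) powr (1/3))"
    using B by (simp add: \<beta>_def)
  also have "\<dots> ^ 3 = sqrt n * L / (64000000000 * (d1 * d2))"
    using d L by (simp add: power_divide power_mult_distrib c c6)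
  finally have "\<beta>^3 * (2 * B)^3 = sqrt n * L / (64000000000 * (d1 * d2))" .
  then show ?thesis using n0 L d by simp
qed

text \<open>The exponent 3/2 of \<open>L\<close> splits into 7/6 and 1/3, and the second part
  cancels against \<open>\<beta>\<close>.\<close>

lemma beta_rate:
  fixes n :: nat and d1 d2 B \<Lambda> K\<^sub>0 \<sigma> :: real
  assumes n: "n \<ge> 1" and B: "B > 0" and d: "d1 > 0" "d2 > 0" and \<Lambda>: "\<Lambda> > 0" and K0: "K\<^sub>0 > 0" and \<sigma>: "\<sigma> > 0"
  defines "R \<equiv> B * (d1 * d2) powr (1/3) * \<Lambda> powr (7/6) / n powr (1/6)"
    and "L \<equiv> K\<^sub>0 * \<Lambda>"
  defines "\<beta> \<equiv> n powr (1/6) * L powr (1/3) / (8000 * B * (d1 * d2) powr (1/3))"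
  shows "L * sqrt L / (\<beta> * \<sigma>) = 8000 * K\<^sub>0 powr (7/6) / \<sigma> * R"
proof -
  have L0: "L > 0" using \<Lambda> K0 by (simp add: L_def)
  have "L * sqrt L = L powr 1 * L powr (1/2)" using L0 by (simp add: powr_half_sqrt)
  also have "\<dots> = L powr (7/6) * L powr (1/3)" unfolding powr_add[symmetric] by simp
  finally have "L * sqrt L = K\<^sub>0 powr (7/6) * \<Lambda> powr (7/6) * L powr (1/3)"
    using \<Lambda> K0 by (simp add: L_def powr_mult)
  then show ?thesis using n B d L0 \<sigma> by (simp add: \<beta>_def R_def mult_ac)
qed

lemma dependency_degrees:
  assumes dg: "dependency_graph p n M X E" and n: "n \<ge> 1"
  shows "degree1 n E \<ge> 1" "degree1 n E \<le> degree2 n E"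
proof -
  have "degree1 n E \<in> (\<lambda>t. card (nbhd n E t)) ` {1..n}"
    unfolding degree1_def using n by (intro Max_in) auto
  then obtain t where t: "t \<in> {1..n}" "degree1 n E = card (nbhd n E t)" by auto
  have "finite (nbhd n E t)" using nbhd_degree(1)[OF dg t(1)] finite_subset by blast
  then have "card {t} \<le> card (nbhd n E t)" using nbhd_degree(2)[OF dg t(1)] by (intro card_mono) auto
  then show "degree1 n E \<ge> 1" using t(2) by simp
  show "degree1 n E \<le> degree2 n E"
    using nbhd_degree(4)[OF dg t(1) nbhd_degree(2)[OF dg t(1)]] t(2) by simp
qed

text \<open>Half of the exponent beats the logarithm up to a factor 8, and the other half eventually
  exceeds the constant.\<close>

lemma eventually_ln_le_powr: "\<forall>\<^sub>F n in sequentially. C * ln (real n) \<le> real n powr (1/4)"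
proof -
  define x where "x = 8 * \<bar>C\<bar> + 1"
  have x: "x > 0" by (simp add: x_def)
  have "\<forall>\<^sub>F n in sequentially. 8 * \<bar>C\<bar> \<le> real n powr (1/8)"
    using eventually_ge_at_top[of "nat \<lceil>x ^ 8\<rceil>"]
  proof eventually_elim
    case (elim n)
    have "8 * \<bar>C\<bar> \<le> x" by (simp add: x_def)
    also have "x = x powr (real 8 * (1/8))" using x by simp
    also have "\<dots> = (x ^ 8) powr (1/8)" by (simp only: powr_powr[symmetric] powr_realpow[OF x])
    also have "\<dots> \<le> real n powr (1/8)"
    proof (rule powr_mono2)
      show "x ^ 8 \<le> real n" by (rule order.trans[OF real_nat_ceiling_ge of_nat_mono[OF elim]])
    qed (use x in simp_all)
    finally show ?case .
  qed
  then show ?thesis using eventually_ge_at_top[of 1]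
  proof eventually_elim
    case (elim n)
    have n0: "real n > 0" using elim by simp
    have "C * ln (real n) \<le> \<bar>C\<bar> * ln (real n)" using elim by (intro mult_right_mono) auto
    also have "ln (real n) \<le> real n powr (1/8) / (1/8)" using elim by (intro ln_powr_bound) auto
    also have "\<bar>C\<bar> * (real n powr (1/8) / (1/8)) = 8 * \<bar>C\<bar> * real n powr (1/8)" by simp
    also have "\<dots> \<le> real n powr (1/8) * real n powr (1/8)" using elim by (intro mult_right_mono) auto
    also have "\<dots> = real n powr (1/4)" by (simp flip: powr_add)
    finally show ?case by (simp add: mult_left_mono)
  qed
qed

text \<open>The constant is chosen before \<open>a\<close>, \<open>d\<close> and all sequences. Only
  the index from which the bound holds may depend on them, which the limes superior permits.\<close>

theorem theorem5:
  fixes \<kappa> \<gamma>\<^sub>1 K\<^sub>4 :: real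
  assumes "\<kappa> > 0" and "\<gamma>\<^sub>1 \<ge> 1" and "K\<^sub>4 > 0"
  shows "\<exists>c>0. \<forall>(a::real) (d::real) (p :: nat \<Rightarrow> nat) (M :: nat \<Rightarrow> 'a measure)
           (X :: nat \<Rightarrow> nat \<Rightarrow> 'a \<Rightarrow> nat \<Rightarrow> real) (N :: nat \<Rightarrow> (nat \<Rightarrow> real) measure)
           (E :: nat \<Rightarrow> (nat \<times> nat) set) (B :: nat \<Rightarrow> real)
           (\<A> :: nat \<Rightarrow> (nat \<Rightarrow> real) set set)
           (A\<^sub>K :: nat \<Rightarrow> (nat \<Rightarrow> real) set \<Rightarrow> (nat \<Rightarrow> real) set)
           (V :: nat \<Rightarrow> (nat \<Rightarrow> real) set \<Rightarrow> (nat \<Rightarrow> real) set).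
         a \<ge> 0 \<and> d > 0 \<and>
         (\<forall>n\<ge>1.
            real (p n) \<ge> real n powr \<kappa> \<and>
            prob_space (M n) \<and>
            (\<forall>t\<in>{1..n}. X n t \<in> M n \<rightarrow>\<^sub>M borel_vec (p n)) \<and>
            (\<forall>t\<in>{1..n}. \<forall>j<p n.
               integrable (M n) (\<lambda>\<omega>. X n t \<omega> j) \<and> (LINT \<omega>|M n. X n t \<omega> j) = 0) \<and>
            (\<forall>j<p n. integrable (M n) (\<lambda>\<omega>. (norm_sum (p n) n (X n) \<omega> j)\<^sup>2)) \<and>
            centered_normal (p n) (cov (M n) (norm_sum (p n) n (X n))) (N n) \<and>
            dependency_graph (p n) n (M n) (X n) (E n) \<and>
            \<A> n \<subseteq> simple_convex (p n) n a d \<and> \<A> n \<subseteq> sets (borel_vec (p n)) \<and>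
            (\<forall>A\<in>\<A> n. approximates (p n) n a d (A\<^sub>K n A) (V n A) A) \<and>
            B n \<ge> 1 \<and>
            (\<forall>A\<in>\<A> n. \<forall>t\<in>{1..n}. \<forall>v\<in>V n A.
               psi_norm (M n) \<gamma>\<^sub>1 (\<lambda>\<omega>. dot (p n) v (X n t \<omega>)) \<le> ereal (B n)) \<and>
            (\<forall>A\<in>\<A> n. \<forall>v\<in>V n A.
               prob_space.variance (M n)
                 (\<lambda>\<omega>. (\<Sum>t=1..n. dot (p n) v (X n t \<omega>)) / sqrt (real n)) \<ge> K\<^sub>4))
         \<longrightarrow>
         limsup (\<lambda>n.
            rho (p n) n (M n) (X n) (N n) (\<A> n) /
            ereal (a * (d * ln (real (p n))) powr (1/2) / real n
                   + B n * (real (degree1 n (E n)) * real (degree2 n (E n))) powr (1/3)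
                       * (d * ln (real (p n))) powr (7/6) / real n powr (1/6)))
         \<le> ereal c"
proof -
  \<comment> \<open>The count of normals involves \<open>ln p + ln n\<close>; the growth condition
    gives \<open>ln n \<le> ln p / \<kappa>\<close>, so \<open>K\<^sub>0 * ln p\<close> dominates
    it.\<close>
  define K\<^sub>0 where "K\<^sub>0 = 1 + 1 / \<kappa>"
  define \<sigma> where "\<sigma> = sqrt K\<^sub>4"
  \<comment> \<open>The summands belong to the smoothing error, to the exponentially small error and
    to the enlargement of the sets. The middle one also makes \<open>c \<ge> 1\<close>.\<close>
  define c where "c = 420 * (8000 * K\<^sub>0 powr (7/6) / \<sigma>) + 1 + 45 * sqrt K\<^sub>0 / \<sigma>"
  have K0: "K\<^sub>0 \<ge> 1" using assms(1) by (simp add: K\<^sub>0_def)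
  have \<sigma>: "\<sigma> > 0" "\<sigma>\<^sup>2 = K\<^sub>4" using assms(3) by (simp_all add: \<sigma>_def)
  have c_parts: "420 * (8000 * K\<^sub>0 powr (7/6) / \<sigma>) \<ge> 0" "45 * sqrt K\<^sub>0 / \<sigma> \<ge> 0"
    using K0 \<sigma> by simp_all
  then have c: "c \<ge> 1" by (simp add: c_def)
  show ?thesis
  proof (intro exI[of _ c] conjI allI impI)
    show "c > 0" using c by simp
    fix a d :: real and p :: "nat \<Rightarrow> nat" and M :: "nat \<Rightarrow> 'a measure" and X :: "nat \<Rightarrow> nat \<Rightarrow> 'a \<Rightarrow> nat \<Rightarrow> real"
      and N :: "nat \<Rightarrow> (nat \<Rightarrow> real) measure" and E :: "nat \<Rightarrow> (nat \<times> nat) set" and B :: "nat \<Rightarrow> real"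
      and \<A> :: "nat \<Rightarrow> (nat \<Rightarrow> real) set set" and A\<^sub>K V :: "nat \<Rightarrow> (nat \<Rightarrow> real) set \<Rightarrow> (nat \<Rightarrow> real) set"
    assume H: "a \<ge> 0 \<and> d > 0 \<and>
         (\<forall>n\<ge>1.
            real (p n) \<ge> real n powr \<kappa> \<and>
            prob_space (M n) \<and>
            (\<forall>t\<in>{1..n}. X n t \<in> M n \<rightarrow>\<^sub>M borel_vec (p n)) \<and>
            (\<forall>t\<in>{1..n}. \<forall>j<p n.
               integrable (M n) (\<lambda>\<omega>. X n t \<omega> j) \<and> (LINT \<omega>|M n. X n t \<omega> j) = 0) \<and>
            (\<forall>j<p n. integrable (M n) (\<lambda>\<omega>. (norm_sum (p n) n (X n) \<omega> j)\<^sup>2)) \<and>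
            centered_normal (p n) (cov (M n) (norm_sum (p n) n (X n))) (N n) \<and>
            dependency_graph (p n) n (M n) (X n) (E n) \<and>
            \<A> n \<subseteq> simple_convex (p n) n a d \<and> \<A> n \<subseteq> sets (borel_vec (p n)) \<and>
            (\<forall>A\<in>\<A> n. approximates (p n) n a d (A\<^sub>K n A) (V n A) A) \<and>
            B n \<ge> 1 \<and>
            (\<forall>A\<in>\<A> n. \<forall>t\<in>{1..n}. \<forall>v\<in>V n A.
               psi_norm (M n) \<gamma>\<^sub>1 (\<lambda>\<omega>. dot (p n) v (X n t \<omega>)) \<le> ereal (B n)) \<and>
            (\<forall>A\<in>\<A> n. \<forall>v\<in>V n A.
               prob_space.variance (M n)
                 (\<lambda>\<omega>. (\<Sum>t=1..n. dot (p n) v (X n t \<omega>)) / sqrt (real n)) \<ge> K\<^sub>4))"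
    have a: "a \<ge> 0" and d: "d > 0" using H by auto
    define \<Lambda> where "\<Lambda> n = d * ln (real (p n))" for n
    define R1 where "R1 n = a * \<Lambda> n powr (1/2) / real n" for n
    define R2 where "R2 n = B n * (real (degree1 n (E n)) * real (degree2 n (E n))) powr (1/3) * \<Lambda> n powr (7/6) / real n powr (1/6)" for n
    \<comment> \<open>Combines what is required of \<open>\<Lambda> n\<close>: being at least 1, so
      that \<open>L \<ge> 1\<close>, and the threshold in \<open>rate_err_le\<close>.\<close>
    define C where "C = max 1 ((8 * K\<^sub>0\<^sup>2)\<^sup>2)"
    have lnp: "\<kappa> * ln (real n) \<le> ln (real (p n))" and p1: "real (p n) \<ge> 1" if "n \<ge> 1" for n
    proof -
      have pn: "real n powr \<kappa> \<le> real (p n)" using H that by blast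
      have "1 \<le> real n powr \<kappa>" using that assms(1) by (intro ge_one_powr_ge_zero) auto
      then show "real (p n) \<ge> 1" using pn by linarith
      have "ln (real n powr \<kappa>) \<le> ln (real (p n))"
        using pn that by (subst ln_le_cancel_iff) (use \<open>1 \<le> real n powr \<kappa>\<close> in linarith)+
      then show "\<kappa> * ln (real n) \<le> ln (real (p n))" using that by (simp add: ln_powr)
    qed
    have "filterlim (\<lambda>n. ln (real n)) at_top sequentially"
      by (rule filterlim_compose[OF ln_at_top filterlim_real_sequentially])
    then have "\<forall>\<^sub>F n in sequentially. C / (d * \<kappa>) \<le> ln (real n)"
      unfolding filterlim_at_top by blast
    then have "\<forall>\<^sub>F n in sequentially. n \<ge> 1 \<and> \<Lambda> n \<ge> C \<and> 8 * K\<^sub>0 * ln (real n) \<le> real n powr (1/4)"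
      using eventually_ge_at_top[of 1] eventually_ln_le_powr[of "8 * K\<^sub>0"]
    proof eventually_elim
      case (elim n)
      have "C \<le> d * (\<kappa> * ln (real n))" using elim(1) d assms(1) by (simp add: field_simps)
      also have "\<dots> \<le> \<Lambda> n" unfolding \<Lambda>_def using d lnp[OF elim(2)] by (intro mult_left_mono) auto
      finally show ?case using elim by simp
    qed
    then have "\<forall>\<^sub>F n in sequentially. rho (p n) n (M n) (X n) (N n) (\<A> n) / ereal (R1 n + R2 n) \<le> ereal c"
    proof (rule eventually_mono)
      fix n assume hyp: "n \<ge> 1 \<and> \<Lambda> n \<ge> C \<and> 8 * K\<^sub>0 * ln (real n) \<le> real n powr (1/4)"
      then have n: "n \<ge> 1" and \<Lambda>C: "\<Lambda> n \<ge> C" and q: "8 * K\<^sub>0 * ln (real n) \<le> real n powr (1/4)" by auto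
      have \<Lambda>1: "\<Lambda> n \<ge> 1" "\<Lambda> n \<ge> (8 * K\<^sub>0\<^sup>2)\<^sup>2" using \<Lambda>C by (auto simp: C_def)
      from H n have
        Mp: "prob_space (M n)" and
        Xm: "\<And>t. t \<in> {1..n} \<Longrightarrow> X n t \<in> M n \<rightarrow>\<^sub>M borel_vec (p n)" and
        Xi: "\<And>t j. t \<in> {1..n} \<Longrightarrow> j < p n \<Longrightarrow> integrable (M n) (\<lambda>\<omega>. X n t \<omega> j)" and
        X0: "\<And>t j. t \<in> {1..n} \<Longrightarrow> j < p n \<Longrightarrow> (LINT \<omega>|M n. X n t \<omega> j) = 0" and
        sq: "\<And>j. j < p n \<Longrightarrow> integrable (M n) (\<lambda>\<omega>. (norm_sum (p n) n (X n) \<omega> j)\<^sup>2)" and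
        Nn: "centered_normal (p n) (cov (M n) (norm_sum (p n) n (X n))) (N n)" and
        dg: "dependency_graph (p n) n (M n) (X n) (E n)" and
        Asc: "\<A> n \<subseteq> simple_convex (p n) n a d" and Am: "\<A> n \<subseteq> sets (borel_vec (p n))" and
        Aap: "\<And>A. A \<in> \<A> n \<Longrightarrow> approximates (p n) n a d (A\<^sub>K n A) (V n A) A" and
        B1: "B n \<ge> 1" and
        psi: "\<And>A t v. A \<in> \<A> n \<Longrightarrow> t \<in> {1..n} \<Longrightarrow> v \<in> V n A \<Longrightarrow> psi_norm (M n) \<gamma>\<^sub>1 (\<lambda>\<omega>. dot (p n) v (X n t \<omega>)) \<le> ereal (B n)" and
        var: "\<And>A v. A \<in> \<A> n \<Longrightarrow> v \<in> V n A \<Longrightarrow> prob_space.variance (M n)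
                 (\<lambda>\<omega>. (\<Sum>t=1..n. dot (p n) v (X n t \<omega>)) / sqrt (real n)) \<ge> \<sigma>\<^sup>2"
        unfolding \<sigma>(2) by blast+
      let ?d1 = "real (degree1 n (E n))" and ?d2 = "real (degree2 n (E n))"
      have d12: "?d1 \<ge> 1" "?d2 \<ge> ?d1" using dependency_degrees[OF dg n] by auto
      have R1_nonneg: "R1 n \<ge> 0" using a by (simp add: R1_def)
      have R2_pos: "R2 n > 0" unfolding R2_def using B1 d12 \<Lambda>1 n by simp
      define L where "L = K\<^sub>0 * \<Lambda> n"
      define \<beta> where "\<beta> = n powr (1/6) * L powr (1/3) / (8000 * B n * (?d1 * ?d2) powr (1/3))"
      have L1: "L \<ge> 1" unfolding L_def using K0 \<Lambda>1 mult_mono[of 1 K\<^sub>0 1 "\<Lambda> n"] by simp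
      have \<beta>0: "\<beta> > 0" unfolding \<beta>_def using L1 B1 d12 n by simp
      have L2: "d * (ln (p n) + ln n) \<le> L"
      proof -
        have "ln (real n) \<le> ln (real (p n)) / \<kappa>" using lnp[OF n] assms(1) by (simp add: field_simps)
        then have "d * (ln (p n) + ln n) \<le> d * (ln (p n) + ln (real (p n)) / \<kappa>)"
          using d by (intro mult_left_mono add_left_mono) auto
        also have "\<dots> = L" by (simp add: L_def \<Lambda>_def K\<^sub>0_def algebra_simps)
        finally show ?thesis .
      qed
      have small: "8 * (5054400000 * (?d1 * ?d2 * (\<beta>^3 * (2 * B n)^3) / (L * sqrt n))) \<le> 1"
        unfolding \<beta>_def by (rule beta_small[OF n]) (use B1 d12 L1 in auto)
      have rate: "L * sqrt L / (\<beta> * \<sigma>) = 8000 * K\<^sub>0 powr (7/6) / \<sigma> * R2 n"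
        unfolding \<beta>_def R2_def L_def by (rule beta_rate[OF n]) (use B1 d12 \<Lambda>1 K0 \<sigma> in auto)
      have "\<bar>measure (M n) {\<omega> \<in> space (M n). norm_sum (p n) n (X n) \<omega> \<in> A} - measure (N n) A\<bar> \<le> c * (R1 n + R2 n)"
        if A: "A \<in> \<A> n" for A
      \<comment> \<open>A rate of at least 1 makes the bound trivial, since probabilities differ by
        at most 1 and \<open>c \<ge> 1\<close>. The other case supplies the condition under which
        the exponential error is below the rate.\<close>
      proof (cases "R2 n < 1")
        case False
        interpret Mn: prob_space "M n" by (rule Mp)
        obtain k :: nat and Lm :: "nat \<Rightarrow> nat \<Rightarrow> real" where N_eq: "N n = distr (gaussP {..<k}) (borel_vec (p n)) (\<lambda>z. \<lambda>i\<in>{..<p n}. \<Sum>l<k. Lm i l * z l)"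
          using Nn unfolding centered_normal_def by blast
        have "prob_space (N n)" unfolding N_eq borel_vec_def
          by (intro prob_space.prob_space_distr[OF prob_space_gaussP] measurable_restrict gaussP_linear_measurable)
        then have "0 \<le> measure (N n) A" "measure (N n) A \<le> 1" by (auto intro: prob_space.prob_le_1)
        moreover have "0 \<le> Mn.prob {\<omega> \<in> space (M n). norm_sum (p n) n (X n) \<omega> \<in> A}"
          "Mn.prob {\<omega> \<in> space (M n). norm_sum (p n) n (X n) \<omega> \<in> A} \<le> 1" by auto
        ultimately have "\<bar>Mn.prob {\<omega> \<in> space (M n). norm_sum (p n) n (X n) \<omega> \<in> A} - measure (N n) A\<bar> \<le> 1" by linarith
        also have "\<dots> \<le> 1 * (R1 n + R2 n)" using False R1_nonneg by simp
        also have "\<dots> \<le> c * (R1 n + R2 n)" using c R1_nonneg R2_pos by (intro mult_right_mono) auto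
        finally show ?thesis .
      next
        case True
        have err: "rate_err n ?d1 (exp L) \<beta> (2 * B n) \<le> R2 n"
          unfolding \<beta>_def R2_def L_def
          by (rule rate_err_le[OF n B1 d12 K0 \<Lambda>1(2) q True[unfolded R2_def]])
        have "\<bar>measure (M n) {\<omega> \<in> space (M n). norm_sum (p n) n (X n) \<omega> \<in> A} - measure (N n) A\<bar>
          \<le> 420 * (L * sqrt L / (\<beta> * \<sigma>)) + rate_err n ?d1 (exp L) \<beta> (2 * B n) + 45 * sqrt L * (a / n) / \<sigma>"
        proof (rule simple_convex_bound[OF n Mp _ _ _ _ Nn dg _ assms(2) Aap[OF A] _ _ _ \<sigma>(1) _ a _ L1 L2 \<beta>0 small])
          show "A \<subseteq> vecs (p n)" using A Asc by (auto simp: simple_convex_def)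
          show "A \<in> sets (borel_vec (p n))" using A Am by auto
          show "1 \<le> p n" using p1[OF n] by simp
          show "0 < B n" using B1 by simp
        qed (fact Xm Xi X0 sq psi[OF A] var[OF A])+
        also have "\<dots> \<le> 420 * (8000 * K\<^sub>0 powr (7/6) / \<sigma>) * R2 n + R2 n + 45 * sqrt K\<^sub>0 / \<sigma> * R1 n"
        proof -
          have "45 * sqrt L * (a / n) / \<sigma> = 45 * sqrt K\<^sub>0 / \<sigma> * R1 n"
            using \<Lambda>1 by (simp add: L_def R1_def real_sqrt_mult powr_half_sqrt mult_ac)
          then show ?thesis using err rate by simp
        qed
        also have "\<dots> \<le> c * (R1 n + R2 n)"
        proof -
          let ?x = "420 * (8000 * K\<^sub>0 powr (7/6) / \<sigma>)" and ?y = "45 * sqrt K\<^sub>0 / \<sigma>"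
          have "0 \<le> ?x * R1 n" "0 \<le> ?y * R2 n" using c_parts R1_nonneg R2_pos by (simp_all only: mult_nonneg_nonneg less_imp_le)
          moreover have "c * (R1 n + R2 n) = ?x * R1 n + ?x * R2 n + R1 n + R2 n + ?y * R1 n + ?y * R2 n"
            unfolding c_def by (simp only: distrib_left distrib_right mult_1 add_ac)
          ultimately show ?thesis using R1_nonneg by linarith
        qed
        finally show ?thesis .
      qed
      then have "rho (p n) n (M n) (X n) (N n) (\<A> n) \<le> ereal (c * (R1 n + R2 n))"
        unfolding rho_def by (intro SUP_least) simp
      moreover have "R1 n + R2 n > 0" using R1_nonneg R2_pos by simp
      ultimately show "rho (p n) n (M n) (X n) (N n) (\<A> n) / ereal (R1 n + R2 n) \<le> ereal c"
        by (subst ereal_divide_le_pos) (auto simp: mult.commute)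
    qed
    then show "limsup (\<lambda>n.
            rho (p n) n (M n) (X n) (N n) (\<A> n) /
            ereal (a * (d * ln (real (p n))) powr (1/2) / real n
                   + B n * (real (degree1 n (E n)) * real (degree2 n (E n))) powr (1/3)
                       * (d * ln (real (p n))) powr (7/6) / real n powr (1/6)))
         \<le> ereal c"
      unfolding R1_def R2_def \<Lambda>_def by (rule Limsup_bounded)
  qed
qed

end
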